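(* Let $\epsilon>0$ be fixed. Let $G=(V,E)$ be an undirected graph with $m$ edges and $n$ vertices, let $w:V\to\mathbb{R}_{>0}$ be positive vertex weights, let $W=\sum_{v\in V}w(v)$, and let $\kappa$ be the minimum weight of a vertex cut of $G$. Then a $(1+\epsilon)$-approximate minimum weight vertex cut can be computed with high probability in $\tilde{O}\big((1/\epsilon)\,T_{ivc}(m,n)\min\{1/\epsilon,\ W/(W-\kappa)\}\big)$ randomized time, where $T_{ivc}(m,n)$ is the running time to compute the minimum isolating vertex cut in a weighted graph with $m$ edges and $n$ vertices.
   Context: A vertex cut is a set $C\subseteq V$ such that $G-C$ has at least two connected components; its weight is $w(C)=\sum_{v\in C}w(v)$. A $(1+\epsilon)$-approximate minimum vertex cut is a vertex cut of weight at most $(1+\epsilon)\kappa$. For an independent set $R\subseteq V$, the minimum $R$-isolating vertex cut is a minimum weight set $C\subseteq V\setminus R$ such that for some $r\in R$, $C$ separates $r$ from every vertex of $R\setminus\{r\}$ in $G-C$. $\tilde O$ hides polylogarithmic factors.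
   Formalization: It is additionally assumed that T_ivc(m,n) ≥ δ(m+n) for some δ > 0 (running time covers reading the input); without this the claim fails, e.g. for complete graphs minus one edge given by an unordered edge list. *)

theory Defs
  imports "HOL-Probability.Probability"
begin

section \<open>Vertex cuts and isolating vertex cuts\<close>

definition simple_graph :: "'a set \<Rightarrow> 'a set set \<Rightarrow> bool" where
  "simple_graph V E \<longleftrightarrow> finite V \<and> (\<forall>e\<in>E. \<exists>u\<in>V. \<exists>v\<in>V. u \<noteq> v \<and> e = {u, v})"

text \<open>Pairs of vertices joined by a path of \<open>G - C\<close>; the pairs \<open>(v, v)\<close> are always included.\<close>

definition joined :: "'a set set \<Rightarrow> 'a set \<Rightarrow> ('a \<times> 'a) set" where
  "joined E C = {(u, v). {u, v} \<in> E \<and> u \<notin> C \<and> v \<notin> C}\<^sup>*"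

definition components_minus :: "'a set \<Rightarrow> 'a set set \<Rightarrow> 'a set \<Rightarrow> 'a set set" where
  "components_minus V E C = (\<lambda>v. {u \<in> V - C. (v, u) \<in> joined E C}) ` (V - C)"

definition vertex_cut :: "'a set \<Rightarrow> 'a set set \<Rightarrow> 'a set \<Rightarrow> bool" where
  "vertex_cut V E C \<longleftrightarrow> C \<subseteq> V \<and> card (components_minus V E C) \<ge> 2"

definition min_cut_weight :: "'a set \<Rightarrow> 'a set set \<Rightarrow> ('a \<Rightarrow> real) \<Rightarrow> real" where
  "min_cut_weight V E w = Min {sum w C | C. vertex_cut V E C}"

definition approx_min_vertex_cut ::
    "'a set \<Rightarrow> 'a set set \<Rightarrow> ('a \<Rightarrow> real) \<Rightarrow> real \<Rightarrow> 'a set \<Rightarrow> bool" where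
  "approx_min_vertex_cut V E w \<epsilon> C \<longleftrightarrow>
     vertex_cut V E C \<and> sum w C \<le> (1 + \<epsilon>) * min_cut_weight V E w"

definition independent_set :: "'a set \<Rightarrow> 'a set set \<Rightarrow> 'a set \<Rightarrow> bool" where
  "independent_set V E R \<longleftrightarrow> R \<subseteq> V \<and> (\<forall>u\<in>R. \<forall>v\<in>R. {u, v} \<notin> E)"

definition isolating_cut :: "'a set \<Rightarrow> 'a set set \<Rightarrow> 'a set \<Rightarrow> 'a set \<Rightarrow> bool" where
  "isolating_cut V E R C \<longleftrightarrow>
     C \<subseteq> V - R \<and> (\<exists>r\<in>R. \<forall>s\<in>R - {r}. (r, s) \<notin> joined E C)"

definition min_isolating_cut ::
    "'a set \<Rightarrow> 'a set set \<Rightarrow> ('a \<Rightarrow> real) \<Rightarrow> 'a set \<Rightarrow> 'a set \<Rightarrow> bool" where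
  "min_isolating_cut V E w R C \<longleftrightarrow>
     isolating_cut V E R C \<and> (\<forall>D. isolating_cut V E R D \<longrightarrow> sum w C \<le> sum w D)"


section \<open>A randomized real RAM\<close>

text \<open>
  Running time is measured on a structured random access machine with unit costs. Its memory
  consists of named arrays of integers and named arrays of reals; a scalar is entry 0 of an array.
  As usual for a real RAM, real arithmetic is exact and there is no rounding operation from reals to
  integers. Integer arithmetic is restricted to addition and subtraction. Programs are finite syntax
  trees whose only literals are integers, so that a program cannot carry non-uniform advice.
\<close>

type_synonym vname = string

record store =
  ints :: "vname \<Rightarrow> int \<Rightarrow> int"
  reals :: "vname \<Rightarrow> int \<Rightarrow> real"

datatype iexp = N int | IVal vname iexp | IAdd iexp iexp | ISub iexp iexp

datatype rexp = OfInt iexp | RVal vname iexp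
  | RAdd rexp rexp | RSub rexp rexp | RMul rexp rexp | RDiv rexp rexp

datatype bexp = ILess iexp iexp | RLess rexp rexp | Not bexp | And bexp bexp

text \<open>
  \<open>Rand x i k\<close> stores a uniformly random element of \<open>{0..<k}\<close> in \<open>x[i]\<close> (and 0 if
  \<open>k \<le> 0\<close>). \<open>Call xs c ys\<close> is a procedure call with body \<open>c\<close>: the body runs on a fresh, zero
  store that receives the arrays named in \<open>xs\<close> from the caller, and on return only the arrays named
  in \<open>ys\<close> are handed back. It costs one step plus the steps of the body; with lazily initialized
  memory and a log of the body's writes, this is accurate up to a constant factor.
\<close>

datatype com = Skip
  | ISet vname iexp iexp
  | RSet vname iexp rexp
  | Rand vname iexp iexp
  | Seq com com
  | If bexp com com
  | While bexp com
  | Call "vname list" com "vname list"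

primrec ieval :: "iexp \<Rightarrow> store \<Rightarrow> int" where
  "ieval (N k) s = k"
| "ieval (IVal x i) s = ints s x (ieval i s)"
| "ieval (IAdd a b) s = ieval a s + ieval b s"
| "ieval (ISub a b) s = ieval a s - ieval b s"

primrec reval :: "rexp \<Rightarrow> store \<Rightarrow> real" where
  "reval (OfInt i) s = real_of_int (ieval i s)"
| "reval (RVal x i) s = reals s x (ieval i s)"
| "reval (RAdd a b) s = reval a s + reval b s"
| "reval (RSub a b) s = reval a s - reval b s"
| "reval (RMul a b) s = reval a s * reval b s"
| "reval (RDiv a b) s = reval a s / reval b s"

primrec beval :: "bexp \<Rightarrow> store \<Rightarrow> bool" where
  "beval (ILess a b) s \<longleftrightarrow> ieval a s < ieval b s"
| "beval (RLess a b) s \<longleftrightarrow> reval a s < reval b s"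
| "beval (Not b) s \<longleftrightarrow> \<not> beval b s"
| "beval (And a b) s \<longleftrightarrow> beval a s \<and> beval b s"

definition iupd :: "vname \<Rightarrow> int \<Rightarrow> int \<Rightarrow> store \<Rightarrow> store" where
  "iupd x i k s = s\<lparr>ints := (ints s)(x := (ints s x)(i := k))\<rparr>"

definition rupd :: "vname \<Rightarrow> int \<Rightarrow> real \<Rightarrow> store \<Rightarrow> store" where
  "rupd x i r s = s\<lparr>reals := (reals s)(x := (reals s x)(i := r))\<rparr>"

definition zero_store :: store where
  "zero_store = \<lparr>ints = (\<lambda>_ _. 0), reals = (\<lambda>_ _. 0)\<rparr>"

text \<open>The store that takes the arrays named in \<open>xs\<close> from \<open>s\<close> and all others from \<open>s'\<close>.\<close>

definition transfer_arrays :: "vname list \<Rightarrow> store \<Rightarrow> store \<Rightarrow> store" where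
  "transfer_arrays xs s s' =
     \<lparr>ints = (\<lambda>x. if x \<in> set xs then ints s x else ints s' x),
      reals = (\<lambda>x. if x \<in> set xs then reals s x else reals s' x)\<rparr>"

text \<open>
  The meaning of a program on a store is the subprobability distribution of the pair of its running
  time and its final store; the missing mass is the probability of nontermination.
\<close>

partial_function (spmf) loop ::
    "(store \<Rightarrow> bool) \<Rightarrow> (store \<Rightarrow> (nat \<times> store) spmf) \<Rightarrow> store \<Rightarrow> (nat \<times> store) spmf" where
  "loop b f s =
     (if b s
      then bind_spmf (f s) (\<lambda>p. map_spmf (\<lambda>q. (1 + fst p + fst q, snd q)) (loop b f (snd p)))
      else return_spmf (1, s))"

primrec exec :: "com \<Rightarrow> store \<Rightarrow> (nat \<times> store) spmf" where
  "exec Skip s = return_spmf (1, s)"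
| "exec (ISet x i e) s = return_spmf (1, iupd x (ieval i s) (ieval e s) s)"
| "exec (RSet x i e) s = return_spmf (1, rupd x (ieval i s) (reval e s) s)"
| "exec (Rand x i k) s =
     map_spmf (\<lambda>j. (1, iupd x (ieval i s) j s)) (spmf_of_set {0..<max 1 (ieval k s)})"
| "exec (Seq c d) s =
     bind_spmf (exec c s) (\<lambda>p. map_spmf (\<lambda>q. (fst p + fst q, snd q)) (exec d (snd p)))"
| "exec (If b c d) s =
     map_spmf (\<lambda>p. (1 + fst p, snd p)) (if beval b s then exec c s else exec d s)"
| "exec (While b c) s = loop (beval b) (exec c) s"
| "exec (Call xs c ys) s =
     map_spmf (\<lambda>p. (1 + fst p, transfer_arrays ys (snd p) s))
       (exec c (transfer_arrays xs s zero_store))"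

definition run_prob :: "com \<Rightarrow> store \<Rightarrow> (nat \<Rightarrow> store \<Rightarrow> bool) \<Rightarrow> real" where
  "run_prob c s A = measure (measure_spmf (exec c s)) {(t, s'). A t s'}"


section \<open>Inputs and outputs\<close>

text \<open>
  The vertices are \<open>0, \<dots>, n - 1\<close>. A graph is given by a list of its edges, each listed once, in
  arbitrary order and orientation. A vertex set is given by its 0/1 indicator array.
\<close>

definition lists_edges :: "(nat \<times> nat) list \<Rightarrow> nat set set \<Rightarrow> bool" where
  "lists_edges es E \<longleftrightarrow>
     distinct (map (\<lambda>(u, v). {u, v}) es) \<and> set (map (\<lambda>(u, v). {u, v}) es) = E"

definition arr :: "'b::zero list \<Rightarrow> int \<Rightarrow> 'b" where
  "arr xs i = (if 0 \<le> i \<and> i < int (length xs) then xs ! nat i else 0)"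

definition graph_store :: "nat \<Rightarrow> (nat \<times> nat) list \<Rightarrow> (nat \<Rightarrow> real) \<Rightarrow> store" where
  "graph_store n es w =
     \<lparr>ints = (\<lambda>_ _. 0)
        (''n'' := arr [int n],
         ''m'' := arr [int (length es)],
         ''src'' := arr (map (\<lambda>e. int (fst e)) es),
         ''dst'' := arr (map (\<lambda>e. int (snd e)) es)),
      reals = (\<lambda>_ _. 0)(''w'' := arr (map w [0..<n]))\<rparr>"

definition ivc_store :: "nat \<Rightarrow> (nat \<times> nat) list \<Rightarrow> (nat \<Rightarrow> real) \<Rightarrow> nat set \<Rightarrow> store" where
  "ivc_store n es w R =
     (graph_store n es w)
       \<lparr>ints := (ints (graph_store n es w))
          (''R'' := arr (map (\<lambda>v. if v \<in> R then 1 else 0) [0..<n]))\<rparr>"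

definition cut_store :: "nat \<Rightarrow> (nat \<times> nat) list \<Rightarrow> (nat \<Rightarrow> real) \<Rightarrow> real \<Rightarrow> store" where
  "cut_store n es w \<epsilon> =
     (graph_store n es w)
       \<lparr>reals := (reals (graph_store n es w))(''eps'' := arr [\<epsilon>])\<rparr>"

definition output_set :: "nat \<Rightarrow> store \<Rightarrow> nat set" where
  "output_set n s = {v. v < n \<and> ints s ''C'' (int v) \<noteq> 0}"

text \<open>
  \<open>T m n\<close> bounds the running time of \<open>Q\<close> on all graphs with \<open>m\<close> edges and \<open>n\<close> vertices. The set
  \<open>R\<close> must be nonempty for an isolating cut to exist.
\<close>

definition computes_min_isolating_cut :: "com \<Rightarrow> (nat \<Rightarrow> nat \<Rightarrow> real) \<Rightarrow> bool" where
  "computes_min_isolating_cut Q T \<longleftrightarrow>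
     (\<forall>n E es w R.
        simple_graph {..<n} E \<longrightarrow> lists_edges es E \<longrightarrow> (\<forall>v<n. 0 < w v) \<longrightarrow>
        independent_set {..<n} E R \<longrightarrow> R \<noteq> {} \<longrightarrow>
        run_prob Q (ivc_store n es w R)
          (\<lambda>t s. real t \<le> T (card E) n \<and> min_isolating_cut {..<n} E w R (output_set n s)) = 1)"

end

theory Submission
  imports Defs
begin

text \<open>
  Let \<open>C\<close> be a minimum vertex cut with sides \<open>S\<close> and \<open>D\<close>. If a vertex sample \<open>R\<close> misses \<open>C\<close>,
  meets \<open>S\<close> exactly once and meets \<open>D\<close>, then scanning the edges once and dropping one endpoint of
  every edge inside \<open>R\<close> makes \<open>R\<close> independent and preserves these properties, so that \<open>C\<close> isolates
  the vertex of \<open>S\<close> and a minimum isolating cut has weight at most \<open>\<kappa>\<close>. If one side has weight below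
  \<open>\<epsilon> \<kappa>\<close>, the neighbourhood of any of its vertices is a \<open>(1 + \<epsilon>)\<close>-approximation. Otherwise,
  sampling \<open>v\<close> with probability proportional to \<open>min (w v) B\<close>, for a bound \<open>B \<ge> \<kappa>\<close> and at the
  right scale, succeeds with probability of order \<open>\<epsilon> max \<epsilon> ((W - \<kappa>) / W)\<close>. Weights are capped at \<open>B\<close>
  so that a random choice among \<open>O(log n)\<close> scales suffices once \<open>B \<le> n \<kappa>\<close>.

  Such a \<open>B\<close> is the weight of a cut found by a randomized binary search for the largest weight \<open>b\<close>
  occurring in \<open>C\<close>. For \<open>M \<ge> b\<close>, either some vertex has all its neighbours of weight at most \<open>M\<close>, or the
  vertices heavier than \<open>M\<close> are separated by the others; in the latter case, sampling the heavy
  vertices uniformly yields a cut of weight at most \<open>n M\<close>. Failure to find such a cut certifies, with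
  high probability, that \<open>M < b\<close>.

  Since \<open>\<kappa>\<close> is unknown, the number of rounds is governed by the best cut found so far. Its weight
  is at least \<open>\<kappa>\<close>, so enough rounds are made in any case, and once the target is found the bound is
  within a factor of two of the intended one.
\<close>

section \<open>Expected failure and almost sure termination\<close>

abbreviation outcome :: "(nat \<Rightarrow> store \<Rightarrow> ennreal) \<Rightarrow> (nat \<times> store) option \<Rightarrow> ennreal" where
  "outcome f \<equiv> \<lambda>x. case x of None \<Rightarrow> 1 | Some (t, s) \<Rightarrow> f t s"

definition expf :: "com \<Rightarrow> store \<Rightarrow> (nat \<Rightarrow> store \<Rightarrow> ennreal) \<Rightarrow> ennreal" where
  "expf c s f = (\<integral>\<^sup>+x. outcome f x \<partial>measure_pmf (exec c s))"

definition AS :: "com \<Rightarrow> store \<Rightarrow> (nat \<Rightarrow> store \<Rightarrow> bool) \<Rightarrow> bool" where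
  "AS c s Q \<longleftrightarrow> (\<forall>x\<in>set_pmf (exec c s). \<exists>t s'. x = Some (t, s') \<and> Q t s')"

abbreviation fails :: "(nat \<Rightarrow> store \<Rightarrow> bool) \<Rightarrow> nat \<Rightarrow> store \<Rightarrow> ennreal" where
  "fails Q \<equiv> \<lambda>t s. if Q t s then 0 else 1"

lemma AS_mono: "AS c s Q \<Longrightarrow> (\<And>t s'. Q t s' \<Longrightarrow> Q' t s') \<Longrightarrow> AS c s Q'"
  unfolding AS_def by blast

lemma expf_mono: "(\<And>t s'. f t s' \<le> g t s') \<Longrightarrow> expf c s f \<le> expf c s g"
  unfolding expf_def by (intro nn_integral_mono) (auto split: option.splits)

lemma expf_mono_AS:
  assumes "AS c s Q" "\<And>t s'. Q t s' \<Longrightarrow> f t s' \<le> g t s'"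
  shows "expf c s f \<le> expf c s g"
  unfolding expf_def
proof (rule nn_integral_mono_AE, unfold AE_measure_pmf_iff, rule ballI)
  fix x assume "x \<in> set_pmf (exec c s)"
  then obtain t s' where "x = Some (t, s')" "Q t s'"
    using assms(1) unfolding AS_def by blast
  then show "outcome f x \<le> outcome g x"
    using assms(2) by simp
qed

lemma expf_AS_le:
  assumes "AS c s Q" "\<And>t s'. Q t s' \<Longrightarrow> f t s' \<le> e"
  shows "expf c s f \<le> e"
proof -
  have "expf c s f \<le> (\<integral>\<^sup>+x. e \<partial>measure_pmf (exec c s))"
    unfolding expf_def
  proof (rule nn_integral_mono_AE, unfold AE_measure_pmf_iff, rule ballI)
    fix x assume "x \<in> set_pmf (exec c s)"
    then obtain t s' where "x = Some (t, s')" "Q t s'"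
      using assms(1) unfolding AS_def by blast
    then show "outcome f x \<le> e"
      using assms(2) by simp
  qed
  then show ?thesis by simp
qed

lemma expf_le_1: "(\<And>t s'. f t s' \<le> 1) \<Longrightarrow> expf c s f \<le> 1"
proof -
  assume "\<And>t s'. f t s' \<le> 1"
  then have "expf c s f \<le> (\<integral>\<^sup>+x. 1 \<partial>measure_pmf (exec c s))"
    unfolding expf_def by (intro nn_integral_mono) (auto split: option.splits)
  then show ?thesis by simp
qed

lemma expf_cmult_le:
  assumes "e \<le> 1" "AS c s (\<lambda>_ _. True)"
  shows "expf c s (\<lambda>t s'. e * f t s') \<le> e * expf c s f"
proof -
  have "expf c s (\<lambda>t s'. e * f t s') = (\<integral>\<^sup>+x. e * outcome f x \<partial>measure_pmf (exec c s))"
    unfolding expf_def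
  proof (rule nn_integral_cong_AE, unfold AE_measure_pmf_iff, rule ballI)
    fix x assume "x \<in> set_pmf (exec c s)"
    then obtain t s' where "x = Some (t, s')"
      using assms(2) unfolding AS_def by blast
    then show "(case x of None \<Rightarrow> 1 | Some (t, s') \<Rightarrow> e * f t s') = e * outcome f x"
      by simp
  qed
  also have "\<dots> = e * expf c s f"
    unfolding expf_def by (simp add: nn_integral_cmult)
  finally show ?thesis by simp
qed

lemma expf_Skip [simp]: "expf Skip s f = f 1 s"
  by (simp add: expf_def)

lemma expf_ISet [simp]: "expf (ISet x i e) s f = f 1 (iupd x (ieval i s) (ieval e s) s)"
  by (simp add: expf_def)

lemma expf_RSet [simp]: "expf (RSet x i e) s f = f 1 (rupd x (ieval i s) (reval e s) s)"
  by (simp add: expf_def)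

lemma expf_Seq [simp]: "expf (Seq c d) s f = expf c s (\<lambda>t s'. expf d s' (\<lambda>t'. f (t + t')))"
  unfolding expf_def
  by (auto simp: bind_spmf_def intro!: nn_integral_cong split: option.splits)

lemma expf_If [simp]:
  "expf (If b c d) s f = (if beval b s then expf c s (\<lambda>t. f (1 + t)) else expf d s (\<lambda>t. f (1 + t)))"
  unfolding expf_def
  by (auto intro!: nn_integral_cong split: option.splits)

lemma expf_Call [simp]:
  "expf (Call xs c ys) s f =
    expf c (transfer_arrays xs s zero_store) (\<lambda>t s'. f (1 + t) (transfer_arrays ys s' s))"
  unfolding expf_def
  by (auto intro!: nn_integral_cong split: option.splits)

lemma expf_Rand:
  assumes "0 < K" "ieval k s = int K"
  shows "expf (Rand x i k) s f = (\<Sum>j<K. f 1 (iupd x (ieval i s) (int j) s)) / of_nat K"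
proof -
  have K: "max 1 (int K) = int K" using assms by simp
  have "expf (Rand x i k) s f
      = (\<Sum>j\<in>{0..<int K}. f 1 (iupd x (ieval i s) j s)) / of_nat K"
    using assms unfolding expf_def
    by (simp add: K spmf_of_set_def spmf_of_pmf_def nn_integral_pmf_of_set
        ennreal_of_nat_eq_real_of_nat del: spmf_of_pmf_pmf_of_set)
  also have "{0..<int K} = int ` {..<K}"
    by (metis image_int_atLeastLessThan lessThan_atLeast0 of_nat_0)
  finally show ?thesis
    by (simp add: sum.reindex)
qed

lemma expf_While:
  "expf (While b c) s f =
    (if beval b s then expf c s (\<lambda>t s'. expf (While b c) s' (\<lambda>t'. f (1 + t + t'))) else f 1 s)"
proof -
  have *: "exec (While b c) s = (if beval b s
      then bind_spmf (exec c s) (\<lambda>p. map_spmf (\<lambda>q. (1 + fst p + fst q, snd q)) (exec (While b c) (snd p)))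
      else return_spmf (1, s))"
    unfolding exec.simps by (rule loop.simps)
  show ?thesis
    unfolding expf_def by (subst *)
      (auto simp: bind_spmf_def intro!: nn_integral_cong split: option.splits)
qed

lemma expf_eq_0_iff: "expf c s f = 0 \<longleftrightarrow> AS c s (\<lambda>t s'. f t s' = 0)"
proof -
  have "expf c s f = 0 \<longleftrightarrow>
      (\<forall>x\<in>set_pmf (exec c s). outcome f x = 0)"
    unfolding expf_def by (subst nn_integral_0_iff_AE) (auto simp: AE_measure_pmf_iff)
  also have "\<dots> \<longleftrightarrow> AS c s (\<lambda>t s'. f t s' = 0)"
    unfolding AS_def by (intro ball_cong) (auto split: option.splits)
  finally show ?thesis .
qed

lemma AS_iff_expf: "AS c s Q \<longleftrightarrow> expf c s (fails Q) = 0"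
proof -
  have "(\<lambda>t s'. fails Q t s' = 0) = Q" by (auto simp: fun_eq_iff)
  then show ?thesis unfolding expf_eq_0_iff by simp
qed

lemma AS_Skip [simp]: "AS Skip s Q \<longleftrightarrow> Q 1 s"
  by (simp add: AS_iff_expf)

lemma AS_ISet [simp]: "AS (ISet x i e) s Q \<longleftrightarrow> Q 1 (iupd x (ieval i s) (ieval e s) s)"
  by (simp add: AS_iff_expf)

lemma AS_RSet [simp]: "AS (RSet x i e) s Q \<longleftrightarrow> Q 1 (rupd x (ieval i s) (reval e s) s)"
  by (simp add: AS_iff_expf)

lemma AS_Rand [simp]:
  "AS (Rand x i k) s Q \<longleftrightarrow> (\<forall>j\<in>{0..<max 1 (ieval k s)}. Q 1 (iupd x (ieval i s) j s))"
proof -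
  have "set_pmf (exec (Rand x i k) s) =
      (\<lambda>j. Some (1, iupd x (ieval i s) j s)) ` {0..<max 1 (ieval k s)}"
    by (simp add: spmf_of_set_def spmf_of_pmf_def set_map_pmf image_image set_pmf_of_set
        del: spmf_of_pmf_pmf_of_set)
  then show ?thesis
    unfolding AS_def by simp
qed

lemma AS_Seq [simp]: "AS (Seq c d) s Q \<longleftrightarrow> AS c s (\<lambda>t s'. AS d s' (\<lambda>t'. Q (t + t')))"
  unfolding AS_iff_expf[of "Seq c d"] expf_Seq expf_eq_0_iff[of c]
  by (simp add: AS_iff_expf)

lemma AS_If [simp]:
  "AS (If b c d) s Q \<longleftrightarrow> (if beval b s then AS c s (\<lambda>t. Q (1 + t)) else AS d s (\<lambda>t. Q (1 + t)))"
  by (simp add: AS_iff_expf)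

lemma AS_Call [simp]:
  "AS (Call xs c ys) s Q \<longleftrightarrow>
    AS c (transfer_arrays xs s zero_store) (\<lambda>t s'. Q (1 + t) (transfer_arrays ys s' s))"
  by (simp add: AS_iff_expf)

lemma AS_While:
  "AS (While b c) s Q \<longleftrightarrow>
    (if beval b s then AS (Seq c (While b c)) s (\<lambda>t. Q (1 + t)) else Q 1 s)"
proof -
  have "expf (While b c) s (fails Q) =
    (if beval b s then expf (Seq c (While b c)) s (fails (\<lambda>t. Q (1 + t))) else fails Q 1 s)"
    by (subst expf_While) (simp add: add.assoc)
  then show ?thesis
    unfolding AS_iff_expf by (cases "beval b s") simp_all
qed

declare exec.simps [simp del]

lemma run_prob_eq_1_imp_AS:
  assumes "run_prob c s Q = 1"
  shows "AS c s Q"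
proof -
  have "measure (measure_pmf (exec c s)) (Some ` {(t, s'). Q t s'}) = 1"
    using assms unfolding run_prob_def measure_measure_spmf_conv_measure_pmf by simp
  then have "AE x in measure_pmf (exec c s). x \<in> Some ` {(t, s'). Q t s'}"
    by (subst measure_pmf.prob_eq_1[symmetric]) auto
  then show ?thesis
    unfolding AS_def AE_measure_pmf_iff by fastforce
qed

lemma run_prob_ge:
  assumes "expf c s (fails Q) \<le> ennreal e" "0 \<le> e"
  shows "run_prob c s Q \<ge> 1 - e"
proof -
  let ?M = "measure_pmf (exec c s)" and ?A = "Some ` {(t, s'). Q t s'}"
  have "expf c s (fails Q) = (\<integral>\<^sup>+x. indicator (- ?A) x \<partial>?M)"
    unfolding expf_def
    by (intro nn_integral_cong) (auto split: option.splits simp: indicator_def)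
  also have "\<dots> = emeasure ?M (- ?A)" by simp
  also have "\<dots> = ennreal (measure ?M (- ?A))"
    by (simp add: measure_pmf.emeasure_eq_measure)
  finally have "measure ?M (- ?A) \<le> e" using assms by simp
  moreover have "measure ?M (- ?A) = 1 - measure ?M ?A"
    using measure_pmf.prob_compl[of ?A "exec c s"] by (simp add: Compl_eq_Diff_UNIV)
  ultimately show ?thesis
    unfolding run_prob_def measure_measure_spmf_conv_measure_pmf by simp
qed

section \<open>Separations and isolating cuts\<close>

definition separation :: "'a set \<Rightarrow> 'a set set \<Rightarrow> 'a set \<Rightarrow> 'a set \<Rightarrow> 'a set \<Rightarrow> bool" where
  "separation V E X C Y \<longleftrightarrow> X \<union> C \<union> Y = V \<and> X \<inter> C = {} \<and> X \<inter> Y = {} \<and> C \<inter> Y = {} \<and>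
     (\<forall>x\<in>X. \<forall>y\<in>Y. {x, y} \<notin> E)"

definition nbs :: "'a set set \<Rightarrow> 'a \<Rightarrow> 'a set" where
  "nbs E v = {u. {v, u} \<in> E}"

lemma separation_sym: "separation V E X C Y \<Longrightarrow> separation V E Y C X"
  unfolding separation_def by (metis Int_commute Un_commute Un_assoc insert_commute)

lemma simple_graph_edgeD:
  assumes "simple_graph V E" "{u, v} \<in> E"
  shows "u \<in> V" "v \<in> V" "u \<noteq> v"
  using assms unfolding simple_graph_def by (fastforce simp: doubleton_eq_iff)+

lemma separation_not_joined:
  assumes "simple_graph V E" "separation V E X C Y" "x \<in> X" "y \<in> Y"
  shows "(x, y) \<notin> joined E C"
proof
  assume "(x, y) \<in> joined E C"
  then have "y \<in> X"
    unfolding joined_def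
  proof (induction rule: rtrancl_induct)
    case (step a b)
    then have "{a, b} \<in> E" "b \<notin> C" by auto
    moreover have "b \<in> V" using simple_graph_edgeD(2)[OF assms(1) \<open>{a, b} \<in> E\<close>] .
    ultimately show ?case using step.IH assms(2) unfolding separation_def by blast
  qed (use assms in simp)
  then show False using assms unfolding separation_def by blast
qed

lemma vertex_cut_iff:
  assumes "finite V"
  shows "vertex_cut V E C \<longleftrightarrow> C \<subseteq> V \<and> (\<exists>x\<in>V - C. \<exists>y\<in>V - C. (x, y) \<notin> joined E C)"
proof -
  let ?K = "\<lambda>v. {u \<in> V - C. (v, u) \<in> joined E C}"
  have sym: "sym (joined E C)"
    unfolding joined_def by (intro sym_rtrancl symI) (auto simp: insert_commute)
  have tr: "trans (joined E C)" unfolding joined_def by (rule trans_rtrancl)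
  have refl: "(x, x) \<in> joined E C" for x unfolding joined_def by simp
  have eq: "?K x = ?K y" if "(x, y) \<in> joined E C" for x y
    using that sym tr by (auto dest: symD transD)
  have fin: "finite (components_minus V E C)"
    using assms unfolding components_minus_def by simp
  have "card (components_minus V E C) \<ge> 2 \<longleftrightarrow> \<not> card (components_minus V E C) \<le> Suc 0"
    by linarith
  also have "\<dots> \<longleftrightarrow> (\<exists>A\<in>components_minus V E C. \<exists>B\<in>components_minus V E C. A \<noteq> B)"
    unfolding card_le_Suc0_iff_eq[OF fin] by blast
  also have "\<dots> \<longleftrightarrow> (\<exists>x\<in>V - C. \<exists>y\<in>V - C. (x, y) \<notin> joined E C)"
  proof -
    have "?K x = ?K y \<longleftrightarrow> (x, y) \<in> joined E C" if "y \<in> V - C" for x y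
    proof
      assume "?K x = ?K y"
      moreover have "y \<in> ?K y" using that refl by simp
      ultimately have "y \<in> ?K x" by simp
      then show "(x, y) \<in> joined E C" by simp
    qed (rule eq)
    then show ?thesis unfolding components_minus_def by (simp add: bex_simps)
  qed
  finally show ?thesis unfolding vertex_cut_def by simp
qed

lemma separation_vertex_cut:
  assumes "simple_graph V E" "separation V E X C Y" "X \<noteq> {}" "Y \<noteq> {}"
  shows "vertex_cut V E C"
proof -
  obtain x y where xy: "x \<in> X" "y \<in> Y" using assms by blast
  then have "x \<in> V - C" "y \<in> V - C" "C \<subseteq> V"
    using assms(2) unfolding separation_def by blast+
  moreover have "(x, y) \<notin> joined E C"
    using separation_not_joined[OF assms(1,2) xy] .
  moreover have "finite V" using assms(1) by (simp add: simple_graph_def)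
  ultimately show ?thesis by (subst vertex_cut_iff) blast+
qed

lemma vertex_cut_separation:
  assumes "simple_graph V E" "vertex_cut V E C"
  obtains X Y where "separation V E X C Y" "X \<noteq> {}" "Y \<noteq> {}"
proof -
  have "finite V" using assms(1) by (simp add: simple_graph_def)
  then obtain x y where xy: "C \<subseteq> V" "x \<in> V - C" "y \<in> V - C" "(x, y) \<notin> joined E C"
    using assms(2) by (auto simp: vertex_cut_iff)
  define X where "X = {u \<in> V - C. (x, u) \<in> joined E C}"
  define Y where "Y = V - C - X"
  have "{a, b} \<notin> E" if "a \<in> X" "b \<in> Y" for a b
  proof
    assume "{a, b} \<in> E"
    then have "(a, b) \<in> {(u, v). {u, v} \<in> E \<and> u \<notin> C \<and> v \<notin> C}"
      using that by (auto simp: X_def Y_def)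
    then have "(x, b) \<in> joined E C"
      using that unfolding X_def joined_def by (auto intro: rtrancl_into_rtrancl)
    then show False using that by (auto simp: X_def Y_def)
  qed
  then have "separation V E X C Y"
    using xy unfolding separation_def by (auto simp: X_def Y_def)
  moreover have "x \<in> X" "y \<in> Y"
    using xy by (auto simp: X_def Y_def joined_def)
  ultimately show thesis using that by blast
qed

lemma nbs_separation:
  assumes "simple_graph V E" "v \<in> V"
  shows "separation V E {v} (nbs E v) (V - insert v (nbs E v))"
  using assms simple_graph_edgeD[OF assms(1)]
  unfolding separation_def nbs_def by blast

lemma isolating_cut_vertex_cut:
  assumes "finite V" "isolating_cut V E R C" "R \<subseteq> V" "2 \<le> card R"
  shows "vertex_cut V E C"
proof -
  obtain r where r: "r \<in> R" "\<forall>s\<in>R - {r}. (r, s) \<notin> joined E C" "C \<subseteq> V - R"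
    using assms by (auto simp: isolating_cut_def)
  have "R - {r} \<noteq> {}"
    using assms(4) r(1) card_Diff_singleton[of r R] by (metis card.empty diff_is_0_eq not_numeral_le_zero One_nat_def Suc_1 not_less_eq_eq order_refl)
  then obtain s where "s \<in> R - {r}" by blast
  then show ?thesis
    using r assms by (subst vertex_cut_iff) blast+
qed

lemma separation_isolating_cut:
  assumes "simple_graph V E" "separation V E X C Y" "R \<subseteq> V" "R \<inter> C = {}" "R \<inter> X = {r}"
  shows "isolating_cut V E R C"
  unfolding isolating_cut_def
proof (intro conjI bexI ballI)
  fix s assume "s \<in> R - {r}"
  then have "s \<in> Y" using assms unfolding separation_def by blast
  then show "(r, s) \<notin> joined E C"
    using assms by (intro separation_not_joined[OF assms(1,2)]) auto
qed (use assms in \<open>auto simp: separation_def\<close>)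

fun prune :: "(nat \<times> nat) list \<Rightarrow> nat set \<Rightarrow> nat set" where
  "prune [] R = R"
| "prune ((a, b) # es) R = prune es (if a \<in> R \<and> b \<in> R then R - {b} else R)"

lemma prune_append: "prune (es @ fs) R = prune fs (prune es R)"
  by (induction es R rule: prune.induct) auto

lemma prune_subset: "prune es R \<subseteq> R"
  by (induction es R rule: prune.induct) (auto split: if_splits)

lemma prune_independent:
  assumes "(a, b) \<in> set es" "a \<noteq> b"
  shows "\<not> (a \<in> prune es R \<and> b \<in> prune es R)"
  using assms
proof (induction es R rule: prune.induct)
  case (2 x y es R)
  let ?R = "if x \<in> R \<and> y \<in> R then R - {y} else R"
  show ?case
  proof (cases "(a, b) = (x, y)")
    case True
    then have "\<not> (a \<in> ?R \<and> b \<in> ?R)" by simp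
    then show ?thesis using prune_subset[of es ?R] unfolding prune.simps by blast
  next
    case False
    then have "(a, b) \<in> set es" using "2.prems"(1) by auto
    then show ?thesis using "2.IH" "2.prems"(2) unfolding prune.simps by blast
  qed
qed simp

text \<open>A vertex is only dropped because of a surviving neighbour, which lies on the same side of a
  separation whose middle part avoids the set.\<close>

lemma prune_separation:
  assumes "separation V E X C Y" "R \<inter> C = {}" "R \<subseteq> V" "R \<inter> X \<noteq> {}"
    and "\<And>a b. (a, b) \<in> set es \<Longrightarrow> {a, b} \<in> E \<and> a \<noteq> b"
  shows "prune es R \<inter> X \<noteq> {}"
  using assms(2-)
proof (induction es R rule: prune.induct)
  case (2 a b es R)
  let ?R = "if a \<in> R \<and> b \<in> R then R - {b} else R"
  have "?R \<inter> X \<noteq> {}"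
  proof (cases "a \<in> R \<and> b \<in> R \<and> b \<in> X")
    case True
    have ab: "{b, a} \<in> E" "a \<noteq> b"
      using "2.prems"(4)[of a b] by (auto simp: insert_commute)
    have "a \<notin> Y" using ab True assms(1) unfolding separation_def by blast
    moreover have "a \<in> V" "a \<notin> C" using True "2.prems" by auto
    ultimately have "a \<in> X" using assms(1) unfolding separation_def by blast
    then have "a \<in> ?R \<inter> X" using True ab by simp
    then show ?thesis by blast
  next
    case False
    then show ?thesis using "2.prems"(3) by auto
  qed
  moreover have "?R \<inter> C = {}" "?R \<subseteq> V" using "2.prems" by auto
  moreover have "\<And>a b. (a, b) \<in> set es \<Longrightarrow> {a, b} \<in> E \<and> a \<noteq> b"
    using "2.prems"(4) by simp
  ultimately show ?case unfolding prune.simps by (intro "2.IH") auto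
qed simp

locale instance_graph =
  fixes n :: nat and E :: "nat set set" and es :: "(nat \<times> nat) list" and w :: "nat \<Rightarrow> real"
  assumes graph: "simple_graph {..<n} E"
    and edges: "lists_edges es E"
    and w_pos: "\<And>v. v < n \<Longrightarrow> 0 < w v"
    and has_cut: "\<exists>C. vertex_cut {..<n} E C"
begin

abbreviation "V \<equiv> {..<n}"
abbreviation "kappa \<equiv> min_cut_weight V E w"
abbreviation "W \<equiv> sum w V"

lemma es_edge: "(a, b) \<in> set es \<Longrightarrow> {a, b} \<in> E"
  using edges unfolding lists_edges_def by force

lemma es_edgeD:
  assumes "(a, b) \<in> set es"
  shows "a < n" "b < n" "a \<noteq> b"
  using simple_graph_edgeD[OF graph es_edge[OF assms]] by auto

lemma length_es: "length es = card E"
  using edges unfolding lists_edges_def by (metis distinct_card length_map)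

lemma edge_es:
  assumes "{a, b} \<in> E"
  shows "(a, b) \<in> set es \<or> (b, a) \<in> set es"
proof -
  have "{a, b} \<in> (\<lambda>(u, v). {u, v}) ` set es"
    using edges assms unfolding lists_edges_def by simp
  then obtain u v where uv: "(u, v) \<in> set es" "{a, b} = {u, v}" by auto
  then show ?thesis unfolding doubleton_eq_iff by auto
qed

lemma prune_independent_set:
  assumes "R \<subseteq> V"
  shows "independent_set V E (prune es R)"
  unfolding independent_set_def
proof (intro conjI ballI notI)
  show "prune es R \<subseteq> V" using prune_subset[of es R] assms by (rule order_trans)
next
  fix u v assume uv: "u \<in> prune es R" "v \<in> prune es R" "{u, v} \<in> E"
  from edge_es[OF uv(3)] show False
    using uv prune_independent[of _ _ es R] es_edgeD(3) by metis
qed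

lemma finite_cuts: "finite {sum w C | C. vertex_cut V E C}"
proof -
  have "{sum w C | C. vertex_cut V E C} \<subseteq> sum w ` Pow V"
    by (auto simp: vertex_cut_def)
  then show ?thesis by (rule finite_subset) simp
qed

lemma kappa_le: "vertex_cut V E C \<Longrightarrow> kappa \<le> sum w C"
  unfolding min_cut_weight_def using finite_cuts by (intro Min_le) auto

lemma kappa_attained:
  obtains C where "vertex_cut V E C" "sum w C = kappa"
proof -
  have "kappa \<in> {sum w C | C. vertex_cut V E C}"
    unfolding min_cut_weight_def using finite_cuts has_cut by (intro Min_in) auto
  then show thesis using that by auto
qed

lemma sum_w_nonneg: "A \<subseteq> V \<Longrightarrow> 0 \<le> sum w A"
  using w_pos by (intro sum_nonneg) (auto intro: less_imp_le)

lemma sum_w_mono: "A \<subseteq> B \<Longrightarrow> B \<subseteq> V \<Longrightarrow> sum w A \<le> sum w B"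
  using w_pos by (intro sum_mono2) (auto intro: less_imp_le finite_subset)

lemma kappa_nonneg: "0 \<le> kappa"
proof -
  obtain C where "vertex_cut V E C" "sum w C = kappa" by (rule kappa_attained)
  then show ?thesis using sum_w_nonneg[of C] by (auto simp: vertex_cut_def)
qed

lemma sum_w_pos: "A \<subseteq> V \<Longrightarrow> A \<noteq> {} \<Longrightarrow> 0 < sum w A"
  using w_pos by (intro sum_pos) (auto intro: finite_subset)

lemma sum_separation:
  fixes u :: "nat \<Rightarrow> real"
  assumes "separation V E X C Y"
  shows "sum u V = sum u X + sum u C + sum u Y"
proof -
  have fin: "finite X" "finite C" "finite Y"
    using assms unfolding separation_def by (auto intro: finite_subset[of _ V])
  have "V = (X \<union> C) \<union> Y" using assms unfolding separation_def by auto
  also have "sum u \<dots> = sum u (X \<union> C) + sum u Y"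
    using fin assms unfolding separation_def by (intro sum.union_disjoint) auto
  also have "sum u (X \<union> C) = sum u X + sum u C"
    using fin assms unfolding separation_def by (intro sum.union_disjoint) auto
  finally show ?thesis .
qed

lemma cut_less_W: "vertex_cut V E C \<Longrightarrow> sum w C < W"
proof -
  assume "vertex_cut V E C"
  then obtain X Y where XY: "separation V E X C Y" "X \<noteq> {}" "Y \<noteq> {}"
    by (rule vertex_cut_separation[OF graph])
  then have "0 < sum w X" "0 < sum w Y"
    by (auto intro!: sum_w_pos simp: separation_def)
  then show ?thesis using sum_separation[OF XY(1), of w] by simp
qed

lemma n_ge_2: "2 \<le> n"
proof -
  obtain C where "vertex_cut V E C" using has_cut by blast
  then obtain X Y where XY: "separation V E X C Y" "X \<noteq> {}" "Y \<noteq> {}"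
    by (rule vertex_cut_separation[OF graph])
  then obtain x y where xy: "x \<in> X" "y \<in> Y" by blast
  then have "card {x, y} \<le> card V"
    using XY by (intro card_mono) (auto simp: separation_def)
  moreover have "x \<noteq> y" using xy XY by (auto simp: separation_def)
  ultimately show ?thesis by simp
qed

lemma nbs_subset: "nbs E v \<subseteq> V"
  using simple_graph_edgeD[OF graph] unfolding nbs_def by blast

lemma nbs_irrefl: "v \<notin> nbs E v"
  using simple_graph_edgeD(3)[OF graph] unfolding nbs_def by blast

lemma nbs_vertex_cut:
  assumes "v < n" "insert v (nbs E v) \<noteq> V"
  shows "vertex_cut V E (nbs E v)"
  using assms nbs_subset[of v]
  by (intro separation_vertex_cut[OF graph nbs_separation[OF graph, of v]]) auto

lemma separation_nbs_subset:
  assumes "separation V E X C Y" "x \<in> X" "Y \<noteq> {}"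
  shows "nbs E x \<subseteq> X \<union> C - {x}" "insert x (nbs E x) \<noteq> V" "x < n"
proof -
  have "u \<notin> Y" if "u \<in> nbs E x" for u
    using that assms unfolding separation_def nbs_def by blast
  then show 1: "nbs E x \<subseteq> X \<union> C - {x}"
    using assms(1) nbs_subset[of x] nbs_irrefl[of x] unfolding separation_def by blast
  obtain y where "y \<in> Y" using assms(3) by blast
  then have "y \<in> V" "y \<notin> insert x (nbs E x)"
    using 1 assms(1,2) unfolding separation_def by blast+
  then show "insert x (nbs E x) \<noteq> V" by blast
  have "x \<in> V" using assms(1,2) unfolding separation_def by blast
  then show "x < n" by simp
qed

end

section \<open>A single sampling step\<close>

abbreviation iv :: "vname \<Rightarrow> iexp" where "iv x \<equiv> IVal x (N 0)"
abbreviation rv :: "vname \<Rightarrow> rexp" where "rv x \<equiv> RVal x (N 0)"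

abbreviation best :: "store \<Rightarrow> real" where "best s \<equiv> reals s ''best'' 0"

abbreviation misses :: "real \<Rightarrow> nat \<Rightarrow> store \<Rightarrow> ennreal" where
  "misses \<beta> \<equiv> fails (\<lambda>_ s. best s \<le> \<beta>)"

definition for_loop :: "vname \<Rightarrow> iexp \<Rightarrow> com \<Rightarrow> com" where
  "for_loop x b c = Seq (ISet x (N 0) (N 0))
     (While (ILess (iv x) b) (Seq c (ISet x (N 0) (IAdd (iv x) (N 1)))))"

definition agree :: "vname set \<Rightarrow> store \<Rightarrow> store \<Rightarrow> bool" where
  "agree X s s' \<longleftrightarrow> (\<forall>x\<in>X. ints s x = ints s' x \<and> reals s x = reals s' x)"

lemma ints_iupd [simp]: "ints (iupd x i k s) = (ints s)(x := (ints s x)(i := k))"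
  by (simp add: iupd_def)

lemma reals_iupd [simp]: "reals (iupd x i k s) = reals s"
  by (simp add: iupd_def)

lemma ints_rupd [simp]: "ints (rupd x i k s) = ints s"
  by (simp add: rupd_def)

lemma reals_rupd [simp]: "reals (rupd x i k s) = (reals s)(x := (reals s x)(i := k))"
  by (simp add: rupd_def)

lemma ints_transfer_arrays [simp]:
  "ints (transfer_arrays xs s s') x = (if x \<in> set xs then ints s x else ints s' x)"
  by (simp add: transfer_arrays_def)

lemma reals_transfer_arrays [simp]:
  "reals (transfer_arrays xs s s') x = (if x \<in> set xs then reals s x else reals s' x)"
  by (simp add: transfer_arrays_def)

lemma ints_zero_store [simp]: "ints zero_store x i = 0"
  by (simp add: zero_store_def)

lemma reals_zero_store [simp]: "reals zero_store x i = 0"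
  by (simp add: zero_store_def)

lemma agree_refl [simp]: "agree X s s"
  by (simp add: agree_def)

lemma agree_trans: "agree X s s' \<Longrightarrow> agree X s' s'' \<Longrightarrow> agree X s s''"
  by (simp add: agree_def)

lemma agree_iupd [simp]: "x \<notin> X \<Longrightarrow> agree X (iupd x i k s) s' \<longleftrightarrow> agree X s s'"
  by (auto simp: agree_def)

lemma agree_rupd [simp]: "x \<notin> X \<Longrightarrow> agree X (rupd x i k s) s' \<longleftrightarrow> agree X s s'"
  by (auto simp: agree_def)

lemma AS_SeqI: "AS c s (\<lambda>t s'. AS d s' (\<lambda>t'. Q (t + t'))) \<Longrightarrow> AS (Seq c d) s Q"
  by simp

lemma AS_IfI: "beval b s \<Longrightarrow> AS c s (\<lambda>t. Q (1 + t)) \<Longrightarrow> AS (If b c d) s Q"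
  by simp

lemma expf_for_loop:
  fixes tb :: real
  assumes init: "I 0 (iupd x 0 0 s)"
    and bound: "\<And>k s'. I k s' \<Longrightarrow> ieval b s' = int K"
    and step: "\<And>k s'. k < K \<Longrightarrow> I k s' \<Longrightarrow> ints s' x 0 = int k \<Longrightarrow>
      expf c s' (\<lambda>t s''. if (timed \<longrightarrow> real t \<le> tb) \<and> ints s'' x 0 = int k \<and>
          I (Suc k) (iupd x 0 (int (Suc k)) s'')
        then G (Suc k) (iupd x 0 (int (Suc k)) s'') else 1) \<le> G k s'"
    and post: "\<And>t s'. (timed \<Longrightarrow> real t \<le> 2 + real K * (tb + 2)) \<Longrightarrow> I K s' \<Longrightarrow> f t s' \<le> G K s'"
    and f: "\<And>t s'. f t s' \<le> 1"
  shows "expf (for_loop x b c) s f \<le> G 0 (iupd x 0 0 s)"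
proof -
  let ?W = "While (ILess (iv x) b) (Seq c (ISet x (N 0) (IAdd (iv x) (N 1))))"
  have loop: "expf ?W s' (\<lambda>t. f (t0 + t)) \<le> G k s'"
    if "k \<le> K" "I k s'" "ints s' x 0 = int k" "timed \<Longrightarrow> real t0 \<le> 1 + real k * (tb + 2)" for k s' t0
    using that
  proof (induction "K - k" arbitrary: k s' t0)
    case 0
    then have "k = K" by simp
    moreover have "f (t0 + 1) s' \<le> G K s'" using 0 \<open>k = K\<close> by (intro post) auto
    ultimately show ?case
      using bound[OF 0(3)] 0(4) by (subst expf_While) simp
  next
    case (Suc r)
    then have k: "k < K" by simp
    have "beval (ILess (iv x) b) s'"
      using bound[OF Suc.prems(2)] Suc.prems(3) k by simp
    then have "expf ?W s' (\<lambda>t. f (t0 + t)) =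
        expf c s' (\<lambda>t s''. expf ?W (iupd x 0 (ints s'' x 0 + 1) s'') (\<lambda>t'. f (t0 + (1 + (t + 1) + t'))))"
      by (subst expf_While) simp
    also have "\<dots> \<le> expf c s' (\<lambda>t s''. if (timed \<longrightarrow> real t \<le> tb) \<and> ints s'' x 0 = int k \<and>
          I (Suc k) (iupd x 0 (int (Suc k)) s'')
        then G (Suc k) (iupd x 0 (int (Suc k)) s'') else 1)"
    proof (rule expf_mono)
      fix t s''
      let ?ok = "(timed \<longrightarrow> real t \<le> tb) \<and> ints s'' x 0 = int k \<and> I (Suc k) (iupd x 0 (int (Suc k)) s'')"
      show "expf ?W (iupd x 0 (ints s'' x 0 + 1) s'') (\<lambda>t'. f (t0 + (1 + (t + 1) + t'))) \<le>
        (if ?ok then G (Suc k) (iupd x 0 (int (Suc k)) s'') else 1)"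
      proof (cases ?ok)
        case True
        then have "ints s'' x 0 + 1 = int (Suc k)" by simp
        moreover have "expf ?W (iupd x 0 (int (Suc k)) s'') (\<lambda>t'. f (t0 + (1 + (t + 1)) + t'))
            \<le> G (Suc k) (iupd x 0 (int (Suc k)) s'')"
        proof (rule Suc.hyps(1))
          assume timed
          then show "real (t0 + (1 + (t + 1))) \<le> 1 + real (Suc k) * (tb + 2)"
            using Suc.prems(4) True by (simp add: distrib_right)
        qed (use True k Suc.hyps(2) in auto)
        ultimately show ?thesis by (subst if_P[OF True]) (simp only: add.assoc)
      next
        case False
        then show ?thesis using f by (simp only: if_False) (rule expf_le_1, simp)
      qed
    qed
    also have "\<dots> \<le> G k s'" using step[OF k Suc.prems(2,3)] .
    finally show ?case .
  qed
  show ?thesis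
    unfolding for_loop_def using loop[of 0 "iupd x 0 0 s" 1] init by simp
qed

lemma AS_for_loop:
  assumes init: "I 0 (iupd x 0 0 s)"
    and bound: "\<And>k s'. I k s' \<Longrightarrow> ieval b s' = int K"
    and step: "\<And>k s'. k < K \<Longrightarrow> I k s' \<Longrightarrow> ints s' x 0 = int k \<Longrightarrow>
      AS c s' (\<lambda>t s''. t \<le> tb \<and> ints s'' x 0 = int k \<and> I (Suc k) (iupd x 0 (int (Suc k)) s''))"
    and post: "\<And>t s'. t \<le> 2 + K * (tb + 2) \<Longrightarrow> I K s' \<Longrightarrow> Q t s'"
  shows "AS (for_loop x b c) s Q"
proof -
  have "expf (for_loop x b c) s (fails Q) \<le> (\<lambda>_ _. 0) 0 (iupd x 0 0 s)"
  proof (rule expf_for_loop[where I = I and timed = True and tb = "real tb" and K = K and G = "\<lambda>_ _. 0"])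
    fix k s' assume "k < K" "I k s'" "ints s' x 0 = int k"
    then show "expf c s' (\<lambda>t s''. if (True \<longrightarrow> real t \<le> real tb) \<and> ints s'' x 0 = int k \<and>
        I (Suc k) (iupd x 0 (int (Suc k)) s'') then 0 else 1) \<le> 0"
      by (intro expf_AS_le[OF step]) auto
  next
    fix t s' assume t: "True \<Longrightarrow> real t \<le> 2 + real K * (real tb + 2)" and I: "I K s'"
    have "real t \<le> real (2 + K * (tb + 2))" using t by (simp add: algebra_simps)
    then have "t \<le> 2 + K * (tb + 2)" by (simp only: of_nat_le_iff)
    then show "fails Q t s' \<le> 0" using post I by simp
  qed (use init bound in auto)
  then show ?thesis by (simp add: AS_iff_expf)
qed

definition ind :: "nat set \<Rightarrow> int \<Rightarrow> int" where
  "ind X i = (if 0 \<le> i \<and> nat i \<in> X then 1 else 0)"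

lemma ind_of_nat [simp]: "ind X (int v) = (if v \<in> X then 1 else 0)"
  by (simp add: ind_def)

lemma ind_insert [simp]: "(ind X)(int v := 1) = ind (insert v X)"
  by (auto simp: ind_def fun_eq_iff)

lemma ind_remove [simp]: "(ind X)(int v := 0) = ind (X - {v})"
  by (auto simp: ind_def fun_eq_iff)

lemma ind_empty [simp]: "ind {} = (\<lambda>_. 0)"
  by (auto simp: ind_def fun_eq_iff)

lemma ind_arr: "X \<subseteq> {..<n} \<Longrightarrow> ind X = arr (map (\<lambda>v. if v \<in> X then 1 else 0) [0..<n])"
  by (auto simp: ind_def arr_def fun_eq_iff)

definition nonzero :: "iexp \<Rightarrow> bexp" where
  "nonzero a = Not (And (Not (ILess a (N 0))) (Not (ILess (N 0) a)))"

lemma beval_nonzero [simp]: "beval (nonzero a) s \<longleftrightarrow> ieval a s \<noteq> 0"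
  by (auto simp: nonzero_def)

definition draw_scale_rest :: com where
  "draw_scale_rest = Seq (RSet ''lam'' (N 0) (RDiv (RMul (OfInt (iv ''n'')) (OfInt (iv ''n''))) (rv ''cap'')))
       (While (ILess (N 0) (iv ''j''))
         (Seq (RSet ''lam'' (N 0) (RDiv (rv ''lam'') (OfInt (N 2))))
           (ISet ''j'' (N 0) (ISub (iv ''j'') (N 1)))))"

definition draw_scale :: com where
  "draw_scale = Seq (Rand ''j'' (N 0) (IAdd (IAdd (iv ''l'') (iv ''l'')) (N 1)))
     draw_scale_rest"

text \<open>With \<open>thr = M\<close>, \<open>cap = 1\<close>, \<open>base = 0\<close> the sampling weight is the indicator of the vertices heavier
  than \<open>M\<close>; with \<open>thr = cap = B\<close>, \<open>base = 1\<close> it is \<open>min (w v) B\<close>.\<close>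

abbreviation set_weight :: com where
  "set_weight \<equiv> If (RLess (rv ''thr'') (RVal ''w'' (iv ''v'')))
     (RSet ''u'' (N 0) (rv ''cap''))
     (RSet ''u'' (N 0) (RMul (rv ''base'') (RVal ''w'' (iv ''v''))))"

abbreviation include_vertex :: com where
  "include_vertex \<equiv> If (RLess (OfInt (iv ''r'')) (RMul (rv ''lam'') (rv ''u'')))
     (ISet ''R'' (iv ''v'') (N 1)) Skip"

definition sample_vertex :: com where
  "sample_vertex =
     Seq (Rand ''r'' (N 0) (IAdd (IAdd (iv ''n'') (iv ''n'')) (IAdd (iv ''n'') (iv ''n''))))
       (Seq set_weight include_vertex)"

abbreviation prune_edge :: com where
  "prune_edge \<equiv> If (And (ILess (N 0) (IVal ''R'' (IVal ''src'' (iv ''e''))))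
       (ILess (N 0) (IVal ''R'' (IVal ''dst'' (iv ''e'')))))
     (ISet ''R'' (IVal ''dst'' (iv ''e'')) (N 0)) Skip"

abbreviation count_sample :: com where
  "count_sample \<equiv> for_loop ''v'' (iv ''n'') (ISet ''cnt'' (N 0) (IAdd (iv ''cnt'') (IVal ''R'' (iv ''v''))))"

definition prune_count :: com where
  "prune_count = Seq
     (for_loop ''e'' (iv ''m'')
       prune_edge)
     count_sample"

abbreviation weigh :: com where
  "weigh \<equiv> for_loop ''v'' (iv ''n'')
     (If (nonzero (IVal ''C'' (iv ''v'')))
       (RSet ''wt'' (N 0) (RAdd (rv ''wt'') (RVal ''w'' (iv ''v'')))) Skip)"

abbreviation keep_best :: com where
  "keep_best \<equiv> If (RLess (rv ''wt'') (rv ''best''))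
     (Seq (RSet ''best'' (N 0) (rv ''wt''))
       (for_loop ''v'' (iv ''n'') (ISet ''A'' (iv ''v'') (IVal ''C'' (iv ''v'')))))
     Skip"

definition solve_sample :: "com \<Rightarrow> com" where
  "solve_sample Q = If (ILess (N 1) (iv ''cnt''))
     (Seq (Call [''n'', ''m'', ''src'', ''dst'', ''w'', ''R''] Q [''C''])
       (Seq weigh keep_best))
     Skip"

definition round_body :: "com \<Rightarrow> com" where
  "round_body Q = Seq draw_scale (Seq (for_loop ''v'' (iv ''n'') sample_vertex)
     (Seq prune_count (solve_sample Q)))"

definition round_in :: "vname list" where
  "round_in = [''n'', ''m'', ''src'', ''dst'', ''w'', ''l'', ''thr'', ''cap'', ''base'', ''best'', ''A'']"

definition cut_round :: "com \<Rightarrow> com" where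
  "cut_round Q = Call round_in (round_body Q) [''best'', ''A'']"

locale oracle_graph = instance_graph +
  fixes Q :: com and T :: "nat \<Rightarrow> nat \<Rightarrow> real" and \<delta> :: real
  assumes ivc: "computes_min_isolating_cut Q T"
    and reads_input: "\<delta> > 0" "\<And>m n. \<delta> * real (m + n) \<le> T m n"
begin

abbreviation "size_in \<equiv> n + length es"

definition inp :: "store \<Rightarrow> bool" where
  "inp s \<longleftrightarrow> agree {''n'', ''m'', ''src'', ''dst'', ''w''} s (graph_store n es w)"

definition aset :: "store \<Rightarrow> nat set" where
  "aset s = {v. v < n \<and> ints s ''A'' (int v) \<noteq> 0}"

lemma inp_simps:
  assumes "inp s"
  shows "ints s ''n'' 0 = int n" "ints s ''m'' 0 = int (length es)"
    "k < length es \<Longrightarrow> ints s ''src'' (int k) = int (fst (es ! k))"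
    "k < length es \<Longrightarrow> ints s ''dst'' (int k) = int (snd (es ! k))"
    "v < n \<Longrightarrow> reals s ''w'' (int v) = w v"
  using assms by (simp_all add: inp_def agree_def graph_store_def arr_def)

lemma inp_upd [simp]:
  "x \<notin> {''n'', ''m'', ''src'', ''dst'', ''w''} \<Longrightarrow> inp (iupd x i k s) = inp s"
  "x \<notin> {''n'', ''m'', ''src'', ''dst'', ''w''} \<Longrightarrow> inp (rupd x i r s) = inp s"
  by (simp_all add: inp_def)

lemma inp_transfer_in [simp]:
  "{''n'', ''m'', ''src'', ''dst'', ''w''} \<subseteq> set xs \<Longrightarrow> inp (transfer_arrays xs s s') = inp s"
  by (simp add: inp_def agree_def)

lemma inp_transfer_out [simp]:
  "{''n'', ''m'', ''src'', ''dst'', ''w''} \<inter> set xs = {} \<Longrightarrow> inp (transfer_arrays xs s s') = inp s'"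
  by (simp add: inp_def agree_def)

lemma T_nonneg: "0 \<le> T m k"
  using reads_input(2)[of m k] reads_input(1) by (smt (verit) mult_nonneg_nonneg of_nat_0_le_iff)

lemma AS_oracle:
  assumes "inp s" "ints s ''R'' = ind Y" "reals s ''R'' = (\<lambda>_. 0)"
    and "independent_set V E Y" "Y \<noteq> {}"
  shows "AS Q (transfer_arrays [''n'', ''m'', ''src'', ''dst'', ''w'', ''R''] s zero_store)
    (\<lambda>t s'. real t \<le> T (card E) n \<and> min_isolating_cut V E w Y (output_set n s'))"
proof -
  have "Y \<subseteq> V" using assms by (simp add: independent_set_def)
  then have "transfer_arrays [''n'', ''m'', ''src'', ''dst'', ''w'', ''R''] s zero_store = ivc_store n es w Y"
    using assms ind_arr[of Y n]
    by (auto simp: transfer_arrays_def ivc_store_def graph_store_def inp_def agree_def zero_store_def fun_eq_iff)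
  then show ?thesis
    using ivc graph edges w_pos assms unfolding computes_min_isolating_cut_def
    by (intro run_prob_eq_1_imp_AS) auto
qed

lemma AS_solve_sample:
  assumes s: "inp s" "ints s ''R'' = ind Y" "reals s ''R'' = (\<lambda>_. 0)" "reals s ''wt'' 0 = 0"
    and Y: "independent_set V E Y" "ints s ''cnt'' 0 = int (card Y)"
  shows "AS (solve_sample Q) s (\<lambda>t s'. real t \<le> T (card E) n + 10 * real n + 10 \<and>
    best s' \<le> best s \<and>
    (best s' = best s \<and> ints s' ''A'' = ints s ''A'' \<or>
      vertex_cut V E (aset s') \<and> best s' = sum w (aset s')) \<and>
    (2 \<le> card Y \<longrightarrow> (\<forall>D. isolating_cut V E Y D \<longrightarrow> best s' \<le> sum w D)))"
    (is "AS _ _ ?Q")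
proof (cases "2 \<le> card Y")
  case False
  then show ?thesis
    using Y(2) T_nonneg[of "card E" n] by (simp add: solve_sample_def)
next
  case True
  let ?xs = "[''n'', ''m'', ''src'', ''dst'', ''w'', ''R'']"
  have "Y \<noteq> {}" "Y \<subseteq> V" using True Y by (auto simp: independent_set_def)
  let ?I = "\<lambda>C k s'. inp s' \<and> agree (-{''C'', ''v'', ''wt''}) s' s \<and> output_set n s' = C \<and>
      reals s' ''wt'' 0 = sum w (C \<inter> {..<k})"
  let ?J = "\<lambda>C k s'. inp s' \<and> best s' = sum w C \<and> output_set n s' = C \<and>
      (\<forall>v<k. ints s' ''A'' (int v) = ints s' ''C'' (int v))"
  have "AS (Call ?xs Q [''C'']) s (\<lambda>t s'. real t \<le> T (card E) n + 1 \<and> (\<exists>C. ?I C 0 s' \<and> min_isolating_cut V E w Y C))"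
    unfolding AS_Call
  proof (rule AS_mono[OF AS_oracle[OF s(1-3) Y(1) \<open>Y \<noteq> {}\<close>]])
    fix t s'
    assume "real t \<le> T (card E) n \<and> min_isolating_cut V E w Y (output_set n s')"
    then show "real (1 + t) \<le> T (card E) n + 1 \<and>
      (\<exists>C. ?I C 0 (transfer_arrays [''C''] s' s) \<and> min_isolating_cut V E w Y C)"
      using s by (auto simp: output_set_def agree_def)
  qed
  then have solve: "AS (solve_sample Q) s ?Q" if
    "\<And>t s' C. real t \<le> T (card E) n + 1 \<Longrightarrow> ?I C 0 s' \<Longrightarrow> min_isolating_cut V E w Y C \<Longrightarrow>
      AS weigh s'
      (\<lambda>t' s'. AS keep_best s' (\<lambda>t'' s'. ?Q (1 + (t + (t' + t''))) s'))"
    unfolding solve_sample_def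
    apply (intro AS_IfI AS_SeqI)
    subgoal using True Y(2) by simp
    subgoal by (erule AS_mono) (rule AS_SeqI, elim conjE exE, rule that; (intro conjI)?; assumption)
    done
  show ?thesis
  proof (rule solve)
    fix t0 s0 C
    assume t0: "real t0 \<le> T (card E) n + 1" and s0: "?I C 0 s0" and C: "min_isolating_cut V E w Y C"
    show "AS weigh s0
      (\<lambda>t' s'. AS keep_best s' (\<lambda>t'' s'. ?Q (1 + (t0 + (t' + t''))) s'))"
    proof (rule AS_for_loop[where I = "?I C" and tb = 3])
    show "?I C 0 (iupd ''v'' 0 0 s0)" using s0 by (simp add: output_set_def)
  next
    fix k s' assume "?I C k s'"
    then show "ieval (iv ''n'') s' = int n" by (simp add: inp_simps)
  next
    fix k s' assume k: "k < n" and I: "?I C k s'" and v: "ints s' ''v'' 0 = int k"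
    have "C \<inter> {..<Suc k} = (if k \<in> C then insert k (C \<inter> {..<k}) else C \<inter> {..<k})"
      by (auto simp: less_Suc_eq)
    moreover have "k \<in> C \<longleftrightarrow> ints s' ''C'' (int k) \<noteq> 0"
      using I k by (auto simp: output_set_def)
    ultimately show "AS (If (nonzero (IVal ''C'' (iv ''v'')))
             (RSet ''wt'' (N 0) (RAdd (rv ''wt'') (RVal ''w'' (iv ''v'')))) Skip) s'
        (\<lambda>t s''. t \<le> 3 \<and> ints s'' ''v'' 0 = int k \<and> ?I C (Suc k) (iupd ''v'' 0 (int (Suc k)) s''))"
      using I k v by (simp add: inp_simps output_set_def)
  next
    fix t s' assume t: "t \<le> 2 + n * (3 + 2)" and I: "?I C n s'"
    have ic: "isolating_cut V E Y C" using C by (simp add: min_isolating_cut_def)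
    have CV: "C \<subseteq> V" using ic by (auto simp: isolating_cut_def)
    have vc: "vertex_cut V E C"
      using isolating_cut_vertex_cut[OF _ ic \<open>Y \<subseteq> V\<close> True] by simp
    have wt: "reals s' ''wt'' 0 = sum w C"
      using I CV by (simp add: Int_absorb2)
    have min: "\<forall>D. isolating_cut V E Y D \<longrightarrow> sum w C \<le> sum w D"
      using C by (simp add: min_isolating_cut_def)
    have best: "best s' = best s" "ints s' ''A'' = ints s ''A''"
      using I by (auto simp: agree_def)
    show "AS keep_best s' (\<lambda>t'' s'. ?Q (1 + (t0 + (t + t''))) s')"
    proof (cases "sum w C < best s")
      case False
      then show ?thesis using t t0 wt best min by (auto simp: not_less intro: order_trans)
    next
      case less: True
      have "AS (for_loop ''v'' (iv ''n'') (ISet ''A'' (iv ''v'') (IVal ''C'' (iv ''v''))))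
          (rupd ''best'' 0 (sum w C) s') (\<lambda>t'' s'. ?Q (1 + (t0 + (t + (1 + (1 + t''))))) s')"
      proof (rule AS_for_loop[where I = "?J C" and tb = 1])
        show "?J C 0 (iupd ''v'' 0 0 (rupd ''best'' 0 (sum w C) s'))"
          using I by (simp add: output_set_def)
      next
        fix k s' assume "?J C k s'"
        then show "ieval (iv ''n'') s' = int n" by (simp add: inp_simps)
      next
        fix k s' assume "k < n" "?J C k s'" "ints s' ''v'' 0 = int k"
        then show "AS (ISet ''A'' (iv ''v'') (IVal ''C'' (iv ''v''))) s'
           (\<lambda>t s''. t \<le> 1 \<and> ints s'' ''v'' 0 = int k \<and> ?J C (Suc k) (iupd ''v'' 0 (int (Suc k)) s''))"
          by (simp add: output_set_def less_Suc_eq)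
      next
        fix t'' s'' assume t'': "t'' \<le> 2 + n * (1 + 2)" and J: "?J C n s''"
        then have "aset s'' = C" by (auto simp: aset_def output_set_def)
        moreover have "real (1 + (t0 + (t + (1 + (1 + t''))))) \<le> T (card E) n + 10 * real n + 10"
          using t t0 t'' by simp
        ultimately show "?Q (1 + (t0 + (t + (1 + (1 + t''))))) s''"
          using J vc less min by simp
      qed
      then show ?thesis using wt best less by simp
    qed
    qed
  qed
qed

end

definition hits :: "nat \<Rightarrow> real \<Rightarrow> nat" where
  "hits K y = card {r. r < K \<and> real r < y}"

lemma hits_le: "hits K y \<le> K"
proof -
  have "hits K y \<le> card {..<K}" unfolding hits_def by (intro card_mono) auto
  then show ?thesis by simp
qed

lemma hits_upper: "0 \<le> y \<Longrightarrow> real (hits K y) \<le> y + 1"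
proof -
  assume y: "0 \<le> y"
  have "hits K y \<le> card {..<nat \<lceil>y\<rceil>}"
    unfolding hits_def by (intro card_mono) (auto, linarith)
  also have "\<dots> = nat \<lceil>y\<rceil>" by simp
  finally show ?thesis using y by linarith
qed

lemma hits_lower: "min (real K) y \<le> real (hits K y)"
proof (cases "y \<le> 0")
  case False
  have "{..<min K (nat \<lceil>y\<rceil>)} \<subseteq> {r. r < K \<and> real r < y}"
    by (auto, linarith)
  then have "card {..<min K (nat \<lceil>y\<rceil>)} \<le> hits K y"
    unfolding hits_def by (intro card_mono) auto
  then have "min K (nat \<lceil>y\<rceil>) \<le> hits K y" by simp
  then have "K \<le> hits K y \<or> nat \<lceil>y\<rceil> \<le> hits K y" by linarith
  moreover have "y \<le> real (nat \<lceil>y\<rceil>)" by linarith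
  ultimately show ?thesis by linarith
qed simp

lemma sum_hits:
  fixes a b :: real
  shows "(\<Sum>j<K. if real j < y then a else b) = real (hits K y) * a + real (K - hits K y) * b"
proof -
  have "(\<Sum>j<K. if real j < y then a else b)
      = (\<Sum>j\<in>{..<K} \<inter> {j. real j < y}. a) + (\<Sum>j\<in>{..<K} \<inter> - {j. real j < y}. b)"
    by (subst sum.If_cases) auto
  also have "{..<K} \<inter> {j. real j < y} = {r. r < K \<and> real r < y}" by auto
  also have "{..<K} \<inter> - {j. real j < y} = {..<K} - {r. r < K \<and> real r < y}" by auto
  finally show ?thesis
    by (subst (asm) (2) sum_constant, subst (asm) card_Diff_subset) (auto simp: hits_def)
qed

lemma prod_ge_1_minus_sum:
  fixes q :: "'a \<Rightarrow> real"
  assumes "finite A" "\<And>v. v \<in> A \<Longrightarrow> 0 \<le> q v" "\<And>v. v \<in> A \<Longrightarrow> q v \<le> 1"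
  shows "1 - sum q A \<le> (\<Prod>v\<in>A. 1 - q v)"
  using assms
proof (induction A rule: finite_induct)
  case (insert x A)
  then have IH: "1 - sum q A \<le> (\<Prod>v\<in>A. 1 - q v)" by simp
  have le1: "(\<Prod>v\<in>A. 1 - q v) \<le> 1" using insert by (intro prod_le_1) auto
  have "q x * (\<Prod>v\<in>A. 1 - q v) \<le> q x" using insert.prems le1 by (intro mult_left_le) auto
  then show ?case using insert IH by (simp add: algebra_simps)
qed simp

lemma one_minus_prod_ge:
  fixes q :: "'a \<Rightarrow> real"
  assumes "finite A" "\<And>v. v \<in> A \<Longrightarrow> 0 \<le> q v" "\<And>v. v \<in> A \<Longrightarrow> q v \<le> 1"
  shows "min 1 (sum q A) / 2 \<le> 1 - (\<Prod>v\<in>A. 1 - q v)"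
proof -
  have "(\<Prod>v\<in>A. 1 - q v) \<le> (\<Prod>v\<in>A. exp (- q v))"
    using assms exp_ge_add_one_self[of "- q _"] by (intro prod_mono) auto
  also have "\<dots> = exp (- sum q A)" using assms by (simp add: exp_sum sum_negf[symmetric])
  also have "\<dots> \<le> exp (- min 1 (sum q A))" by simp
  also have "\<dots> \<le> 1 - min 1 (sum q A) / 2"
  proof -
    define y where "y = min 1 (sum q A)"
    have y: "0 \<le> y" "y \<le> 1" using assms by (auto simp: y_def sum_nonneg)
    have "1 + y \<le> exp y" by (rule exp_ge_add_one_self)
    then have "exp (- y) \<le> 1 / (1 + y)" using y by (simp add: exp_minus field_simps)
    also have "\<dots> \<le> 1 - y / 2"
    proof -
      have "1 \<le> (1 - y / 2) * (1 + y)" using y mult_nonneg_nonneg[of y "1 - y"] by (simp add: algebra_simps)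
      then show ?thesis using y by (simp add: divide_le_eq)
    qed
    finally show ?thesis unfolding y_def .
  qed
  finally show ?thesis by simp
qed

text \<open>Consider extending \<open>X\<close> by independent choices among the vertices \<open>k, \<dots>, n - 1\<close>, where
  \<open>v\<close> is chosen with probability \<open>q v\<close>. The first function bounds from below the probability that
  the result misses \<open>C\<close> and meets \<open>S\<close> exactly once, the second is the probability that it meets
  \<open>D\<close>.\<close>

definition once_prob :: "(nat \<Rightarrow> real) \<Rightarrow> nat set \<Rightarrow> nat set \<Rightarrow> nat \<Rightarrow> nat \<Rightarrow> nat set \<Rightarrow> real" where
  "once_prob q S C n k X =
    (if X \<inter> C \<noteq> {} then 0
     else if X \<inter> S = {} then (\<Prod>v\<in>(S \<union> C) \<inter> {k..<n}. 1 - q v) * sum q (S \<inter> {k..<n})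
     else if card (X \<inter> S) = 1 then (\<Prod>v\<in>(S \<union> C) \<inter> {k..<n}. 1 - q v) else 0)"

definition meet_prob :: "(nat \<Rightarrow> real) \<Rightarrow> nat set \<Rightarrow> nat \<Rightarrow> nat \<Rightarrow> nat set \<Rightarrow> real" where
  "meet_prob q D n k X = (if X \<inter> D \<noteq> {} then 1 else 1 - (\<Prod>v\<in>D \<inter> {k..<n}. 1 - q v))"

definition isolate_prob ::
    "(nat \<Rightarrow> real) \<Rightarrow> nat set \<Rightarrow> nat set \<Rightarrow> nat set \<Rightarrow> nat \<Rightarrow> nat \<Rightarrow> nat set \<Rightarrow> real" where
  "isolate_prob q S C D n k X = once_prob q S C n k X * meet_prob q D n k X"

lemma Int_Ico_Suc:
  "k < n \<Longrightarrow> A \<inter> {k..<n} = (if k \<in> A then insert k (A \<inter> {Suc k..<n}) else A \<inter> {Suc k..<n})"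
  by (auto simp: Suc_le_eq order.order_iff_strict)

context
  fixes q :: "nat \<Rightarrow> real"
  assumes q: "\<And>v. 0 \<le> q v" "\<And>v. q v \<le> 1"
begin

lemma prod_bounds: "0 \<le> (\<Prod>v\<in>A. 1 - q v)" "(\<Prod>v\<in>A. 1 - q v) \<le> 1"
  using q by (auto intro!: prod_nonneg prod_le_1)

lemma once_prob_nonneg: "0 \<le> once_prob q S C n k X"
  unfolding once_prob_def using q prod_bounds by (auto intro!: mult_nonneg_nonneg sum_nonneg)

lemma meet_prob_nonneg: "0 \<le> meet_prob q D n k X"
  unfolding meet_prob_def using prod_bounds by auto

lemma isolate_prob_nonneg: "0 \<le> isolate_prob q S C D n k X"
  unfolding isolate_prob_def using once_prob_nonneg meet_prob_nonneg by (rule mult_nonneg_nonneg)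

lemma once_prob_le_1: "once_prob q S C n k X \<le> 1"
proof -
  have "(\<Prod>v\<in>(S \<union> C) \<inter> {k..<n}. 1 - q v) * sum q (S \<inter> {k..<n}) \<le> 1"
  proof -
    let ?A = "S \<inter> {k..<n}" and ?B = "(S \<union> C) \<inter> {k..<n}"
    have "(\<Prod>v\<in>?B. 1 - q v) = (\<Prod>v\<in>?A. 1 - q v) * (\<Prod>v\<in>?B - ?A. 1 - q v)"
      by (subst prod.subset_diff[of ?A ?B]) (auto simp: mult.commute)
    also have "\<dots> \<le> (\<Prod>v\<in>?A. 1 - q v)" using prod_bounds by (intro mult_left_le) auto
    also have "\<dots> \<le> exp (- sum q ?A)"
      using q exp_ge_add_one_self[of "- q _"]
      by (subst sum_negf[symmetric], subst exp_sum) (auto intro!: prod_mono)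
    finally have "(\<Prod>v\<in>?B. 1 - q v) * sum q ?A \<le> exp (- sum q ?A) * sum q ?A"
      using q by (intro mult_right_mono sum_nonneg) auto
    also have "\<dots> \<le> exp (- sum q ?A) * exp (sum q ?A)"
    proof (intro mult_left_mono)
      show "sum q ?A \<le> exp (sum q ?A)" using exp_ge_add_one_self[of "sum q ?A"] by linarith
    qed simp
    finally show ?thesis by (simp add: exp_minus)
  qed
  then show ?thesis unfolding once_prob_def using prod_bounds by auto
qed

lemma isolate_prob_le_1: "isolate_prob q S C D n k X \<le> 1"
proof -
  have "meet_prob q D n k X \<le> 1" unfolding meet_prob_def using prod_bounds by auto
  then show ?thesis
    unfolding isolate_prob_def using once_prob_le_1 once_prob_nonneg meet_prob_nonneg
    by (intro mult_le_one) auto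
qed

lemma isolate_prob_step:
  assumes k: "k < n" and X: "X \<subseteq> {..<k}"
    and disj: "S \<inter> C = {}" "S \<inter> D = {}" "C \<inter> D = {}" and cover: "k \<in> S \<union> C \<union> D"
  shows "isolate_prob q S C D n k X \<le>
    q k * isolate_prob q S C D n (Suc k) (insert k X) + (1 - q k) * isolate_prob q S C D n (Suc k) X"
proof -
  have kX: "k \<notin> X" using X by auto
  have fX: "finite X" using X by (rule finite_subset) simp
  have D0: "meet_prob q D n k X = meet_prob q D n (Suc k) X"
    "meet_prob q D n (Suc k) (insert k X) = meet_prob q D n (Suc k) X" if "k \<notin> D"
    using that by (simp_all add: meet_prob_def Int_Ico_Suc[OF k])
  have S0: "once_prob q S C n k X = once_prob q S C n (Suc k) X"
    "once_prob q S C n (Suc k) (insert k X) = once_prob q S C n (Suc k) X" if "k \<notin> S" "k \<notin> C"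
    using that by (simp_all add: once_prob_def Int_Ico_Suc[OF k])
  consider "k \<in> S" "k \<notin> C" "k \<notin> D" | "k \<in> C" "k \<notin> S" "k \<notin> D" | "k \<in> D" "k \<notin> S" "k \<notin> C"
    using cover disj by blast
  then show ?thesis
  proof cases
    case 1
    have c: "card (insert k (X \<inter> S)) = Suc (card (X \<inter> S))" using kX fX by simp
    define p where "p = (\<Prod>v\<in>(S \<union> C) \<inter> {Suc k..<n}. 1 - q v)"
    define \<sigma> where "\<sigma> = sum q (S \<inter> {Suc k..<n})"
    have p: "0 \<le> p" unfolding p_def by (rule prod_bounds)
    have I: "(\<Prod>v\<in>(S \<union> C) \<inter> {k..<n}. 1 - q v) = (1 - q k) * p" "sum q (S \<inter> {k..<n}) = q k + \<sigma>"
      using 1 by (simp_all add: Int_Ico_Suc[OF k] p_def \<sigma>_def)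
    have "once_prob q S C n k X \<le>
        q k * once_prob q S C n (Suc k) (insert k X) + (1 - q k) * once_prob q S C n (Suc k) X"
    proof (cases "X \<inter> C = {} \<and> X \<inter> S = {}")
      case True
      have "(1 - q k) * p * (q k + \<sigma>) \<le> q k * p + (1 - q k) * (p * \<sigma>)"
        using q[of k] p mult_nonneg_nonneg[of "q k * q k" p] by (simp add: algebra_simps)
      then show ?thesis
        using 1 True c by (simp add: once_prob_def I p_def[symmetric] \<sigma>_def[symmetric])
    next
      case False
      then show ?thesis
        using 1 c q[of k] p by (auto simp: once_prob_def I p_def[symmetric] \<sigma>_def[symmetric])
    qed
    from mult_right_mono[OF this meet_prob_nonneg[of D n "Suc k" X]] show ?thesis
      using D0[OF 1(3)] by (simp add: isolate_prob_def algebra_simps)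
  next
    case 2
    have "once_prob q S C n k X = (1 - q k) * once_prob q S C n (Suc k) X"
      "once_prob q S C n (Suc k) (insert k X) = 0"
      using 2 by (simp_all add: once_prob_def Int_Ico_Suc[OF k])
    then show ?thesis
      using D0[OF 2(3)] by (simp add: isolate_prob_def)
  next
    case 3
    have "meet_prob q D n k X =
        q k * meet_prob q D n (Suc k) (insert k X) + (1 - q k) * meet_prob q D n (Suc k) X"
      using 3 by (simp add: meet_prob_def Int_Ico_Suc[OF k] algebra_simps)
    then show ?thesis
      by (simp only: isolate_prob_def S0[OF 3(2,3)]) (simp add: algebra_simps)
  qed
qed

end

lemma isolate_prob_end:
  "isolate_prob q S C D n n X = (if X \<inter> C = {} \<and> card (X \<inter> S) = 1 \<and> X \<inter> D \<noteq> {} then 1 else 0)"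
  by (auto simp: isolate_prob_def once_prob_def meet_prob_def)

context oracle_graph
begin

lemma AS_prune_count:
  assumes s: "inp s" "ints s ''R'' = ind X" "X \<subseteq> V" "ints s ''cnt'' 0 = 0"
  shows "AS prune_count s (\<lambda>t s'. t \<le> 10 * size_in + 10 \<and> agree (-{''e'', ''R'', ''v'', ''cnt''}) s' s \<and>
    reals s' = reals s \<and> ints s' ''R'' = ind (prune es X) \<and>
    ints s' ''cnt'' 0 = int (card (prune es X)))"
proof -
  let ?Y = "prune es X"
  let ?I = "\<lambda>k s'. inp s' \<and> agree (-{''e'', ''R'', ''v'', ''cnt''}) s' s \<and> reals s' = reals s \<and>
      ints s' ''cnt'' 0 = 0 \<and> ints s' ''R'' = ind (prune (take k es) X)"
  let ?J = "\<lambda>k s'. inp s' \<and> agree (-{''e'', ''R'', ''v'', ''cnt''}) s' s \<and> reals s' = reals s \<and>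
      ints s' ''cnt'' 0 = int (card (?Y \<inter> {..<k})) \<and> ints s' ''R'' = ind ?Y"
  show ?thesis
    unfolding prune_count_def
  proof (rule AS_SeqI, rule AS_for_loop[where I = ?I and tb = 2])
    show "?I 0 (iupd ''e'' 0 0 s)" using s by simp
  next
    fix k s' assume "?I k s'"
    then show "ieval (iv ''m'') s' = int (length es)" by (simp add: inp_simps)
  next
    fix k s' assume k: "k < length es" and I: "?I k s'" and e: "ints s' ''e'' 0 = int k"
    obtain a b where ab: "es ! k = (a, b)" by fastforce
    have "prune (take (Suc k) es) X =
        (let R = prune (take k es) X in if a \<in> R \<and> b \<in> R then R - {b} else R)"
      using k ab by (simp add: take_Suc_conv_app_nth prune_append Let_def)
    then show "AS prune_edge s'
       (\<lambda>t s''. t \<le> 2 \<and> ints s'' ''e'' 0 = int k \<and> ?I (Suc k) (iupd ''e'' 0 (int (Suc k)) s''))"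
      using I e k ab by (simp add: inp_simps Let_def)
  next
    fix t s' assume t: "t \<le> 2 + length es * (2 + 2)" and I: "?I (length es) s'"
    show "AS count_sample s'
      (\<lambda>t' s'. t + t' \<le> 10 * size_in + 10 \<and> agree (-{''e'', ''R'', ''v'', ''cnt''}) s' s \<and>
         reals s' = reals s \<and> ints s' ''R'' = ind ?Y \<and> ints s' ''cnt'' 0 = int (card ?Y))"
    proof (rule AS_for_loop[where I = ?J and tb = 1])
      show "?J 0 (iupd ''v'' 0 0 s')" using I by simp
    next
      fix k s' assume "?J k s'"
      then show "ieval (iv ''n'') s' = int n" by (simp add: inp_simps)
    next
      fix k s' assume k: "k < n" and J: "?J k s'" and v: "ints s' ''v'' 0 = int k"
      have "?Y \<inter> {..<Suc k} = (if k \<in> ?Y then insert k (?Y \<inter> {..<k}) else ?Y \<inter> {..<k})"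
        by (auto simp: less_Suc_eq)
      then show "AS (ISet ''cnt'' (N 0) (IAdd (iv ''cnt'') (IVal ''R'' (iv ''v'')))) s'
          (\<lambda>t s''. t \<le> 1 \<and> ints s'' ''v'' 0 = int k \<and> ?J (Suc k) (iupd ''v'' 0 (int (Suc k)) s''))"
        using J v by simp
    next
      fix t' s' assume t': "t' \<le> 2 + n * (1 + 2)" and J: "?J n s'"
      have "?Y \<subseteq> V" using prune_subset[of es X] s(3) by (rule order_trans)
      then show "t + t' \<le> 10 * size_in + 10 \<and> agree (-{''e'', ''R'', ''v'', ''cnt''}) s' s \<and>
         reals s' = reals s \<and> ints s' ''R'' = ind ?Y \<and> ints s' ''cnt'' 0 = int (card ?Y)"
        using J t t' by (simp add: Int_absorb2)
    qed
  qed
qed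

lemma AS_draw_scale_rest:
  assumes s: "inp s" "ints s ''j'' 0 = int j"
  shows "AS draw_scale_rest s (\<lambda>t s'. t \<le> 2 + 3 * j \<and> agree (-{''j'', ''lam''}) s' s \<and>
    reals s' ''lam'' 0 = real n * real n / reals s ''cap'' 0 / 2 ^ j)"
proof -
  let ?W = "While (ILess (N 0) (iv ''j''))
         (Seq (RSet ''lam'' (N 0) (RDiv (rv ''lam'') (OfInt (N 2))))
           (ISet ''j'' (N 0) (ISub (iv ''j'') (N 1))))"
  have "AS ?W s' (\<lambda>t s''. t \<le> 1 + 3 * j \<and> agree (-{''j'', ''lam''}) s'' s \<and>
      reals s'' ''lam'' 0 = reals s' ''lam'' 0 / 2 ^ j)"
    if "ints s' ''j'' 0 = int j" "agree (-{''j'', ''lam''}) s' s" for s' j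
    using that
  proof (induction j arbitrary: s')
    case 0
    then show ?case by (subst AS_While) simp
  next
    case (Suc j)
    let ?s = "iupd ''j'' 0 (int j) (rupd ''lam'' 0 (reals s' ''lam'' 0 / 2) s')"
    have "AS ?W ?s (\<lambda>t s''. t \<le> 1 + 3 * j \<and> agree (-{''j'', ''lam''}) s'' s \<and>
      reals s'' ''lam'' 0 = reals ?s ''lam'' 0 / 2 ^ j)"
      using Suc.prems by (intro Suc.IH) simp_all
    then have "AS ?W ?s (\<lambda>t s''. 1 + (1 + 1 + t) \<le> 1 + 3 * Suc j \<and> agree (-{''j'', ''lam''}) s'' s \<and>
      reals s'' ''lam'' 0 = reals s' ''lam'' 0 / 2 ^ Suc j)"
      by (rule AS_mono) auto
    then show ?case using Suc.prems by (subst AS_While) simp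
  qed
  from this[of "rupd ''lam'' 0 (real n * real n / reals s ''cap'' 0) s" j] s
  show ?thesis by (simp add: draw_scale_rest_def inp_simps)
qed

definition sampled :: "store \<Rightarrow> nat set \<Rightarrow> store \<Rightarrow> bool" where
  "sampled s X s' \<longleftrightarrow> agree (-{''v'', ''r'', ''u'', ''R''}) s' s \<and> reals s' ''R'' = reals s ''R'' \<and>
     ints s' ''R'' = ind X"

definition sample_weight :: "store \<Rightarrow> nat \<Rightarrow> real" where
  "sample_weight s v = (if reals s ''thr'' 0 < w v then reals s ''cap'' 0 else reals s ''base'' 0 * w v)"

lemma sampled_inp: "sampled s X s' \<Longrightarrow> inp s \<Longrightarrow> inp s'"
  by (auto simp: sampled_def inp_def agree_def)

lemma sampled_upd [simp]:
  "x \<in> {''v'', ''r'', ''u''} \<Longrightarrow> sampled s X (iupd x i k s') = sampled s X s'"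
  "x \<in> {''v'', ''r'', ''u''} \<Longrightarrow> sampled s X (rupd x i q s') = sampled s X s'"
  by (auto simp: sampled_def)

lemma sampled_insert [simp]:
  "sampled s X s' \<Longrightarrow> sampled s (insert v X) (iupd ''R'' (int v) 1 s')"
  by (auto simp: sampled_def)

lemma sampled_reals: "sampled s X s' \<Longrightarrow> x \<notin> {''v'', ''r'', ''u'', ''R''} \<Longrightarrow> reals s' x = reals s x"
  by (simp add: sampled_def agree_def)

lemma AS_sample:
  assumes s: "inp s" "ints s ''R'' = (\<lambda>_. 0)"
  shows "AS (for_loop ''v'' (iv ''n'') sample_vertex) s
    (\<lambda>t s'. t \<le> 10 * n + 2 \<and> (\<exists>X\<subseteq>V. sampled s X s'))"
proof (rule AS_for_loop[where I = "\<lambda>k s'. \<exists>X\<subseteq>{..<k}. sampled s X s'" and tb = 5])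
  show "\<exists>X\<subseteq>{..<0}. sampled s X (iupd ''v'' 0 0 s)"
    using s by (auto simp: sampled_def)
next
  fix k s' assume "\<exists>X\<subseteq>{..<k}. sampled s X s'"
  then show "ieval (iv ''n'') s' = int n" using s sampled_inp by (auto simp: inp_simps)
next
  fix k s' assume k: "k < n" "\<exists>X\<subseteq>{..<k}. sampled s X s'" and v: "ints s' ''v'' 0 = int k"
  then obtain X where X: "X \<subseteq> {..<k}" "sampled s X s'" by blast
  have XS: "X \<subseteq> {..<Suc k}" "insert k X \<subseteq> {..<Suc k}" using X by auto
  have e: "\<exists>X\<subseteq>{..<Suc k}. sampled s X s''" "\<exists>X\<subseteq>{..<Suc k}. sampled s X (iupd ''R'' (int k) 1 s'')"
    if "sampled s X s''" for s''
    using that XS sampled_insert[of s X s'' k] by blast+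
  show "AS sample_vertex s' (\<lambda>t s''. t \<le> 5 \<and> ints s'' ''v'' 0 = int k \<and>
      (\<exists>X\<subseteq>{..<Suc k}. sampled s X (iupd ''v'' 0 (int (Suc k)) s'')))"
    using X(2) v by (simp add: sample_vertex_def e)
next
  fix t s' assume "t \<le> 2 + n * (5 + 2)" "\<exists>X\<subseteq>{..<n}. sampled s X s'"
  then show "t \<le> 10 * n + 2 \<and> (\<exists>X\<subseteq>V. sampled s X s')" by auto
qed

lemma expf_sample:
  fixes q :: "nat \<Rightarrow> real"
  assumes s: "inp s" "ints s ''R'' = (\<lambda>_. 0)"
    and q: "\<And>v. q v = real (hits (4 * n) (reals s ''lam'' 0 * sample_weight s v)) / real (4 * n)"
    and sep: "separation V E S C D"
    and f: "\<And>t s'. f t s' \<le> 1"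
      "\<And>t s' X. X \<subseteq> V \<Longrightarrow> sampled s X s' \<Longrightarrow> X \<inter> C = {} \<Longrightarrow> card (X \<inter> S) = 1 \<Longrightarrow> X \<inter> D \<noteq> {} \<Longrightarrow> f t s' = 0"
  shows "expf (for_loop ''v'' (iv ''n'') sample_vertex) s f \<le> ennreal (1 - isolate_prob q S C D n 0 {})"
proof -
  define L where "L = isolate_prob q S C D n"
  define rset :: "store \<Rightarrow> nat set" where "rset = (\<lambda>s'. {v. ints s' ''R'' (int v) = 1})"
  have n: "0 < n" using n_ge_2 by simp
  have q01: "0 \<le> q v" "q v \<le> 1" for v
  proof -
    have "real (hits (4 * n) (reals s ''lam'' 0 * sample_weight s v)) \<le> real (4 * n)"
      using hits_le by (rule of_nat_mono)
    then show "0 \<le> q v" "q v \<le> 1" using n by (simp_all add: q divide_le_eq_1)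
  qed
  have L0: "0 \<le> L k X" for k X unfolding L_def using q01 by (rule isolate_prob_nonneg)
  have rset: "rset s' = X" if "sampled s X s'" for s' X
    using that by (auto simp: rset_def sampled_def split: if_splits)
  have rset_upd [simp]: "rset (iupd x i k s') = rset s'" "rset (rupd x i r s') = rset s'"
    if "x \<noteq> ''R''" for x i k r s' using that by (auto simp: rset_def)
  have "expf (for_loop ''v'' (iv ''n'') sample_vertex) s f \<le>
      (\<lambda>k s'. ennreal (1 - L k (rset s'))) 0 (iupd ''v'' 0 0 s)"
  proof (rule expf_for_loop[where I = "\<lambda>k s'. \<exists>X\<subseteq>{..<k}. sampled s X s'" and G = "\<lambda>k s'. ennreal (1 - L k (rset s'))" and timed = False and tb = 0])
    show "\<exists>X\<subseteq>{..<0}. sampled s X (iupd ''v'' 0 0 s)"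
      using s by (auto simp: sampled_def)
  next
    fix k s' assume "\<exists>X\<subseteq>{..<k}. sampled s X s'"
    then show "ieval (iv ''n'') s' = int n" using s sampled_inp by (auto simp: inp_simps)
  next
    fix k s' assume k: "k < n" and "\<exists>X\<subseteq>{..<k}. sampled s X s'" and v: "ints s' ''v'' 0 = int k"
    then obtain X where X: "X \<subseteq> {..<k}" "sampled s X s'" by blast
    let ?f = "\<lambda>t s''. if (False \<longrightarrow> real t \<le> 0) \<and> ints s'' ''v'' 0 = int k \<and>
           (\<exists>X\<subseteq>{..<Suc k}. sampled s X (iupd ''v'' 0 (int (Suc k)) s''))
        then ennreal (1 - L (Suc k) (rset (iupd ''v'' 0 (int (Suc k)) s''))) else 1"
    have XS: "X \<subseteq> {..<Suc k}" "insert k X \<subseteq> {..<Suc k}" using X by auto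
    have inp: "inp s'" using X s sampled_inp by blast
    define y where "y = reals s ''lam'' 0 * sample_weight s k"
    define K where "K = 4 * n"
    have K: "0 < K" using n by (simp add: K_def)
    define F where "F = ?f 0"
    have F: "F s'' = ennreal (1 - L (Suc k) Z)"
      if "sampled s Z s''" "Z \<subseteq> {..<Suc k}" "ints s'' ''v'' 0 = int k" for Z s''
    proof -
      have "sampled s Z (iupd ''v'' 0 (int (Suc k)) s'')" using that by simp
      then show ?thesis using that rset unfolding F_def by auto
    qed
    have g: "expf (Seq set_weight include_vertex) (iupd ''r'' 0 (int j) s') (\<lambda>_. F)
        = ennreal (if real j < y then 1 - L (Suc k) (insert k X) else 1 - L (Suc k) X)" for j
    proof -
      have 1: "sampled s X (iupd ''r'' 0 (int j) s')" using X by simp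
      have 2: "reals s' x = reals s x" if "x \<notin> {''v'', ''r'', ''u'', ''R''}" for x
        using X(2) that by (rule sampled_reals)
      let ?s = "rupd ''u'' 0 (sample_weight s k) (iupd ''r'' 0 (int j) s')"
      have S: "sampled s X ?s" "sampled s (insert k X) (iupd ''R'' (int k) 1 ?s)"
        using 1 by simp_all
      have wk: "reals s' ''w'' (int k) = w k" "reals s ''w'' (int k) = w k"
        using inp s k by (simp_all add: inp_simps)
      have "expf set_weight
           (iupd ''r'' 0 (int j) s') (\<lambda>_. h) = h ?s" for h
        using v by (cases "reals s ''thr'' 0 < w k") (simp_all add: wk 2 sample_weight_def)
      moreover have "expf include_vertex ?s (\<lambda>_. F) =
         (if real j < y then F (iupd ''R'' (int k) 1 ?s) else F ?s)"
        using v by (simp add: 2 y_def)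
      ultimately show ?thesis
        using F[OF S(1) XS(1)] F[OF S(2) XS(2)] v by simp
    qed
    have f_eq: "?f = (\<lambda>_. F)" unfolding F_def by simp
    have "expf sample_vertex s' (\<lambda>_. F) = (\<Sum>j<K. ennreal (if real j < y then 1 - L (Suc k) (insert k X) else 1 - L (Suc k) X)) / of_nat K"
      unfolding sample_vertex_def expf_Seq[of "Rand _ _ _"]
      by (subst expf_Rand[OF K]) (use inp g in \<open>simp_all add: inp_simps K_def del: expf_Seq\<close>)
    also have "\<dots> = ennreal (1 - (q k * L (Suc k) (insert k X) + (1 - q k) * L (Suc k) X))"
    proof -
      have h: "hits K y \<le> K" by (rule hits_le)
      have nn: "0 \<le> 1 - L k X" for k X
        unfolding L_def using isolate_prob_le_1[OF q01] by simp
      define a b where "a = 1 - L (Suc k) (insert k X)" and "b = 1 - L (Suc k) X"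
      have ab: "0 \<le> a" "0 \<le> b" using nn by (simp_all add: a_def b_def)
      have "(\<Sum>j<K. ennreal (if real j < y then a else b)) = ennreal (\<Sum>j<K. if real j < y then a else b)"
        using ab by (subst sum_ennreal) auto
      also have "\<dots> / of_nat K = ennreal ((real (hits K y) * a + real (K - hits K y) * b) / real K)"
        unfolding sum_hits ennreal_of_nat_eq_real_of_nat using ab K by (subst divide_ennreal) auto
      finally have "(\<Sum>j<K. ennreal (if real j < y then 1 - L (Suc k) (insert k X) else 1 - L (Suc k) X)) / of_nat K
        = ennreal ((real (hits K y) * (1 - L (Suc k) (insert k X)) + real (K - hits K y) * (1 - L (Suc k) X)) / real K)"
        unfolding a_def b_def .
      also have "(real (hits K y) * (1 - L (Suc k) (insert k X)) + real (K - hits K y) * (1 - L (Suc k) X)) / real K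
        = 1 - (q k * L (Suc k) (insert k X) + (1 - q k) * L (Suc k) X)"
      proof -
        have "q k = real (hits K y) / real K" by (simp only: q K_def y_def)
        then have "real (hits K y) = real K * q k" using K by simp
        then show ?thesis using K h by (simp add: of_nat_diff field_simps)
      qed
      finally show ?thesis .
    qed
    also have "\<dots> \<le> ennreal (1 - L k X)"
    proof -
      have "k \<in> S \<union> C \<union> D" "S \<inter> C = {}" "S \<inter> D = {}" "C \<inter> D = {}"
        using sep k unfolding separation_def by auto
      then have "L k X \<le> q k * L (Suc k) (insert k X) + (1 - q k) * L (Suc k) X"
        unfolding L_def using q01 k X(1) by (intro isolate_prob_step) auto
      then show ?thesis by (intro ennreal_leI) simp
    qed
    finally show "expf sample_vertex s' ?f \<le> ennreal (1 - L k (rset s'))"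
      using rset[OF X(2)] by (simp only: f_eq)
  next
    fix t s' assume "\<exists>X\<subseteq>{..<n}. sampled s X s'"
    then obtain X where X: "X \<subseteq> {..<n}" "sampled s X s'" by blast
    then show "f t s' \<le> ennreal (1 - L n (rset s'))"
      using f rset[OF X(2)] by (auto simp: L_def isolate_prob_end)
  qed (rule f)
  moreover have "rset (iupd ''v'' 0 0 s) = {}" using s by (simp add: rset_def)
  ultimately show ?thesis by (simp add: L_def)
qed


definition improves :: "store \<Rightarrow> store \<Rightarrow> bool" where
  "improves s s' \<longleftrightarrow> best s' \<le> best s \<and>
    (best s' = best s \<and> ints s' ''A'' = ints s ''A'' \<or>
      vertex_cut V E (aset s') \<and> best s' = sum w (aset s'))"

lemma AS_prune_solve:
  assumes s: "inp s" "ints s ''R'' = ind X" "X \<subseteq> V" "ints s ''cnt'' 0 = 0"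
    "reals s ''R'' = (\<lambda>_. 0)" "reals s ''wt'' 0 = 0"
  shows "AS (Seq prune_count (solve_sample Q)) s (\<lambda>t s'. real t \<le> T (card E) n + 20 * real size_in + 20 \<and>
    improves s s' \<and>
    (2 \<le> card (prune es X) \<longrightarrow> (\<forall>D. isolating_cut V E (prune es X) D \<longrightarrow> best s' \<le> sum w D)))"
proof (rule AS_SeqI, rule AS_mono[OF AS_prune_count[OF s(1-4)]], elim conjE)
  fix t s'
  assume t: "t \<le> 10 * size_in + 10" and ag: "agree (-{''e'', ''R'', ''v'', ''cnt''}) s' s"
    and r: "reals s' = reals s" "ints s' ''R'' = ind (prune es X)"
      "ints s' ''cnt'' 0 = int (card (prune es X))"
  have inp: "inp s'" using s(1) ag by (auto simp: inp_def agree_def)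
  have A: "ints s' ''A'' = ints s ''A''" using ag by (simp add: agree_def)
  show "AS (solve_sample Q) s' (\<lambda>t' s'. real (t + t') \<le> T (card E) n + 20 * real size_in + 20 \<and>
    improves s s' \<and>
    (2 \<le> card (prune es X) \<longrightarrow> (\<forall>D. isolating_cut V E (prune es X) D \<longrightarrow> best s' \<le> sum w D)))"
    by (rule AS_mono[OF AS_solve_sample[OF inp r(2) _ _ prune_independent_set[OF s(3)] r(3)]])
      (use t r A s in \<open>auto simp: improves_def\<close>)
qed

lemma AS_round:
  assumes s: "inp s" "ints s ''l'' 0 = int l"
  shows "AS (cut_round Q) s (\<lambda>t s'. real t \<le> T (card E) n + 30 * real size_in + 6 * real l + 40 \<and>
    agree (-{''best'', ''A''}) s' s \<and> improves s s')"
proof -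
  define s0 where "s0 = transfer_arrays round_in s zero_store"
  have s0: "inp s0" "ints s0 ''l'' 0 = int l" "ints s0 ''cnt'' 0 = 0" "ints s0 ''R'' = (\<lambda>_. 0)"
    "reals s0 ''R'' = (\<lambda>_. 0)" "reals s0 ''wt'' 0 = 0" "ints s0 ''A'' = ints s ''A''"
    "best s0 = best s"
    using s by (simp_all add: s0_def round_in_def fun_eq_iff)
  have "AS (round_body Q) s0 (\<lambda>t s'. real t \<le> T (card E) n + 30 * real size_in + 6 * real l + 39 \<and> improves s0 s')"
    unfolding round_body_def draw_scale_def AS_Seq[of _ "Seq _ _"] AS_Seq[of "Rand _ _ _"] AS_Rand
  proof (intro ballI)
    fix i assume "i \<in> {0..<max 1 (ieval (IAdd (IAdd (iv ''l'') (iv ''l'')) (N 1)) s0)}"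
    then obtain j where j: "i = int j" "j \<le> 2 * l"
      using s0 by (auto dest!: zero_le_imp_eq_int)
    let ?s = "iupd ''j'' (ieval (N 0) s0) i s0"
    have 1: "inp ?s" "ints ?s ''j'' 0 = int j" using s0 j by simp_all
    show "AS draw_scale_rest ?s (\<lambda>t s'.
      AS (for_loop ''v'' (iv ''n'') sample_vertex) s' (\<lambda>t' s'.
      AS (Seq prune_count (solve_sample Q)) s' (\<lambda>t'' s'.
         real (1 + t + (t' + t'')) \<le> T (card E) n + 30 * real size_in + 6 * real l + 39 \<and> improves s0 s')))"
    proof (rule AS_mono[OF AS_draw_scale_rest[OF 1]], elim conjE)
      fix t s1
      assume t: "t \<le> 2 + 3 * j" and a1: "agree (-{''j'', ''lam''}) s1 ?s"
      have s1: "inp s1" "ints s1 ''R'' = (\<lambda>_. 0)"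
        using a1 s0 by (auto simp: inp_def agree_def)
      show "AS (for_loop ''v'' (iv ''n'') sample_vertex) s1 (\<lambda>t' s'.
        AS (Seq prune_count (solve_sample Q)) s' (\<lambda>t'' s'.
         real (1 + t + (t' + t'')) \<le> T (card E) n + 30 * real size_in + 6 * real l + 39 \<and> improves s0 s'))"
      proof (rule AS_mono[OF AS_sample[OF s1]], elim conjE exE)
        fix t' s2 X
        assume t': "t' \<le> 10 * n + 2" and X: "X \<subseteq> V" "sampled s1 X s2"
        have s2: "inp s2" "ints s2 ''R'' = ind X" "ints s2 ''cnt'' 0 = 0" "reals s2 ''R'' = (\<lambda>_. 0)"
          "reals s2 ''wt'' 0 = 0" "ints s2 ''A'' = ints s0 ''A''" "best s2 = best s0"
          using sampled_inp[OF X(2) s1(1)] X(2) a1 s0 by (simp_all add: sampled_def agree_def)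
        show "AS (Seq prune_count (solve_sample Q)) s2 (\<lambda>t'' s'.
         real (1 + t + (t' + t'')) \<le> T (card E) n + 30 * real size_in + 6 * real l + 39 \<and> improves s0 s')"
          by (rule AS_mono[OF AS_prune_solve[OF s2(1,2) X(1) s2(3-5)]])
            (use t t' j s2 in \<open>auto simp: improves_def\<close>)
      qed
    qed
  qed
  then have "AS (round_body Q) s0 (\<lambda>t s'. real (1 + t) \<le> T (card E) n + 30 * real size_in + 6 * real l + 40 \<and>
    agree (-{''best'', ''A''}) (transfer_arrays [''best'', ''A''] s' s) s \<and>
    improves s (transfer_arrays [''best'', ''A''] s' s))"
    by (rule AS_mono) (use s0 in \<open>auto simp: improves_def aset_def agree_def\<close>)
  then show ?thesis unfolding cut_round_def AS_Call s0_def[symmetric] .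
qed

lemma isolate_prob_ge:
  fixes u :: "nat \<Rightarrow> real"
  assumes sep: "separation V E S C D" and u: "\<And>v. v < n \<Longrightarrow> 0 \<le> u v"
    and q: "\<And>v. q v = real (hits (4 * n) (lam * u v)) / real (4 * n)"
    and lam: "0 < lam" "1 / 8 \<le> lam / real (4 * n) * sum u (S \<union> C)"
      "lam / real (4 * n) * sum u (S \<union> C) \<le> 1 / 4"
  shows "1 / 256 * (sum u S / sum u (S \<union> C)) * min 1 (sum u D / sum u (S \<union> C))
    \<le> isolate_prob q S C D n 0 {}"
proof -
  define \<mu> where "\<mu> = lam / real (4 * n)"
  define U where "U = sum u (S \<union> C)"
  have n: "0 < n" using n_ge_2 by simp
  have sets: "S \<union> C \<subseteq> V" "D \<subseteq> V" "S \<inter> C = {}" using sep by (auto simp: separation_def)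
  have fin: "finite (S \<union> C)" "finite D" "finite S" using sets by (auto intro: finite_subset[of _ V])
  have mu: "0 < \<mu>" "1 / 8 \<le> \<mu> * U" "\<mu> * U \<le> 1 / 4"
    using lam n by (simp_all add: \<mu>_def U_def)
  have U: "0 < U" using mu by (smt (verit) mult_nonneg_nonpos divide_pos_pos)
  have q01: "0 \<le> q v" "q v \<le> 1" for v
  proof -
    have "real (hits (4 * n) (lam * u v)) \<le> real (4 * n)" using hits_le by (rule of_nat_mono)
    then show "0 \<le> q v" "q v \<le> 1" using n by (simp_all add: q divide_le_eq_1)
  qed
  have q_low: "min 1 (\<mu> * u v) \<le> q v" for v
  proof -
    have "min (real (4 * n)) (lam * u v) / real (4 * n) \<le> q v"
      unfolding q using hits_lower[of "4 * n"] by (intro divide_right_mono) simp_all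
    then show ?thesis using n by (simp add: \<mu>_def min_def divide_simps split: if_splits)
  qed
  have q_up: "q v \<le> \<mu> * u v + 1 / real (4 * n)" if "v < n" for v
  proof -
    have "q v \<le> (lam * u v + 1) / real (4 * n)"
      unfolding q using hits_upper[of "lam * u v"] lam(1) u[of v] that by (intro divide_right_mono) auto
    then show ?thesis by (simp add: \<mu>_def add_divide_distrib)
  qed
  have "sum q (S \<union> C) \<le> (\<Sum>v\<in>S \<union> C. \<mu> * u v + 1 / real (4 * n))"
    using sets by (intro sum_mono q_up) auto
  also have "\<dots> = \<mu> * U + real (card (S \<union> C)) / real (4 * n)"
    by (simp add: sum.distrib U_def sum_distrib_left)
  also have "real (card (S \<union> C)) / real (4 * n) \<le> 1 / 4"
    using card_mono[OF _ sets(1)] n by (simp add: divide_le_eq)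
  finally have "sum q (S \<union> C) \<le> 1 / 2" using mu by simp
  then have prod: "1 / 2 \<le> (\<Prod>v\<in>S \<union> C. 1 - q v)"
    using prod_ge_1_minus_sum[OF fin(1), of q] q01 by simp
  have le1: "\<mu> * u v \<le> 1 / 4" if "v \<in> S \<union> C" for v
  proof -
    have "u v \<le> U" unfolding U_def using that fin u sets by (intro member_le_sum) auto
    then have "\<mu> * u v \<le> \<mu> * U" using mu by (intro mult_left_mono) auto
    then show ?thesis using mu by linarith
  qed
  have "\<mu> * sum u S \<le> sum q S"
    unfolding sum_distrib_left
  proof (rule sum_mono)
    fix v assume "v \<in> S"
    then show "\<mu> * u v \<le> q v" using le1[of v] q_low[of v] by simp
  qed
  moreover have "0 \<le> \<mu> * sum u S" using mu u sets by (intro mult_nonneg_nonneg sum_nonneg) auto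
  ultimately have A: "1 / 2 * (\<mu> * sum u S) \<le> (\<Prod>v\<in>S \<union> C. 1 - q v) * sum q S"
    using prod by (intro mult_mono) auto
  have "min 1 (\<mu> * sum u D) \<le> min 1 (sum q D)"
  proof (cases "\<exists>v\<in>D. 1 \<le> \<mu> * u v")
    case True
    then obtain v where v: "v \<in> D" "1 \<le> \<mu> * u v" by blast
    then have "1 \<le> q v" using q_low[of v] by simp
    also have "q v \<le> sum q D" using v fin q01 by (intro member_le_sum) auto
    finally show ?thesis by simp
  next
    case False
    have "\<mu> * sum u D \<le> sum q D"
      unfolding sum_distrib_left
    proof (rule sum_mono)
      fix v assume "v \<in> D"
      then have "\<mu> * u v < 1" using False by auto
      then show "\<mu> * u v \<le> q v" using q_low[of v] by simp
    qed
    then show ?thesis by linarith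
  qed
  then have B: "min 1 (\<mu> * sum u D) / 2 \<le> 1 - (\<Prod>v\<in>D. 1 - q v)"
    using one_minus_prod_ge[of D q, OF fin(2) q01] by linarith
  have "1 / 8 * (1 / U) \<le> \<mu>" using mu U by (simp add: divide_le_eq)
  then have C: "1 / 8 * (x / U) \<le> \<mu> * x" if "0 \<le> x" for x
    using mult_right_mono[OF _ that, of "1 / 8 * (1 / U)" \<mu>] by simp
  have uD: "0 \<le> sum u D" "0 \<le> sum u S" using u sets by (auto intro!: sum_nonneg)
  have D: "1 / 8 * min 1 (sum u D / U) \<le> min 1 (\<mu> * sum u D)"
    using C[OF uD(1)] by (auto simp: min_def)
  have "1 / 256 * (sum u S / U) * min 1 (sum u D / U)
      = (1 / 2 * (1 / 8 * (sum u S / U))) * (1 / 8 * min 1 (sum u D / U) / 2)" by simp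
  also have "\<dots> \<le> (1 / 2 * (\<mu> * sum u S)) * (min 1 (\<mu> * sum u D) / 2)"
  proof (rule mult_mono)
    show "1 / 2 * (1 / 8 * (sum u S / U)) \<le> 1 / 2 * (\<mu> * sum u S)" using C[OF uD(2)] by linarith
    show "1 / 8 * min 1 (sum u D / U) / 2 \<le> min 1 (\<mu> * sum u D) / 2"
      using D by (rule divide_right_mono) simp
    show "0 \<le> 1 / 2 * (\<mu> * sum u S)" using mu uD by simp
    show "0 \<le> 1 / 8 * min 1 (sum u D / U) / 2" using U uD by simp
  qed
  also have "\<dots> \<le> ((\<Prod>v\<in>S \<union> C. 1 - q v) * sum q S) * (1 - (\<Prod>v\<in>D. 1 - q v))"
  proof (rule mult_mono[OF A B])
    show "0 \<le> (\<Prod>v\<in>S \<union> C. 1 - q v) * sum q S" using q01 by (intro mult_nonneg_nonneg prod_nonneg sum_nonneg) auto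
    show "0 \<le> min 1 (\<mu> * sum u D) / 2" using mu uD by simp
  qed
  also have "\<dots> = isolate_prob q S C D n 0 {}"
  proof -
    have "S \<inter> {0..<n} = S" "D \<inter> {0..<n} = D" "(S \<union> C) \<inter> {0..<n} = S \<union> C"
      using sets by auto
    then show ?thesis by (simp add: isolate_prob_def once_prob_def meet_prob_def)
  qed
  finally show ?thesis unfolding U_def .
qed

lemma exists_scale:
  assumes "1 \<le> x" "x \<le> real n * real n" "n \<le> 2 ^ l"
  obtains j where "j \<le> 2 * l" "x \<le> 2 ^ j" "2 ^ j \<le> 2 * x"
proof -
  have "x \<le> 2 ^ (2 * l)"
  proof -
    have "real n \<le> 2 ^ l" using assms(3) by (metis of_nat_le_iff of_nat_numeral of_nat_power)
    then have "real n * real n \<le> 2 ^ l * 2 ^ l" by (intro mult_mono) auto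
    then show ?thesis using assms(2) by (simp add: mult_2 power_add)
  qed
  define j where "j = (LEAST j. x \<le> 2 ^ j)"
  have 1: "x \<le> 2 ^ j" unfolding j_def by (rule LeastI) (rule \<open>x \<le> 2 ^ (2 * l)\<close>)
  have 2: "j \<le> 2 * l" unfolding j_def by (rule Least_le) (rule \<open>x \<le> 2 ^ (2 * l)\<close>)
  have 3: "2 ^ j \<le> 2 * x"
  proof (cases j)
    case 0
    then show ?thesis using assms(1) by simp
  next
    case (Suc i)
    then have "\<not> x \<le> 2 ^ i" unfolding j_def by (intro not_less_Least) simp
    then show ?thesis using Suc by simp
  qed
  show thesis using that 1 2 3 by blast
qed

lemma expf_round:
  assumes s: "inp s" "ints s ''l'' 0 = int l" and l: "n \<le> 2 ^ l"
    and u: "u = sample_weight s" and cap: "0 < reals s ''cap'' 0" and base: "0 \<le> reals s ''base'' 0"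
    and sep: "separation V E S C D"
    and U: "reals s ''cap'' 0 \<le> real n * sum u (S \<union> C)" "sum u (S \<union> C) \<le> real n * reals s ''cap'' 0"
  shows "expf (cut_round Q) s (misses (sum w C))
    \<le> ennreal (1 - 1 / 256 * (sum u S / sum u (S \<union> C)) * min 1 (sum u D / sum u (S \<union> C)) / real (2 * l + 1))"
    (is "_ \<le> ennreal (1 - ?p / _)")
proof -
  define s0 where "s0 = transfer_arrays round_in s zero_store"
  have s0: "inp s0" "ints s0 ''l'' 0 = int l" "ints s0 ''cnt'' 0 = 0" "ints s0 ''R'' = (\<lambda>_. 0)"
    "reals s0 ''R'' = (\<lambda>_. 0)" "reals s0 ''wt'' 0 = 0" "reals s0 ''cap'' 0 = reals s ''cap'' 0"
    "reals s0 ''thr'' 0 = reals s ''thr'' 0" "reals s0 ''base'' 0 = reals s ''base'' 0"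
    using s by (simp_all add: s0_def round_in_def fun_eq_iff)
  define c where "c = reals s ''cap'' 0"
  define f :: "nat \<Rightarrow> store \<Rightarrow> ennreal" where
    "f = (misses (sum w C))"
  have f1: "f t s' \<le> 1" for t s' by (simp add: f_def)
  have n: "0 < n" using n_ge_2 by simp
  let ?U = "sum u (S \<union> C)"
  have U0: "0 < ?U" using U(1) cap n by (smt (verit) mult_nonneg_nonpos of_nat_0_le_iff)
  have "1 \<le> real n * ?U / c" "real n * ?U / c \<le> real n * real n"
    using U cap n by (simp_all add: c_def divide_le_eq mult_left_mono mult.assoc)
  then obtain j0 where j0: "j0 \<le> 2 * l" "real n * ?U / c \<le> 2 ^ j0" "2 ^ j0 \<le> 2 * (real n * ?U / c)"
    using l by (rule exists_scale)
  have u0: "0 \<le> u v" if "v < n" for v using cap base w_pos[OF that] by (simp add: u sample_weight_def)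
  let ?tail = "\<lambda>s'. expf (for_loop ''v'' (iv ''n'') sample_vertex) s' (\<lambda>_ s'.
        expf (Seq prune_count (solve_sample Q)) s' f)"
  have ft: "(\<lambda>t. f (t0 + t)) = f" for t0 by (simp add: f_def)
  have tail: "?tail s1 \<le> ennreal (1 - ?p)"
    if s1: "agree (-{''j'', ''lam''}) s1 s0" "reals s1 ''lam'' 0 = real n * real n / c / 2 ^ j0" for s1
  proof -
    have i1: "inp s1" "ints s1 ''R'' = (\<lambda>_. 0)"
      using s1 s0 by (auto simp: inp_def agree_def)
    have u1: "sample_weight s1 = u"
      using s1(1) s0 by (simp add: u sample_weight_def agree_def fun_eq_iff)
    define q where "q = (\<lambda>v. real (hits (4 * n) (reals s1 ''lam'' 0 * u v)) / real (4 * n))"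
    have "?tail s1 \<le> ennreal (1 - isolate_prob q S C D n 0 {})"
    proof (rule expf_sample[OF i1 _ sep])
      fix v show "q v = real (hits (4 * n) (reals s1 ''lam'' 0 * sample_weight s1 v)) / real (4 * n)"
        by (simp add: q_def u1)
    next
      fix s' show "expf (Seq prune_count (solve_sample Q)) s' f \<le> 1"
        by (intro expf_le_1 f1)
    next
      fix s2 X
      assume X: "X \<subseteq> V" "sampled s1 X s2" "X \<inter> C = {}" "card (X \<inter> S) = 1" "X \<inter> D \<noteq> {}"
      have s2: "inp s2" "ints s2 ''R'' = ind X" "ints s2 ''cnt'' 0 = 0" "reals s2 ''R'' = (\<lambda>_. 0)"
          "reals s2 ''wt'' 0 = 0"
        using sampled_inp[OF X(2) i1(1)] X(2) s1(1) s0 by (simp_all add: sampled_def agree_def)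
      have ed: "{a, b} \<in> E \<and> a \<noteq> b" if "(a, b) \<in> set es" for a b
        using es_edge[OF that] es_edgeD(3)[OF that] by simp
      obtain r where r: "X \<inter> S = {r}" using X(4) by (auto simp: card_1_singleton_iff)
      have Y: "prune es X \<subseteq> X" by (rule prune_subset)
      have "prune es X \<inter> S \<noteq> {}"
        by (rule prune_separation[OF sep X(3,1)]) (use r ed in auto)
      moreover have "prune es X \<inter> S \<subseteq> {r}" using r Y by blast
      ultimately have YS: "prune es X \<inter> S = {r}" by (simp add: subset_singleton_iff)
      have "prune es X \<inter> D \<noteq> {}"
        by (rule prune_separation[OF separation_sym[OF sep] X(3,1)]) (use X(5) ed in auto)
      then obtain d where d: "d \<in> prune es X" "d \<in> D" by blast
      have "r \<noteq> d" using YS d sep unfolding separation_def by blast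
      then have "card {r, d} = 2" by simp
      moreover have "finite (prune es X)" using Y X(1) by (meson finite_lessThan finite_subset)
      ultimately have "2 \<le> card (prune es X)"
        using YS d card_mono[of "prune es X" "{r, d}"] by auto
      moreover have "isolating_cut V E (prune es X) C"
        by (rule separation_isolating_cut[OF graph sep _ _ YS]) (use Y X in auto)
      ultimately have "AS (Seq prune_count (solve_sample Q)) s2 (\<lambda>t s'. best s' \<le> sum w C)"
        by (intro AS_mono[OF AS_prune_solve[OF s2(1,2) X(1) s2(3-5)]]) auto
      then have "expf (Seq prune_count (solve_sample Q)) s2 f \<le> 0"
        by (rule expf_AS_le) (simp add: f_def)
      then show "expf (Seq prune_count (solve_sample Q)) s2 f = 0" by simp
    qed
    also have "\<dots> \<le> ennreal (1 - ?p)"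
    proof -
      have mu: "reals s1 ''lam'' 0 / real (4 * n) * ?U = (real n * ?U / c) / (4 * 2 ^ j0)"
        using n by (simp add: s1(2) field_simps)
      have "?p \<le> isolate_prob q S C D n 0 {}"
      proof (rule isolate_prob_ge[OF sep u0])
        show "0 < reals s1 ''lam'' 0" using n cap by (simp add: s1(2) c_def)
        show "1 / 8 \<le> reals s1 ''lam'' 0 / real (4 * n) * ?U"
          unfolding mu using j0(3) by (subst le_divide_eq) (simp add: mult_ac)
        show "reals s1 ''lam'' 0 / real (4 * n) * ?U \<le> 1 / 4"
          unfolding mu using j0(2) by (subst divide_le_eq) simp
      qed (simp_all add: q_def)
      then show ?thesis by (intro ennreal_leI) simp
    qed
    finally show ?thesis .
  qed
  define h where "h = (\<lambda>j. if j = j0 then 1 - ?p else (1::real))"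
  have sets: "S \<union> C \<subseteq> V" "D \<subseteq> V" using sep by (auto simp: separation_def)
  have "sum u S \<le> ?U"
    using sets u0 by (intro sum_mono2) (auto intro: finite_subset[of _ V])
  moreover have nn: "0 \<le> sum u S" "0 \<le> sum u D" using sets u0 by (auto intro!: sum_nonneg)
  ultimately have rat: "0 \<le> sum u S / ?U" "sum u S / ?U \<le> 1" "0 \<le> sum u D / ?U"
    using U0 by (simp_all add: divide_le_eq_1)
  then have "0 \<le> sum u S / ?U * min 1 (sum u D / ?U)" "sum u S / ?U * min 1 (sum u D / ?U) \<le> 1"
    by (intro mult_nonneg_nonneg mult_le_one; simp)+
  then have p: "0 \<le> ?p" "?p \<le> 1" by linarith+
  have drawn: "expf draw_scale_rest (iupd ''j'' 0 (int j) s0) (\<lambda>_ s'. ?tail s') \<le> ennreal (h j)" for j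
  proof -
    have 1: "inp (iupd ''j'' 0 (int j) s0)" "ints (iupd ''j'' 0 (int j) s0) ''j'' 0 = int j" using s0 by simp_all
    show ?thesis
    proof (cases "j = j0")
      case True
      show ?thesis
      proof (rule expf_AS_le[OF AS_draw_scale_rest[OF 1]], elim conjE)
        fix t s1
        assume "agree (-{''j'', ''lam''}) s1 (iupd ''j'' 0 (int j) s0)"
          "reals s1 ''lam'' 0 = real n * real n / reals (iupd ''j'' 0 (int j) s0) ''cap'' 0 / 2 ^ j"
        moreover have "agree (-{''j'', ''lam''}) (iupd ''j'' 0 (int j) s0) s0" by simp
        ultimately show "?tail s1 \<le> ennreal (h j)"
          using tail[of s1] True s0 unfolding h_def c_def by (simp del: expf_Seq add: agree_trans[of _ s1])
      qed
    next
      case False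
      have "expf draw_scale_rest (iupd ''j'' 0 (int j) s0) (\<lambda>_ s'. ?tail s') \<le> 1"
        by (intro expf_le_1 f1)
      then show ?thesis using False by (simp add: h_def)
    qed
  qed
  have "expf (cut_round Q) s f = expf (round_body Q) s0 f"
    by (simp add: cut_round_def s0_def[symmetric] f_def)
  also have "\<dots> = expf draw_scale s0 (\<lambda>_ s'. ?tail s')"
    by (simp only: round_body_def expf_Seq[of _ "Seq _ _"] ft)
  also have "\<dots> = (\<Sum>j<2 * l + 1. expf draw_scale_rest (iupd ''j'' 0 (int j) s0) (\<lambda>_ s'. ?tail s')) / of_nat (2 * l + 1)"
    unfolding draw_scale_def expf_Seq[of "Rand _ _ _"]
    by (subst expf_Rand[of "2 * l + 1"]) (use s0 in simp_all)
  also have "\<dots> \<le> (\<Sum>j<2 * l + 1. ennreal (h j)) / of_nat (2 * l + 1)"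
    using drawn by (intro divide_right_mono_ennreal sum_mono)
  also have "\<dots> = ennreal (1 - ?p / real (2 * l + 1))"
  proof -
    have "(\<Sum>j<2 * l + 1. h j) = (\<Sum>j<2 * l + 1. 1 - (if j = j0 then ?p else 0))"
      unfolding h_def by (intro sum.cong) auto
    also have "\<dots> = real (2 * l + 1) - ?p" using j0 by (simp add: sum_subtractf)
    finally have "(\<Sum>j<2 * l + 1. h j) = real (2 * l + 1) - ?p" .
    moreover have "0 \<le> h j" for j using p by (simp add: h_def)
    ultimately have "(\<Sum>j<2 * l + 1. ennreal (h j)) = ennreal (real (2 * l + 1) - ?p)"
      by (subst sum_ennreal) auto
    then have "(\<Sum>j<2 * l + 1. ennreal (h j)) / of_nat (2 * l + 1) = ennreal ((real (2 * l + 1) - ?p) / real (2 * l + 1))"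
      using p by (simp only: ennreal_of_nat_eq_real_of_nat) (subst divide_ennreal, auto)
    then show ?thesis by (simp only: diff_divide_distrib) simp
  qed
  finally show ?thesis unfolding f_def .
qed

end

section \<open>Repeated rounds\<close>

definition repeat_while :: "bexp \<Rightarrow> com \<Rightarrow> com" where
  "repeat_while b c = Seq (ISet ''i'' (N 0) (N 0))
     (While b (Seq c (ISet ''i'' (N 0) (IAdd (iv ''i'') (N 1)))))"

lemma fails_mono: "(Q' \<Longrightarrow> Q) \<Longrightarrow> (if Q then 0 else 1) \<le> (if Q' then 0 else (1::ennreal))"
  by simp

lemma expf_repeat_while:
  fixes e \<beta> tb :: real
  assumes guard: "\<And>k s. I s \<Longrightarrow> ints s ''i'' 0 = int k \<Longrightarrow> k < K \<Longrightarrow> beval b s"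
    and exit: "\<And>k s. I s \<Longrightarrow> ints s ''i'' 0 = int k \<Longrightarrow> best s \<le> \<beta> \<Longrightarrow> K' \<le> k \<Longrightarrow> \<not> beval b s"
    and KK': "K \<le> K'" and tb: "0 \<le> tb" and e: "0 \<le> e" "e \<le> 1"
    and body: "\<And>s. I s \<Longrightarrow> AS c s (\<lambda>t s'. real t \<le> tb \<and> ints s' ''i'' = ints s ''i'' \<and> I s' \<and>
      best s' \<le> best s)"
    and prob: "\<And>s. I s \<Longrightarrow> expf c s (misses \<beta>) \<le> ennreal e"
    and I_upd: "\<And>k s. I s \<Longrightarrow> I (iupd ''i'' 0 k s)" and s: "I s"
  shows "expf (repeat_while b c) s
    (fails (\<lambda>t s'. real t \<le> 2 + real K' * (tb + 2) \<and> I s' \<and> best s' \<le> \<beta>)) \<le> ennreal (e ^ K)"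
proof -
  let ?W = "While b (Seq c (ISet ''i'' (N 0) (IAdd (iv ''i'') (N 1))))"
  have done_case: "AS ?W s (\<lambda>t s'. real t \<le> 1 + real (K' - k) * (tb + 2) \<and> I s' \<and> best s' \<le> \<beta>)"
    if "I s" "ints s ''i'' 0 = int k" "k \<le> K'" "best s \<le> \<beta>" for s k
    using that
  proof (induction "K' - k" arbitrary: s k)
    case 0
    then have "\<not> beval b s" using exit by simp
    then show ?case using 0 tb by (subst AS_While) simp
  next
    case (Suc r)
    show ?case
    proof (cases "beval b s")
      case False
      then show ?thesis using Suc.prems tb by (subst AS_While) simp
    next
      case True
      have "AS c s (\<lambda>t s'. AS ?W (iupd ''i'' 0 (ints s' ''i'' 0 + 1) s') (\<lambda>t' s'.
          real (1 + (t + 1 + t')) \<le> 1 + real (K' - k) * (tb + 2) \<and> I s' \<and> best s' \<le> \<beta>))"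
      proof (rule AS_mono[OF body[OF Suc.prems(1)]], elim conjE)
        fix t s'
        assume t: "real t \<le> tb" and s': "ints s' ''i'' = ints s ''i''" "I s'"
          "best s' \<le> best s"
        have k: "k < K'" using Suc.hyps(2) by simp
        have "AS ?W (iupd ''i'' 0 (ints s' ''i'' 0 + 1) s')
          (\<lambda>t s'. real t \<le> 1 + real (K' - Suc k) * (tb + 2) \<and> I s' \<and> best s' \<le> \<beta>)"
          using Suc.hyps(2) Suc.prems s' k by (intro Suc.hyps(1) I_upd) auto
        then show "AS ?W (iupd ''i'' 0 (ints s' ''i'' 0 + 1) s') (\<lambda>t' s'.
          real (1 + (t + 1 + t')) \<le> 1 + real (K' - k) * (tb + 2) \<and> I s' \<and> best s' \<le> \<beta>)"
        proof (rule AS_mono)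
          fix t' s''
          assume "real t' \<le> 1 + real (K' - Suc k) * (tb + 2) \<and> I s'' \<and> best s'' \<le> \<beta>"
          moreover have "real (K' - k) = real (K' - Suc k) + 1" using k by simp
          ultimately show "real (1 + (t + 1 + t')) \<le> 1 + real (K' - k) * (tb + 2) \<and> I s'' \<and> best s'' \<le> \<beta>"
            using t by (simp only: distrib_right) simp
        qed
      qed
      then show ?thesis using True by (subst AS_While) (simp add: add_ac)
    qed
  qed
  let ?bad = "\<lambda>j t0 t s'. fails (\<lambda>t s'. real t \<le> t0 + real (K' - j) * (tb + 2) \<and> I s' \<and> best s' \<le> \<beta>) t s'"
  have main: "expf ?W s (\<lambda>t. ?bad k 1 t) \<le> ennreal (e ^ (K - k))"
    if "I s" "ints s ''i'' 0 = int k" "k \<le> K" for s k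
    using that
  proof (induction "K - k" arbitrary: s k)
    case 0
    then show ?case by (simp, intro expf_le_1) simp
  next
    case (Suc r)
    then have k: "k < K" "k < K'" using KK' by auto
    have r: "K - k = Suc (K - Suc k)" using k by simp
    have "expf ?W s (\<lambda>t. ?bad k 1 t) = expf c s (\<lambda>t s'. expf ?W (iupd ''i'' 0 (ints s' ''i'' 0 + 1) s')
        (\<lambda>t'. ?bad k 1 (1 + (t + 1) + t')))"
      using guard[OF Suc.prems(1,2) k(1)] by (subst expf_While) (simp add: add_ac)
    also have "\<dots> \<le> expf c s (\<lambda>t s'. ennreal (e ^ (K - Suc k)) * (if best s' \<le> \<beta> then 0 else 1))"
    proof (rule expf_mono_AS[OF body[OF Suc.prems(1)]], elim conjE)
      fix t s'
      assume t: "real t \<le> tb" and s': "ints s' ''i'' = ints s ''i''" "I s'"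
        "best s' \<le> best s"
      let ?s = "iupd ''i'' 0 (ints s' ''i'' 0 + 1) s'"
      have i: "I ?s" "ints ?s ''i'' 0 = int (Suc k)" using s' Suc.prems I_upd by simp_all
      have K'1: "real (K' - k) = real (K' - Suc k) + 1" using k by simp
      have bad: "?bad k 1 (1 + (t + 1) + t') s'' \<le> ?bad (Suc k) 1 t' s''" for t' s''
      proof (rule fails_mono, elim conjE, intro conjI)
        assume "real t' \<le> 1 + real (K' - Suc k) * (tb + 2)"
        then show "real (1 + (t + 1) + t') \<le> 1 + real (K' - k) * (tb + 2)"
          unfolding K'1 distrib_right using t by simp
      qed
      show "expf ?W ?s (\<lambda>t'. ?bad k 1 (1 + (t + 1) + t'))
          \<le> ennreal (e ^ (K - Suc k)) * (if best s' \<le> \<beta> then 0 else 1)"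
      proof (cases "best s' \<le> \<beta>")
        case True
        have "expf ?W ?s (\<lambda>t'. ?bad k 1 (1 + (t + 1) + t')) \<le> 0"
        proof (rule expf_AS_le[OF done_case[OF i]])
          fix t' s''
          assume "real t' \<le> 1 + real (K' - Suc k) * (tb + 2) \<and> I s'' \<and> best s'' \<le> \<beta>"
          then show "?bad k 1 (1 + (t + 1) + t') s'' \<le> 0" using bad[of t' s''] by simp
        qed (use True k in auto)
        then show ?thesis by simp
      next
        case False
        have "expf ?W ?s (\<lambda>t'. ?bad k 1 (1 + (t + 1) + t')) \<le> expf ?W ?s (\<lambda>t'. ?bad (Suc k) 1 t')"
          by (rule expf_mono) (rule bad)
        also have "\<dots> \<le> ennreal (e ^ (K - Suc k))"
          using Suc.hyps k by (intro Suc.hyps(1) i) auto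
        finally show ?thesis using False by simp
      qed
    qed
    also have "\<dots> \<le> ennreal (e ^ (K - Suc k)) * expf c s (misses \<beta>)"
      using e by (intro expf_cmult_le AS_mono[OF body[OF Suc.prems(1)]]) (auto simp: power_le_one)
    also have "\<dots> \<le> ennreal (e ^ (K - Suc k)) * ennreal e"
      using prob[OF Suc.prems(1)] by (rule mult_left_mono) simp
    also have "\<dots> = ennreal (e ^ (K - k))"
      using e by (simp add: r ennreal_mult'[symmetric] mult.commute)
    finally show ?case .
  qed
  have "expf (repeat_while b c) s (fails (\<lambda>t s'. real t \<le> 2 + real K' * (tb + 2) \<and> I s' \<and> best s' \<le> \<beta>))
      = expf ?W (iupd ''i'' 0 0 s) (\<lambda>t. ?bad 0 1 t)"
    unfolding repeat_while_def by simp
  also have "\<dots> \<le> ennreal (e ^ K)"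
    using main[of "iupd ''i'' 0 0 s" 0] s I_upd by simp
  finally show ?thesis .
qed

lemma power_le_exp:
  fixes p h x :: real
  assumes "0 \<le> p" "p \<le> 1" "h \<le> real K" "x \<le> p * h"
  shows "(1 - p) ^ K \<le> exp (- x)"
proof -
  have "(1 - p) ^ K \<le> exp (- p) ^ K"
    using assms exp_ge_add_one_self[of "- p"] by (intro power_mono) auto
  also have "\<dots> = exp (- (p * real K))" by (simp add: exp_of_nat_mult[symmetric] mult.commute)
  also have "\<dots> \<le> exp (- x)"
    using mult_left_mono[OF assms(3,1)] assms(4) by simp
  finally show ?thesis .
qed

definition lim1 :: "nat \<Rightarrow> rexp" where
  "lim1 a = RMul (OfInt (N (int a))) (RMul (OfInt (iv ''l'')) (OfInt (IAdd (IAdd (iv ''l'') (iv ''l'')) (N 1))))"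

definition find_level :: "nat \<Rightarrow> com \<Rightarrow> com" where
  "find_level a Q = repeat_while (RLess (OfInt (iv ''i'')) (lim1 a)) (cut_round Q)"

abbreviation refine_guard :: "nat \<Rightarrow> bexp" where
  "refine_guard a \<equiv> And (RLess (OfInt (iv ''i'')) (RMul (lim1 a) (RMul (rv ''ie'') (rv ''ie''))))
       (RLess (OfInt (iv ''i'')) (RMul (lim1 a)
         (RMul (rv ''ie'') (RDiv (rv ''W'') (RSub (rv ''W'') (rv ''best''))))))"

abbreviation refine_step :: "com \<Rightarrow> com" where
  "refine_step Q \<equiv> Seq (Seq (RSet ''thr'' (N 0) (rv ''best'')) (RSet ''cap'' (N 0) (rv ''best''))) (cut_round Q)"

definition refine :: "nat \<Rightarrow> com \<Rightarrow> com" where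
  "refine a Q = repeat_while (refine_guard a) (refine_step Q)"

context oracle_graph
begin

definition good :: "store \<Rightarrow> bool" where
  "good s \<longleftrightarrow> vertex_cut V E (aset s) \<and> best s = sum w (aset s) \<and>
    (\<forall>v<n. insert v (nbs E v) \<noteq> V \<longrightarrow> best s \<le> sum w (nbs E v))"

lemma good_improves: "good s \<Longrightarrow> improves s s' \<Longrightarrow> good s'"
  unfolding good_def improves_def aset_def by (auto intro: order_trans)

lemma good_upd:
  "x \<notin> {''best'', ''A''} \<Longrightarrow> good (iupd x i k s) = good s"
  "x \<notin> {''best'', ''A''} \<Longrightarrow> good (rupd x i r s) = good s"
  by (auto simp: good_def aset_def)

lemma good_kappa: "good s \<Longrightarrow> kappa \<le> best s" "good s \<Longrightarrow> best s < W"
  using kappa_le cut_less_W by (auto simp: good_def)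

definition round_time :: "nat \<Rightarrow> real" where
  "round_time l = T (card E) n + 30 * real size_in + 6 * real l + 50"

lemma round_time_nonneg: "0 \<le> round_time l"
  using T_nonneg by (simp add: round_time_def)

lemma inp_agree: "agree X s' s \<Longrightarrow> {''n'', ''m'', ''src'', ''dst'', ''w''} \<subseteq> X \<Longrightarrow> inp s \<Longrightarrow> inp s'"
  by (auto simp: inp_def agree_def)

lemma sum_split_C: "separation V E S C D \<Longrightarrow> sum (u :: nat \<Rightarrow> real) (S \<union> C) = sum u S + sum u C"
  by (intro sum.union_disjoint) (auto simp: separation_def intro: finite_subset[of _ V])

text \<open>The vertices heavier than \<open>M\<close> are split by a light cut into two parts, unless all of them lie
  on one side, in which case some vertex on the other side has a light neighbourhood.\<close>

lemma light_cut_cases: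
  assumes M: "0 \<le> M" and C: "vertex_cut V E C" "\<forall>v\<in>C. w v \<le> M"
    and no_nbs: "\<And>v. v < n \<Longrightarrow> insert v (nbs E v) \<noteq> V \<Longrightarrow> real n * M < sum w (nbs E v)"
  obtains S D where "separation V E S {v\<in>V. w v \<le> M} D" "S \<noteq> {}" "card S \<le> card D"
proof -
  obtain X Y where XY: "separation V E X C Y" "X \<noteq> {}" "Y \<noteq> {}"
    using C(1) by (rule vertex_cut_separation[OF graph])
  let ?H = "{v\<in>V. M < w v}"
  have H: "Z \<inter> ?H \<noteq> {}" if Z: "separation V E Z C Z'" "Z \<noteq> {}" "Z' \<noteq> {}" for Z Z'
  proof
    assume *: "Z \<inter> ?H = {}"
    obtain x where x: "x \<in> Z" using Z by blast
    have sub: "nbs E x \<subseteq> V" by (rule nbs_subset)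
    have "w v \<le> M" if v: "v \<in> nbs E x" for v
    proof (cases "v \<in> C")
      case False
      then have "v \<in> Z" using separation_nbs_subset(1)[OF Z(1) x Z(3)] v by blast
      then show ?thesis using * sub v by (auto simp: not_less)
    qed (use C(2) in blast)
    then have "sum w (nbs E x) \<le> real (card (nbs E x)) * M" by (rule sum_bounded_above)
    also have "\<dots> \<le> real n * M"
      using M card_mono[OF _ sub] by (intro mult_right_mono) auto
    finally show False
      using no_nbs[of x] separation_nbs_subset(2,3)[OF Z(1) x Z(3)] by simp
  qed
  have sep: "separation V E (X \<inter> ?H) {v\<in>V. w v \<le> M} (Y \<inter> ?H)"
    using XY(1) C(2) unfolding separation_def by (auto simp: not_le)
  show thesis
  proof (cases "card (X \<inter> ?H) \<le> card (Y \<inter> ?H)")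
    case True
    then show ?thesis using that[OF sep] H[OF XY] by blast
  next
    case False
    then show ?thesis
      using that[OF separation_sym[OF sep]] H[OF separation_sym[OF XY(1)] XY(3,2)] by simp
  qed
qed

lemma sum_le_n: "(\<And>v. v \<in> A \<Longrightarrow> u v \<le> b) \<Longrightarrow> 0 \<le> b \<Longrightarrow> A \<subseteq> V \<Longrightarrow> sum u A \<le> real n * b"
proof -
  assume *: "\<And>v. v \<in> A \<Longrightarrow> u v \<le> b" "0 \<le> b" "A \<subseteq> V"
  have "sum u A \<le> real (card A) * b" using *(1) by (rule sum_bounded_above)
  also have "\<dots> \<le> real n * b"
    using *(2) card_mono[OF _ *(3)] by (intro mult_right_mono) auto
  finally show ?thesis .
qed

lemma find_level_prob:
  assumes s: "inp s" "ints s ''l'' 0 = int l" "n \<le> 2 ^ l" "good s"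
    and thr: "reals s ''thr'' 0 = M" "0 \<le> M" "reals s ''cap'' 0 = 1" "reals s ''base'' 0 = 0"
    and C: "vertex_cut V E C" "\<forall>v\<in>C. w v \<le> M"
  shows "expf (cut_round Q) s (misses (real n * M))
    \<le> ennreal (1 - 1 / (256 * real (2 * l + 1)))"
proof (cases "\<exists>v<n. insert v (nbs E v) \<noteq> V \<and> sum w (nbs E v) \<le> real n * M")
  case True
  then have "best s \<le> real n * M" using s(4) unfolding good_def by (auto intro: order_trans)
  then have "expf (cut_round Q) s (misses (real n * M)) \<le> 0"
    by (intro expf_AS_le[OF AS_round[OF s(1,2)]]) (auto simp: improves_def)
  also have "\<dots> \<le> ennreal (1 - 1 / (256 * real (2 * l + 1)))" by simp
  finally show ?thesis .
next
  case False
  let ?L = "{v\<in>V. w v \<le> M}"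
  obtain S D where SD: "separation V E S ?L D" "S \<noteq> {}" "card S \<le> card D"
    by (rule light_cut_cases[OF thr(2) C]) (use False in \<open>auto simp: not_le\<close>)
  define u where "u = sample_weight s"
  have u: "u = (\<lambda>v. if M < w v then 1 else 0)"
    unfolding u_def using thr by (simp add: sample_weight_def fun_eq_iff)
  have heavy: "v \<in> S \<union> D \<Longrightarrow> M < w v" for v
  proof -
    assume "v \<in> S \<union> D"
    then have "v \<in> V" "v \<notin> ?L" using SD(1) unfolding separation_def by blast+
    then show "M < w v" by simp
  qed
  then have sums: "sum u S = real (card S)" "sum u D = real (card D)" "sum u ?L = 0"
    by (simp_all add: u)
  have SV: "S \<subseteq> V" using SD(1) by (auto simp: separation_def)
  then have cS: "1 \<le> card S" "card S \<le> n"
    using SD(2) card_mono[OF _ SV] by (auto simp: Suc_le_eq card_gt_0_iff intro: finite_subset[OF SV])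
  have SC: "sum u (S \<union> ?L) = real (card S)" using sum_split_C[OF SD(1), of u] sums by simp
  have wL: "sum w ?L \<le> real n * M" using thr(2) by (intro sum_le_n) auto
  have "expf (cut_round Q) s (misses (real n * M))
    \<le> expf (cut_round Q) s (misses (sum w ?L))"
    using wL by (intro expf_mono) auto
  also have "\<dots> \<le> ennreal (1 - 1 / 256 * (sum u S / sum u (S \<union> ?L)) * min 1 (sum u D / sum u (S \<union> ?L)) / real (2 * l + 1))"
  proof (rule expf_round[OF s(1-3) u_def _ _ SD(1)])
    have "1 * 1 \<le> real n * real (card S)" using cS n_ge_2 by (intro mult_mono) auto
    then show "reals s ''cap'' 0 \<le> real n * sum u (S \<union> ?L)" unfolding SC using thr by simp
    show "sum u (S \<union> ?L) \<le> real n * reals s ''cap'' 0" unfolding SC using cS thr by simp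
  qed (use thr in auto)
  also have "1 / 256 * (sum u S / sum u (S \<union> ?L)) * min 1 (sum u D / sum u (S \<union> ?L)) / real (2 * l + 1)
      = 1 / (256 * real (2 * l + 1))"
    unfolding SC sums using cS SD(3) by (simp add: min_def le_divide_eq_1)
  finally show ?thesis .
qed

lemma find_level_fails:
  assumes s: "inp s" "ints s ''l'' 0 = int l" "n \<le> 2 ^ l" "good s"
    and thr: "reals s ''thr'' 0 = M" "0 \<le> M" "reals s ''cap'' 0 = 1" "reals s ''base'' 0 = 0"
    and al: "0 < a" "0 < l"
  shows "expf (find_level a Q) s (fails (\<lambda>t s'.
      real t \<le> 2 + real (a * l * (2 * l + 1)) * (round_time l + 2) \<and>
      agree (-{''best'', ''A'', ''i''}) s' s \<and> good s' \<and> best s' \<le> best s \<and>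
      ((\<exists>C. vertex_cut V E C \<and> (\<forall>v\<in>C. w v \<le> M)) \<longrightarrow> best s' \<le> real n * M)))
    \<le> ennreal (exp (- (real (a * l) / 1024)))"
proof -
  define K where "K = a * l * (2 * l + 1)"
  define light where "light \<longleftrightarrow> (\<exists>C. vertex_cut V E C \<and> (\<forall>v\<in>C. w v \<le> M))"
  define \<beta> where "\<beta> = (if light then real n * M else best s)"
  define p where "p = 1 / (256 * real (2 * l + 1))"
  have p: "0 \<le> p" "p \<le> 1" by (auto simp: p_def divide_le_eq)
  let ?I = "\<lambda>s'. agree (-{''best'', ''A'', ''i''}) s' s \<and> good s' \<and> best s' \<le> best s"
  have I: "inp s'" "ints s' ''l'' 0 = int l" "reals s' ''thr'' 0 = M" "reals s' ''cap'' 0 = 1"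
    "reals s' ''base'' 0 = 0" if "?I s'" for s'
    using that s thr inp_agree[of "-{''best'', ''A'', ''i''}" s' s] by (auto simp: agree_def)
  have lim: "reval (lim1 a) s' = real K" if "?I s'" for s'
    using I[OF that] by (simp add: lim1_def K_def algebra_simps)
  have "expf (find_level a Q) s (fails (\<lambda>t s'. real t \<le> 2 + real K * (round_time l + 2) \<and> ?I s' \<and>
      best s' \<le> \<beta>)) \<le> ennreal ((1 - p) ^ K)"
    unfolding find_level_def
  proof (rule expf_repeat_while[where I = ?I])
    fix s' assume I': "?I s'"
    show "AS (cut_round Q) s' (\<lambda>t s''. real t \<le> round_time l \<and> ints s'' ''i'' = ints s' ''i'' \<and> ?I s'' \<and>
        best s'' \<le> best s')"
    proof (rule AS_mono[OF AS_round[OF I(1,2)[OF I']]], elim conjE)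
      fix t s''
      assume *: "real t \<le> T (card E) n + 30 * real size_in + 6 * real l + 40"
        "agree (-{''best'', ''A''}) s'' s'" "improves s' s''"
      then show "real t \<le> round_time l \<and> ints s'' ''i'' = ints s' ''i'' \<and> ?I s'' \<and>
        best s'' \<le> best s'"
        using I' good_improves[of s' s''] unfolding round_time_def improves_def agree_def by auto
    qed
    show "expf (cut_round Q) s' (misses \<beta>) \<le> ennreal (1 - p)"
    proof (cases light)
      case True
      then show ?thesis
        using find_level_prob[OF I(1,2)[OF I'] s(3) _ I(3)[OF I'] thr(2) I(4,5)[OF I']] I'
        unfolding light_def \<beta>_def p_def by auto
    next
      case False
      have "expf (cut_round Q) s' (misses \<beta>) \<le> 0"
        using I' False by (intro expf_AS_le[OF AS_round[OF I(1,2)[OF I']]]) (auto simp: improves_def \<beta>_def)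
      then show ?thesis by simp
    qed
  next
    fix k s' assume "?I s'"
    then show "?I (iupd ''i'' 0 k s')" by (simp add: good_upd)
  qed (use lim s p round_time_nonneg in auto)
  also have "(1 - p) ^ K \<le> exp (- (real (a * l) / 1024))"
  proof (rule power_le_exp[OF p order_refl])
    define r where "r = real (2 * l + 1)"
    have "p = 1 / (256 * r)" "real K = real (a * l) * r"
      by (simp_all only: p_def K_def r_def of_nat_mult)
    moreover have "0 < r" by (simp add: r_def)
    ultimately have "p * real K = real (a * l) / 256" by simp
    then show "real (a * l) / 1024 \<le> p * real K"
      using of_nat_0_le_iff[of "a * l", where 'a = real] by linarith
  qed
  finally have "expf (find_level a Q) s (fails (\<lambda>t s'. real t \<le> 2 + real K * (round_time l + 2) \<and> ?I s' \<and>
      best s' \<le> \<beta>)) \<le> ennreal (exp (- (real (a * l) / 1024)))"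
    by (simp add: ennreal_leI)
  then show ?thesis
    by (rule order_trans[rotated], intro expf_mono) (auto simp: \<beta>_def light_def K_def)
qed

end

lemma ratio_bound:
  fixes x y k e R :: real
  assumes "0 < k" "1 \<le> e" "k \<le> e * x" "x \<le> y" "1 \<le> R" "1 / (2 * R) \<le> y / (x + k)"
  shows "1 / (4 * (e * min e R)) \<le> x / (x + k) * min 1 (y / (x + k))"
proof -
  have x: "0 < x" using assms(1-3) by (smt (verit) mult_nonneg_nonpos)
  have "x \<le> e * x" using assms(2) x by simp
  then have "x + k \<le> 2 * e * x" using assms(3) by simp
  then have A: "1 / (2 * e) \<le> x / (x + k)"
    using x assms(1,2) by (simp add: field_simps)
  have "x / (x + k) \<le> y / (x + k)" using assms(4) x assms(1) by (intro divide_right_mono) auto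
  then have "1 / (2 * e) \<le> y / (x + k)" using A by simp
  moreover note assms(6)
  moreover have "1 / (2 * e) \<le> 1" "1 / (2 * R) \<le> 1" using assms(2,5) by (auto simp: divide_le_eq)
  ultimately have B: "1 / (2 * min e R) \<le> min 1 (y / (x + k))"
    using assms(2,5) by (auto simp: min_def split: if_splits)
  have "1 / (4 * (e * min e R)) = (1 / (2 * e)) * (1 / (2 * min e R))" by simp
  also have "\<dots> \<le> x / (x + k) * min 1 (y / (x + k))"
    using A B assms(2,5) x assms(1) by (intro mult_mono) auto
  finally show ?thesis .
qed

context oracle_graph
begin

definition refine_bound :: "nat \<Rightarrow> nat \<Rightarrow> real \<Rightarrow> real \<Rightarrow> real" where
  "refine_bound a l e b = real (a * l * (2 * l + 1)) * (e * min e (W / (W - b)))"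

definition refine_inv :: "nat \<Rightarrow> real \<Rightarrow> store \<Rightarrow> bool" where
  "refine_inv l e s \<longleftrightarrow> inp s \<and> ints s ''l'' 0 = int l \<and> reals s ''base'' 0 = 1 \<and>
    reals s ''ie'' 0 = e \<and> reals s ''W'' 0 = W \<and> good s \<and> best s \<le> real n * kappa"

abbreviation refine_set :: "store \<Rightarrow> store" where
  "refine_set s \<equiv> rupd ''cap'' 0 (best s) (rupd ''thr'' 0 (best s) s)"

lemma kappa_less_W: "kappa < W"
  using kappa_attained cut_less_W by metis

lemma W_ratio:
  assumes "kappa \<le> b" "b < W"
  shows "1 \<le> W / (W - kappa)" "W / (W - kappa) \<le> W / (W - b)"
proof -
  show "1 \<le> W / (W - kappa)" using assms kappa_nonneg by (simp add: le_divide_eq)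
  show "W / (W - kappa) \<le> W / (W - b)"
    using assms kappa_nonneg by (intro divide_left_mono mult_pos_pos) auto
qed

lemma refine_bound_mono:
  assumes "kappa \<le> b" "b \<le> b'" "b' < W" "1 \<le> e"
  shows "refine_bound a l e b \<le> refine_bound a l e b'"
proof -
  have "W / (W - b) \<le> W / (W - b')"
    using assms kappa_nonneg by (intro divide_left_mono mult_pos_pos) auto
  then show ?thesis
    unfolding refine_bound_def using assms by (intro mult_left_mono) auto
qed

lemma refine_step_sample_prob:
  assumes s: "refine_inv l e s" and l: "n \<le> 2 ^ l" and e: "1 \<le> e" and kappa: "0 < kappa"
    and C: "sum w C = kappa" and sep: "separation V E X C Y"
    and XY: "kappa \<le> e * sum w X" "kappa \<le> e * sum w Y"
  shows "expf (refine_step Q) s (misses kappa)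
    \<le> ennreal (1 - 1 / (1024 * real (2 * l + 1) * (e * min e (W / (W - kappa)))))"
proof -
  define b where "b = best s"
  have b: "kappa \<le> b" "b \<le> real n * kappa" using s good_kappa by (auto simp: refine_inv_def b_def)
  define u where "u = sample_weight (refine_set s)"
  have u: "u = (\<lambda>v. min b (w v))"
    unfolding u_def using s by (auto simp: sample_weight_def refine_inv_def fun_eq_iff b_def)
  have sub: "X \<subseteq> V" "C \<subseteq> V" "Y \<subseteq> V" using sep by (auto simp: separation_def)
  have u0: "0 \<le> u v" if "v < n" for v using w_pos[OF that] b kappa by (simp add: u)
  have uw: "u v \<le> w v" for v by (simp add: u)
  have "w v \<le> b" if "v \<in> C" for v
  proof -
    have "w v \<le> sum w C"
    proof (rule member_le_sum[OF that])
      fix x assume "x \<in> C - {v}"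
      then show "0 \<le> w x" using sub by (intro less_imp_le w_pos) auto
    qed (use sub in \<open>auto intro: finite_subset\<close>)
    then show ?thesis using C b by simp
  qed
  then have uC: "sum u C = kappa" unfolding C[symmetric] by (intro sum.cong) (auto simp: u)
  have big: "sum u Z = sum w Z \<or> b \<le> sum u Z" if "Z \<subseteq> V" for Z
  proof (cases "\<exists>v\<in>Z. b < w v")
    case True
    then obtain v where v: "v \<in> Z" "b < w v" by blast
    then have "u v \<le> sum u Z"
      using that u0 by (intro member_le_sum) (auto intro: finite_subset)
    then show ?thesis using v by (simp add: u)
  next
    case False
    then have "sum u Z = sum w Z" by (intro sum.cong) (auto simp: u not_less)
    then show ?thesis ..
  qed
  have e_ge: "kappa \<le> e * sum u Z" if "Z \<subseteq> V" "kappa \<le> e * sum w Z" for Z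
    using big[OF that(1)]
  proof
    assume "b \<le> sum u Z"
    then have "1 * kappa \<le> e * sum u Z" using e b kappa by (intro mult_mono) auto
    then show ?thesis by simp
  qed (use that in simp)
  obtain S D where SD: "separation V E S C D" "sum u S \<le> sum u D" "kappa \<le> e * sum u S"
    "S \<subseteq> V" "D \<subseteq> V" "sum w S + kappa + sum w D = W"
  proof (cases "sum u X \<le> sum u Y")
    case True
    then show thesis
      using that[OF sep] e_ge[OF sub(1) XY(1)] sub sum_separation[OF sep, of w] C by simp
  next
    case False
    then show thesis
      using that[OF separation_sym[OF sep]] e_ge[OF sub(3) XY(2)] sub sum_separation[OF sep, of w] C by simp
  qed
  have SC: "sum u (S \<union> C) = sum u S + kappa" using sum_split_C[OF SD(1), of u] uC by simp
  have S0: "0 \<le> sum u S" using u0 SD(4) by (intro sum_nonneg) auto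
  have pos: "0 < W - kappa" using kappa_less_W by simp
  have "1 / (2 * (W / (W - kappa))) \<le> sum u D / (sum u S + kappa)"
  proof (cases "b \<le> sum u D")
    case True
    have "1 / (2 * R) \<le> 1 / 2" if "1 \<le> R" for R :: real
      using that by (simp add: divide_le_eq)
    then have "1 / (2 * (W / (W - kappa))) \<le> 1 / 2"
      using W_ratio(1)[OF order_refl kappa_less_W] by blast
    also have "\<dots> \<le> sum u D / (sum u S + kappa)"
      using True b SD(2) S0 kappa by (simp add: le_divide_eq)
    finally show ?thesis .
  next
    case False
    then have "sum u D = sum w D" "sum u S = sum w S"
      using big[OF SD(4)] big[OF SD(5)] SD(2) by auto
    then have "(W - kappa) / 2 \<le> sum u D" "sum u S + kappa \<le> W"
      using SD(2,6) sum_w_nonneg[OF SD(5)] by (simp_all add: field_simps)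
    then have "((W - kappa) / 2) / W \<le> sum u D / (sum u S + kappa)"
      using S0 kappa pos by (intro frac_le) auto
    then show ?thesis by simp
  qed
  from ratio_bound[OF kappa e SD(3,2) _ this]
  have ratio: "1 / (4 * (e * min e (W / (W - kappa)))) \<le>
      sum u S / sum u (S \<union> C) * min 1 (sum u D / sum u (S \<union> C))"
    using W_ratio(1)[OF order_refl kappa_less_W] by (simp add: SC)
  have i: "inp (refine_set s)" "ints (refine_set s) ''l'' 0 = int l"
    using s by (simp_all add: refine_inv_def)
  have "expf (cut_round Q) (refine_set s) (misses (sum w C))
    \<le> ennreal (1 - 1 / 256 * (sum u S / sum u (S \<union> C)) * min 1 (sum u D / sum u (S \<union> C)) / real (2 * l + 1))"
  proof (rule expf_round[OF i l u_def _ _ SD(1)])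
    have "kappa \<le> sum u (S \<union> C)" using SC S0 by simp
    then have "real n * kappa \<le> real n * sum u (S \<union> C)" by (intro mult_left_mono) auto
    then show "reals (refine_set s) ''cap'' 0 \<le> real n * sum u (S \<union> C)"
      using b by (simp add: b_def)
    show "sum u (S \<union> C) \<le> real n * reals (refine_set s) ''cap'' 0"
      using SD(4) sub b kappa by (intro sum_le_n) (auto simp: u b_def)
  qed (use s b kappa in \<open>auto simp: refine_inv_def b_def\<close>)
  also have "\<dots> \<le> ennreal (1 - 1 / (1024 * real (2 * l + 1) * (e * min e (W / (W - kappa)))))"
  proof (intro ennreal_leI diff_left_mono)
    define r where "r = real (2 * l + 1)"
    have r: "0 < r" by (simp add: r_def)
    have "1 / (1024 * r * (e * min e (W / (W - kappa)))) = 1 / (4 * (e * min e (W / (W - kappa)))) / (256 * r)"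
      by simp
    also have "\<dots> \<le> sum u S / sum u (S \<union> C) * min 1 (sum u D / sum u (S \<union> C)) / (256 * r)"
      using ratio r by (intro divide_right_mono) auto
    also have "\<dots> = 1 / 256 * (sum u S / sum u (S \<union> C)) * min 1 (sum u D / sum u (S \<union> C)) / r"
      by simp
    finally show "1 / (1024 * real (2 * l + 1) * (e * min e (W / (W - kappa)))) \<le>
      1 / 256 * (sum u S / sum u (S \<union> C)) * min 1 (sum u D / sum u (S \<union> C)) / real (2 * l + 1)"
      unfolding r_def .
  qed
  finally show ?thesis by (simp add: C)
qed

lemma refine_target:
  assumes s: "refine_inv l e s" and l: "n \<le> 2 ^ l" "0 < l" and e: "1 \<le> e" and a: "0 < a"
  obtains \<beta> p where "kappa \<le> \<beta>" "\<beta> < W" "\<beta> \<le> (1 + 1 / e) * kappa" "0 \<le> p" "p \<le> 1"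
    "refine_bound a l e \<beta> \<le> 2 * refine_bound a l e kappa"
    "real (a * l) / 1024 \<le> p * refine_bound a l e kappa"
    "\<And>s'. refine_inv l e s' \<Longrightarrow>
      expf (refine_step Q) s' (misses \<beta>) \<le> ennreal (1 - p)"
proof -
  have R: "1 \<le> W / (W - kappa)" by (rule W_ratio[OF order_refl kappa_less_W])
  have hk: "real (a * l) \<le> refine_bound a l e kappa"
  proof -
    have "1 * 1 \<le> e * min e (W / (W - kappa))" using e R by (intro mult_mono) auto
    then have "real (a * l * (2 * l + 1)) * 1 \<le> refine_bound a l e kappa"
      unfolding refine_bound_def by (intro mult_left_mono) auto
    moreover have "real (a * l) \<le> real (a * l * (2 * l + 1))" by (rule of_nat_mono) simp
    ultimately show ?thesis unfolding mult_1_right by (rule order_trans[rotated])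
  qed
  moreover have "0 \<le> real (a * l)" by simp
  ultimately have hk': "0 \<le> refine_bound a l e kappa" "real (a * l) / 1024 \<le> 1 * refine_bound a l e kappa"
    by linarith+
  have triv: "expf (refine_step Q) s' (misses \<beta>) \<le> ennreal (1 - 1)"
    if s': "refine_inv l e s'" and best: "best s' \<le> \<beta>" for s' \<beta>
  proof -
    have i: "inp (refine_set s')" "ints (refine_set s') ''l'' 0 = int l"
      using s' by (simp_all add: refine_inv_def)
    have "expf (cut_round Q) (refine_set s') (misses \<beta>) \<le> 0"
      using best by (intro expf_AS_le[OF AS_round[OF i]]) (auto simp: improves_def)
    then show ?thesis by simp
  qed
  obtain C where C: "vertex_cut V E C" "sum w C = kappa" by (rule kappa_attained)
  obtain X' Y' where XY': "separation V E X' C Y'" "X' \<noteq> {}" "Y' \<noteq> {}"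
    using C(1) by (rule vertex_cut_separation[OF graph])
  obtain X Y where sep: "separation V E X C Y" "X \<noteq> {}" "Y \<noteq> {}" "sum w X \<le> sum w Y"
  proof (cases "sum w X' \<le> sum w Y'")
    case True
    then show thesis using that XY' by blast
  next
    case False
    then show thesis using that[OF separation_sym[OF XY'(1)]] XY' by simp
  qed
  have sub: "X \<subseteq> V" "C \<subseteq> V" "Y \<subseteq> V" using sep by (auto simp: separation_def)
  have Wsum: "W = sum w X + kappa + sum w Y" using sum_separation[OF sep(1), of w] C by simp
  consider "kappa = 0" | "0 < kappa" "e * sum w X < kappa" | "0 < kappa" "kappa \<le> e * sum w X"
    using kappa_nonneg by linarith
  then show thesis
  proof cases
    case 1
    show thesis
    proof (rule that[of 0 1])
      fix s' assume "refine_inv l e s'"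
      then show "expf (refine_step Q) s' (misses 0) \<le> ennreal (1 - 1)"
        using 1 by (intro triv) (auto simp: refine_inv_def)
    qed (use 1 kappa_less_W hk' in auto)
  next
    case 2
    obtain x where x: "x \<in> X" using sep by blast
    note nb = separation_nbs_subset[OF sep(1) x sep(3)]
    define \<beta> where "\<beta> = sum w (nbs E x)"
    have cut: "vertex_cut V E (nbs E x)" using nb by (intro nbs_vertex_cut) auto
    have "\<beta> \<le> sum w (X \<union> C)" unfolding \<beta>_def using nb(1) sub by (intro sum_w_mono) auto
    also have "\<dots> = sum w X + kappa" using sum_split_C[OF sep(1), of w] C by simp
    finally have b1: "\<beta> \<le> sum w X + kappa" .
    have "sum w X \<le> kappa / e" using 2 e by (simp add: field_simps)
    then have b2: "\<beta> \<le> (1 + 1 / e) * kappa" using b1 by (simp add: algebra_simps)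
    have b3: "kappa \<le> \<beta>" "\<beta> < W" unfolding \<beta>_def using kappa_le[OF cut] cut_less_W[OF cut] by auto
    have "(W - kappa) / 2 \<le> W - \<beta>" using b1 Wsum sep(4) by (simp add: field_simps)
    then have "W / (W - \<beta>) \<le> W / ((W - kappa) / 2)"
      using b3 kappa_nonneg by (intro divide_left_mono mult_pos_pos) auto
    then have "W / (W - \<beta>) \<le> 2 * (W / (W - kappa))" by (simp add: mult.commute)
    moreover have "min e y \<le> 2 * min e z" if "y \<le> 2 * z" for y z :: real
      using that e by (auto simp: min_def)
    ultimately have "min e (W / (W - \<beta>)) \<le> 2 * min e (W / (W - kappa))" by blast
    then have "e * min e (W / (W - \<beta>)) \<le> e * (2 * min e (W / (W - kappa)))" using e by (intro mult_left_mono) auto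
    then have b4: "refine_bound a l e \<beta> \<le> 2 * refine_bound a l e kappa"
      unfolding refine_bound_def
      using mult_left_mono[of _ _ "real (a * l * (2 * l + 1))"] by (fastforce simp: mult_ac)
    show thesis
    proof (rule that[OF b3 b2 _ _ b4])
      fix s' assume "refine_inv l e s'"
      then show "expf (refine_step Q) s' (misses \<beta>) \<le> ennreal (1 - 1)"
        using nb by (intro triv) (auto simp: refine_inv_def good_def \<beta>_def)
    qed (use hk' in auto)
  next
    case 3
    define p where "p = 1 / (1024 * real (2 * l + 1) * (e * min e (W / (W - kappa))))"
    have m: "1 \<le> e * min e (W / (W - kappa))"
      using e R mult_mono[of 1 e 1 "min e (W / (W - kappa))"] by auto
    have XY: "kappa \<le> e * sum w X" "kappa \<le> e * sum w Y"
      using 3 sep(4) e mult_left_mono[OF sep(4), of e] by linarith+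
    show thesis
    proof (rule that[of kappa p])
      show "0 \<le> p" using m by (simp add: p_def)
      show "p \<le> 1" using m mult_mono[of 1 "1024 * real (2 * l + 1)" 1 "e * min e (W / (W - kappa))"]
        unfolding p_def by (subst divide_le_eq_1_pos) auto
      define x where "x = real (2 * l + 1) * (e * min e (W / (W - kappa)))"
      have "refine_bound a l e kappa = real (a * l) * x"
        unfolding refine_bound_def x_def of_nat_mult[of "a * l"] by (simp only: mult.assoc)
      moreover have "0 < x" using m unfolding x_def by (intro mult_pos_pos[of "real (2 * l + 1)"]) linarith+
      moreover have "p = 1 / (1024 * x)" unfolding p_def x_def by (simp only: mult.assoc)
      ultimately show "real (a * l) / 1024 \<le> p * refine_bound a l e kappa" by simp
      have "0 \<le> refine_bound a l e kappa" using hk by (rule order_trans[rotated]) simp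
      then show "refine_bound a l e kappa \<le> 2 * refine_bound a l e kappa" by simp
      show "kappa \<le> (1 + 1 / e) * kappa" using 3 e by (simp add: algebra_simps)
      fix s' assume "refine_inv l e s'"
      then show "expf (refine_step Q) s' (misses kappa) \<le> ennreal (1 - p)"
        unfolding p_def by (rule refine_step_sample_prob[OF _ l(1) e 3(1) C(2) sep(1) XY])
    qed (use kappa_less_W in auto)
  qed
qed

lemma refine_fails:
  assumes s: "refine_inv l e s" and l: "n \<le> 2 ^ l" "0 < l" and e: "1 \<le> e" and a: "0 < a"
  shows "expf (refine a Q) s (fails (\<lambda>t s'.
      real t \<le> 2 + (2 * refine_bound a l e kappa + 1) * (round_time l + 5) \<and>
      refine_inv l e s' \<and> best s' \<le> (1 + 1 / e) * kappa))
    \<le> ennreal (exp (- (real (a * l) / 1024)))"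
proof -
  obtain \<beta> p where \<beta>: "kappa \<le> \<beta>" "\<beta> < W" "\<beta> \<le> (1 + 1 / e) * kappa" "0 \<le> p" "p \<le> 1"
    "refine_bound a l e \<beta> \<le> 2 * refine_bound a l e kappa"
    "real (a * l) / 1024 \<le> p * refine_bound a l e kappa"
    "\<And>s'. refine_inv l e s' \<Longrightarrow>
      expf (refine_step Q) s' (misses \<beta>) \<le> ennreal (1 - p)"
    using refine_target[OF s l e a] by metis
  let ?h = "refine_bound a l e"
  define K where "K = nat \<lceil>?h kappa\<rceil>"
  define K' where "K' = nat \<lceil>2 * ?h kappa\<rceil>"
  have h0: "0 \<le> ?h kappa"
    using e W_ratio(1)[OF order_refl kappa_less_W] by (simp add: refine_bound_def)
  have guard: "beval (refine_guard a) s' \<longleftrightarrow>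
      real_of_int (ints s' ''i'' 0) < ?h (best s')" if "refine_inv l e s'" for s'
  proof -
    have "reval (lim1 a) s' = real (a * l * (2 * l + 1))"
      using that by (simp add: lim1_def refine_inv_def algebra_simps)
    then show ?thesis
      using that e by (simp add: refine_inv_def refine_bound_def min_mult_distrib_left min_less_iff_conj del: of_nat_mult)
  qed
  have best: "kappa \<le> best s'" "best s' < W" if "refine_inv l e s'" for s'
    using that good_kappa by (auto simp: refine_inv_def)
  have "expf (refine a Q) s (fails (\<lambda>t s'. real t \<le> 2 + real K' * ((round_time l + 3) + 2) \<and>
      refine_inv l e s' \<and> best s' \<le> \<beta>)) \<le> ennreal ((1 - p) ^ K)"
    unfolding refine_def
  proof (rule expf_repeat_while[where I = "refine_inv l e"])
    fix k s' assume *: "refine_inv l e s'" "ints s' ''i'' 0 = int k" "k < K"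
    have "real k < ?h kappa" using *(3) h0 by (simp add: K_def zless_nat_eq_int_zless less_ceiling_iff)
    also have "\<dots> \<le> ?h (best s')" using best[OF *(1)] e by (intro refine_bound_mono) auto
    finally show "beval (refine_guard a) s'"
      using guard[OF *(1)] *(2) by simp
  next
    fix k s' assume *: "refine_inv l e s'" "ints s' ''i'' 0 = int k" "best s' \<le> \<beta>" "K' \<le> k"
    have "?h (best s') \<le> ?h \<beta>" using best[OF *(1)] *(3) \<beta> e by (intro refine_bound_mono) auto
    also have "\<dots> \<le> real K'" using \<beta>(6) unfolding K'_def by linarith
    finally show "\<not> beval (refine_guard a) s'"
      using guard[OF *(1)] *(2,4) by simp
  next
    show "K \<le> K'" unfolding K_def K'_def using h0 by (intro nat_mono ceiling_mono) simp
  next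
    fix s' assume I': "refine_inv l e s'"
    have i: "inp (refine_set s')" "ints (refine_set s') ''l'' 0 = int l"
      using I' by (simp_all add: refine_inv_def)
    have g: "good (refine_set s')" using I' by (simp add: refine_inv_def good_upd)
    have "AS (cut_round Q) (refine_set s') (\<lambda>t s''. real (1 + 1 + t) \<le> round_time l + 3 \<and> ints s'' ''i'' = ints s' ''i'' \<and>
        refine_inv l e s'' \<and> best s'' \<le> best s')"
    proof (rule AS_mono[OF AS_round[OF i]], elim conjE)
      fix t s''
      assume t: "real t \<le> T (card E) n + 30 * real size_in + 6 * real l + 40"
        and ag: "agree (-{''best'', ''A''}) s'' (refine_set s')" and im: "improves (refine_set s') s''"
      have "inp s''" using inp_agree[OF ag _ i(1)] by simp
      moreover have "ints s'' ''i'' = ints s' ''i''" "ints s'' ''l'' = ints s' ''l''"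
        "reals s'' ''base'' = reals s' ''base''" "reals s'' ''ie'' = reals s' ''ie''" "reals s'' ''W'' = reals s' ''W''"
        using ag by (auto simp: agree_def)
      moreover have "good s''" by (rule good_improves[OF g im])
      moreover have "best s'' \<le> best s'" using im by (simp add: improves_def)
      ultimately show "real (1 + 1 + t) \<le> round_time l + 3 \<and> ints s'' ''i'' = ints s' ''i'' \<and>
        refine_inv l e s'' \<and> best s'' \<le> best s'"
        using t I' by (simp add: refine_inv_def round_time_def)
    qed
    then show "AS (refine_step Q) s' (\<lambda>t s''. real t \<le> round_time l + 3 \<and> ints s'' ''i'' = ints s' ''i'' \<and>
        refine_inv l e s'' \<and> best s'' \<le> best s')"
      by simp
    show "expf (refine_step Q) s' (misses \<beta>) \<le> ennreal (1 - p)"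
      by (rule \<beta>(8)[OF I'])
  next
    fix k s' assume "refine_inv l e s'"
    then show "refine_inv l e (iupd ''i'' 0 k s')" by (simp add: refine_inv_def good_upd)
  qed (use s \<beta> round_time_nonneg[of l] in auto)
  also have "(1 - p) ^ K \<le> exp (- (real (a * l) / 1024))"
    using \<beta>(7) by (intro power_le_exp[OF \<beta>(4,5)]) (auto simp: K_def real_nat_ceiling_ge)
  finally have main: "expf (refine a Q) s (fails (\<lambda>t s'. real t \<le> 2 + real K' * ((round_time l + 3) + 2) \<and>
      refine_inv l e s' \<and> best s' \<le> \<beta>)) \<le> ennreal (exp (- (real (a * l) / 1024)))"
    by (simp add: ennreal_leI)
  have "real K' * ((round_time l + 3) + 2) \<le> (2 * ?h kappa + 1) * (round_time l + 5)"
  proof -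
    have "real K' \<le> 2 * ?h kappa + 1" unfolding K'_def using h0 by linarith
    then show ?thesis using round_time_nonneg[of l] mult_right_mono[of "real K'" "2 * ?h kappa + 1" "round_time l + 5"]
      by (simp add: add.assoc)
  qed
  then have time: "real t \<le> 2 + (2 * ?h kappa + 1) * (round_time l + 5)"
    if "real t \<le> 2 + real K' * ((round_time l + 3) + 2)" for t
    using that by linarith
  have "expf (refine a Q) s (fails (\<lambda>t s'. real t \<le> 2 + (2 * ?h kappa + 1) * (round_time l + 5) \<and>
      refine_inv l e s' \<and> best s' \<le> (1 + 1 / e) * kappa))
    \<le> expf (refine a Q) s (fails (\<lambda>t s'. real t \<le> 2 + real K' * ((round_time l + 3) + 2) \<and>
      refine_inv l e s' \<and> best s' \<le> \<beta>))"
    by (intro expf_mono fails_mono, elim conjE, intro conjI)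
      (rule time, assumption, assumption, erule order_trans, rule \<beta>(3))
  with main show ?thesis by (rule order_trans[rotated])
qed

end

section \<open>Initial cut and search for the weight level\<close>

definition add_to :: "vname \<Rightarrow> iexp \<Rightarrow> rexp \<Rightarrow> com" where
  "add_to x i e = RSet x i (RAdd (RVal x i) e)"

abbreviation double_up :: com where
  "double_up \<equiv> While (ILess (iv ''p'') (iv ''n''))
        (Seq (ISet ''p'' (N 0) (IAdd (iv ''p'') (iv ''p''))) (ISet ''l'' (N 0) (IAdd (iv ''l'') (N 1))))"

abbreviation weigh_nbs :: com where
  "weigh_nbs \<equiv> for_loop ''e'' (iv ''m'')
        (Seq (add_to ''d'' (IVal ''src'' (iv ''e'')) (RVal ''w'' (IVal ''dst'' (iv ''e''))))
          (add_to ''d'' (IVal ''dst'' (iv ''e'')) (RVal ''w'' (IVal ''src'' (iv ''e'')))))"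

abbreviation lightest_nbs :: com where
  "lightest_nbs \<equiv> Seq (RSet ''best'' (N 0) (rv ''W''))
        (for_loop ''v'' (iv ''n'')
          (If (And (RLess (RAdd (RVal ''d'' (iv ''v'')) (RVal ''w'' (iv ''v''))) (rv ''W''))
                (RLess (RVal ''d'' (iv ''v'')) (rv ''best'')))
            (Seq (RSet ''best'' (N 0) (RVal ''d'' (iv ''v''))) (ISet ''arg'' (N 0) (iv ''v''))) Skip))"

abbreviation mark_nbs :: com where
  "mark_nbs \<equiv> for_loop ''e'' (iv ''m'')
      (Seq (If (nonzero (ISub (IVal ''src'' (iv ''e'')) (iv ''arg''))) Skip
             (ISet ''A'' (IVal ''dst'' (iv ''e'')) (N 1)))
        (If (nonzero (ISub (IVal ''dst'' (iv ''e'')) (iv ''arg''))) Skip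
             (ISet ''A'' (IVal ''src'' (iv ''e'')) (N 1))))"

definition init_body :: com where
  "init_body = Seq (for_loop ''v'' (iv ''n'') (add_to ''W'' (N 0) (RVal ''w'' (iv ''v''))))
    (Seq (Seq (ISet ''p'' (N 0) (N 1)) double_up)
    (Seq weigh_nbs (Seq lightest_nbs mark_nbs)))"

abbreviation list_candidates :: com where
  "list_candidates \<equiv> for_loop ''v'' (iv ''n'')
      (If (And (RLess (rv ''lo'') (RVal ''w'' (iv ''v'')))
            (RLess (RMul (OfInt (iv ''n'')) (RVal ''w'' (iv ''v''))) (rv ''best'')))
        (Seq (ISet ''lst'' (iv ''cnt'') (iv ''v'')) (ISet ''cnt'' (N 0) (IAdd (iv ''cnt'') (N 1)))) Skip)"

abbreviation draw_candidate :: com where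
  "draw_candidate \<equiv> Seq (Rand ''r'' (N 0) (iv ''cnt''))
      (RSet ''thr'' (N 0) (RVal ''w'' (IVal ''lst'' (iv ''r''))))"

abbreviation raise_lo :: com where
  "raise_lo \<equiv> If (RLess (RMul (OfInt (iv ''n'')) (rv ''thr'')) (rv ''best''))
          (RSet ''lo'' (N 0) (rv ''thr'')) Skip"

definition pick_body :: com where
  "pick_body = Seq list_candidates
    draw_candidate"

definition search_step :: "nat \<Rightarrow> com \<Rightarrow> com" where
  "search_step a Q = Seq (Call [''n'', ''m'', ''src'', ''dst'', ''w'', ''lo'', ''best''] pick_body [''cnt'', ''thr''])
    (If (ILess (N 0) (iv ''cnt''))
      (Seq (find_level a Q)
        raise_lo)
      Skip)"

primrec itimes :: "nat \<Rightarrow> iexp \<Rightarrow> iexp" where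
  "itimes 0 e = N 0"
| "itimes (Suc k) e = IAdd e (itimes k e)"

lemma ieval_itimes [simp]: "ieval (itimes k e) s = int k * ieval e s"
  by (induction k) (simp_all add: distrib_right)

definition search :: "nat \<Rightarrow> nat \<Rightarrow> com \<Rightarrow> com" where
  "search a k Q = for_loop ''g'' (itimes k (iv ''l'')) (search_step a Q)"

fun nb_list :: "(nat \<times> nat) list \<Rightarrow> nat \<Rightarrow> nat set" where
  "nb_list [] x = {}"
| "nb_list ((a, b) # es) x = (if a = x then {b} else {}) \<union> (if b = x then {a} else {}) \<union> nb_list es x"

fun nb_weight :: "(nat \<Rightarrow> real) \<Rightarrow> (nat \<times> nat) list \<Rightarrow> nat \<Rightarrow> real" where
  "nb_weight w [] x = 0"
| "nb_weight w ((a, b) # es) x = (if a = x then w b else 0) + (if b = x then w a else 0) + nb_weight w es x"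

lemma nb_list_append: "nb_list (es @ fs) x = nb_list es x \<union> nb_list fs x"
  by (induction es x rule: nb_list.induct) auto

lemma nb_weight_append: "nb_weight w (es @ fs) x = nb_weight w es x + nb_weight w fs x"
  by (induction es x rule: nb_list.induct) auto

lemma nb_list_iff: "y \<in> nb_list es x \<longleftrightarrow> {x, y} \<in> set (map (\<lambda>(u, v). {u, v}) es)"
  by (induction es x rule: nb_list.induct) (auto simp: doubleton_eq_iff)

lemma finite_nb_list [simp]: "finite (nb_list es x)"
  by (induction es x rule: nb_list.induct) auto

lemma nb_weight_eq:
  assumes "distinct (map (\<lambda>(u, v). {u, v}) es)" "\<And>a b. (a, b) \<in> set es \<Longrightarrow> a \<noteq> b"
  shows "nb_weight w es x = sum w (nb_list es x)"
  using assms
proof (induction es x rule: nb_list.induct)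
  case (2 a b es x)
  then have IH: "nb_weight w es x = sum w (nb_list es x)" by simp
  have ab: "a \<noteq> b" using "2.prems"(2)[of a b] by simp
  have "{a, b} \<notin> set (map (\<lambda>(u, v). {u, v}) es)" using "2.prems"(1) by simp
  then have "a = x \<Longrightarrow> b \<notin> nb_list es x" "b = x \<Longrightarrow> a \<notin> nb_list es x"
    unfolding nb_list_iff by (auto simp: insert_commute)
  then show ?case using IH ab by auto
qed simp

lemma sum_max_rank:
  fixes w :: "'a \<Rightarrow> real"
  assumes "finite A"
  shows "(\<Sum>v\<in>A. real (max (card {u\<in>A. w u < w v}) (card {u\<in>A. w v < w u}))) \<le> 3 / 4 * (real (card A))\<^sup>2"
  using assms
proof (induction "card A" arbitrary: A rule: less_induct)
  case less
  let ?m = "\<lambda>A v. max (card {u\<in>A. w u < w v}) (card {u\<in>A. w v < w u})"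
  show ?case
  proof (cases "card A \<le> 1")
    case True
    show ?thesis
    proof (cases "A = {}")
      case False
      then obtain a where "A = {a}" using True less.prems by (metis card_1_singletonE card_0_eq le_antisym less_one not_le)
      then show ?thesis by (simp add: Collect_conv_if)
    qed simp
  next
    case False
    have "A \<noteq> {}" using False by auto
    define x where "x = arg_min_on w A"
    have x: "x \<in> A" "\<And>u. u \<in> A \<Longrightarrow> w x \<le> w u"
      unfolding x_def using arg_min_if_finite[OF less.prems \<open>A \<noteq> {}\<close>, of w] by (auto simp: not_less)
    have B0: "finite (A - {x})" "A - {x} \<noteq> {}"
    proof -
      have "card (A - {x}) = card A - 1" using x(1) less.prems by simp
      then have "card (A - {x}) \<noteq> 0" using False by linarith
      then show "A - {x} \<noteq> {}" by (metis card.empty)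
    qed (use less.prems in simp)
    define y where "y = arg_min_on (\<lambda>v. - w v) (A - {x})"
    have y: "y \<in> A - {x}" "\<And>u. u \<in> A - {x} \<Longrightarrow> w u \<le> w y"
      unfolding y_def using arg_min_if_finite[OF B0, of "\<lambda>v. - w v"] by (auto simp: not_less)
    define B where "B = A - {x, y}"
    have A: "A = insert x (insert y B)" "x \<notin> insert y B" "y \<notin> B" "finite B"
      using x y less.prems by (auto simp: B_def)
    have cA: "card A = card B + 2" using A by simp
    have end_bound: "?m A z \<le> card B + 1" if "z \<in> A" for z
    proof -
      have "card {u\<in>A. w u < w z} \<le> card (A - {z})" "card {u\<in>A. w z < w u} \<le> card (A - {z})"
        using less.prems by (auto intro!: card_mono)
      then show ?thesis using that cA by simp
    qed
    have mid: "?m A v \<le> ?m B v + 1" if "v \<in> B" for v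
    proof -
      have "w x \<le> w v" "w v \<le> w y" using x y that by (auto simp: B_def)
      then have sub: "{u\<in>A. w u < w v} \<subseteq> insert x {u\<in>B. w u < w v}"
        "{u\<in>A. w v < w u} \<subseteq> insert y {u\<in>B. w v < w u}"
        unfolding A(1) by auto
      have "card {u\<in>A. w u < w v} \<le> card (insert x {u\<in>B. w u < w v})"
        by (rule card_mono[OF _ sub(1)]) (use A(4) in simp)
      moreover have "card {u\<in>A. w v < w u} \<le> card (insert y {u\<in>B. w v < w u})"
        by (rule card_mono[OF _ sub(2)]) (use A(4) in simp)
      moreover have "card (insert z S) \<le> Suc (card S)" for z :: 'a and S
        by (cases "finite S") (auto simp: card_insert_if)
      ultimately have "card {u\<in>A. w u < w v} \<le> Suc (card {u\<in>B. w u < w v})"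
        "card {u\<in>A. w v < w u} \<le> Suc (card {u\<in>B. w v < w u})"
        by (meson order_trans)+
      then show ?thesis by linarith
    qed
    have "(\<Sum>v\<in>A. real (?m A v)) = real (?m A x) + real (?m A y) + (\<Sum>v\<in>B. real (?m A v))"
      using A by (metis (no_types, lifting) add.assoc finite_insert sum.insert)
    also have "\<dots> \<le> real (card B + 1) + real (card B + 1) + (\<Sum>v\<in>B. real (?m B v + 1))"
      using end_bound x y mid by (intro add_mono sum_mono of_nat_mono) auto
    also have "\<dots> = 2 * real (card B + 1) + real (card B) + (\<Sum>v\<in>B. real (?m B v))"
      by (simp add: sum.distrib)
    also have "\<dots> \<le> 2 * real (card B + 1) + real (card B) + 3 / 4 * (real (card B))\<^sup>2"
      using less.hyps[of B] A cA by simp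
    also have "\<dots> \<le> 3 / 4 * (real (card A))\<^sup>2"
      unfolding cA by (simp add: power2_eq_square algebra_simps)
    finally show ?thesis .
  qed
qed

lemma expf_le_add:
  assumes "\<And>t s'. h t s' \<le> 1" "\<And>t s'. P t s' \<Longrightarrow> h t s' \<le> B"
  shows "expf c s h \<le> expf c s (fails P) + B"
proof -
  have "expf c s h \<le> (\<integral>\<^sup>+x. outcome (fails P) x + B \<partial>measure_pmf (exec c s))"
    unfolding expf_def
  proof (rule nn_integral_mono)
    fix x
    show "outcome h x \<le>
        outcome (fails P) x + B"
    proof (cases x)
      case (Some p)
      obtain t s' where "p = (t, s')" by fastforce
      then show ?thesis using Some assms(1)[of t s'] assms(2)[of t s'] by (auto intro: add_increasing2)
    qed simp
  qed
  also have "\<dots> = expf c s (fails P) + B"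
    unfolding expf_def by (subst nn_integral_add) auto
  finally show ?thesis .
qed

context oracle_graph
begin

lemma nb_list_es: "nb_list es x = nbs E x"
  using edges unfolding set_eq_iff nb_list_iff lists_edges_def nbs_def by auto

lemma nb_weight_es: "nb_weight w es x = sum w (nbs E x)"
  using edges es_edgeD(3) nb_weight_eq[of es w x] unfolding nb_list_es[symmetric] lists_edges_def by blast

definition lg :: nat where
  "lg = (LEAST l. n \<le> 2 ^ l)"

lemma n_le_lg: "n \<le> 2 ^ lg"
  unfolding lg_def by (rule LeastI[of _ n]) (simp add: less_imp_le)

lemma less_lg: "k < lg \<Longrightarrow> 2 ^ k < n"
  unfolding lg_def using not_less_Least not_le by blast

lemma lg_pos: "0 < lg"
  using n_le_lg n_ge_2 by (cases lg) auto

lemma lg_le_n: "lg \<le> n"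
  unfolding lg_def by (rule Least_le) (simp add: less_imp_le)

lemma lg_le_log: "real lg \<le> 2 * log 2 (real n)"
proof -
  have "2 ^ (lg - 1) \<le> n" using less_lg[of "lg - 1"] lg_pos by simp
  then have "real (2 ^ (lg - 1)) \<le> real n" by (rule of_nat_mono)
  then have "log 2 (2 ^ (lg - 1)) \<le> log 2 (real n)" by (simp add: le_log_of_power)
  then have "real lg - 1 \<le> log 2 (real n)" using lg_pos by (simp add: of_nat_diff)
  moreover have "log 2 2 \<le> log 2 (real n)" using n_ge_2 by (subst log_le_cancel_iff) auto
  ultimately show ?thesis by simp
qed

lemma AS_compute_lg:
  assumes s: "ints s ''n'' 0 = int n" "ints s ''p'' 0 = 1" "ints s ''l'' 0 = 0"
  shows "AS double_up s
    (\<lambda>t s'. t \<le> 1 + 3 * lg \<and> agree (-{''p'', ''l''}) s' s \<and> ints s' ''l'' 0 = int lg)"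
proof -
  have "AS double_up s' (\<lambda>t s''. t \<le> 1 + 3 * (lg - k) \<and> agree (-{''p'', ''l''}) s'' s \<and> ints s'' ''l'' 0 = int lg)"
    if "k \<le> lg" "agree (-{''p'', ''l''}) s' s" "ints s' ''p'' 0 = 2 ^ k" "ints s' ''l'' 0 = int k" for k s'
    using that
  proof (induction "lg - k" arbitrary: k s')
    case 0
    then have [simp]: "k = lg" by simp
    have "int n \<le> 2 ^ lg" using n_le_lg by (metis of_nat_le_iff of_nat_numeral of_nat_power)
    moreover have "ints s' ''n'' 0 = int n" using 0 s by (simp add: agree_def)
    ultimately show ?case using 0 by (subst AS_While) simp
  next
    case (Suc r)
    have "2 ^ k < n" using less_lg[of k] Suc.hyps(2) by simp
    then have "2 ^ k < int n" by (metis of_nat_less_iff of_nat_numeral of_nat_power)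
    moreover have "ints s' ''n'' 0 = int n" using Suc.prems s by (simp add: agree_def)
    moreover have "AS double_up (iupd ''l'' 0 (int (Suc k)) (iupd ''p'' 0 (2 ^ Suc k) s'))
        (\<lambda>t s''. t \<le> 1 + 3 * (lg - Suc k) \<and> agree (-{''p'', ''l''}) s'' s \<and> ints s'' ''l'' 0 = int lg)"
      using Suc by (intro Suc.hyps(1)) auto
    then have "AS double_up (iupd ''l'' 0 (int (Suc k)) (iupd ''p'' 0 (2 ^ Suc k) s'))
        (\<lambda>t s''. 1 + (1 + 1 + t) \<le> 1 + 3 * (lg - k) \<and> agree (-{''p'', ''l''}) s'' s \<and> ints s'' ''l'' 0 = int lg)"
      by (rule AS_mono) (use Suc.hyps(2) in auto)
    ultimately show ?case
      using Suc.prems by (subst AS_While) (simp add: add.commute)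
  qed
  from this[of 0 s] s show ?thesis by simp
qed

lemma AS_init_body:
  assumes s: "inp s" "ints s ''l'' 0 = 0" "ints s ''A'' = (\<lambda>_. 0)" "reals s ''d'' = (\<lambda>_. 0)"
    "reals s ''W'' 0 = 0"
  shows "AS init_body s (\<lambda>t s'. t \<le> 50 * size_in + 50 \<and> good s' \<and> ints s' ''l'' 0 = int lg \<and> reals s' ''W'' 0 = W)"
proof -
  let ?d = "\<lambda>x. sum w (nbs E x)"
  let ?cand = "\<lambda>v. insert v (nbs E v) \<noteq> V"
  let ?I1 = "\<lambda>k s'. inp s' \<and> agree (-{''v'', ''W''}) s' s \<and> reals s' ''W'' 0 = sum w {..<k}"
  let ?I3 = "\<lambda>k s'. inp s' \<and> ints s' ''A'' = (\<lambda>_. 0) \<and> ints s' ''l'' 0 = int lg \<and> reals s' ''W'' 0 = W \<and>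
      (\<forall>x. reals s' ''d'' (int x) = nb_weight w (take k es) x)"
  let ?I4 = "\<lambda>k s'. inp s' \<and> ints s' ''A'' = (\<lambda>_. 0) \<and> ints s' ''l'' 0 = int lg \<and> reals s' ''W'' 0 = W \<and>
      (\<forall>x. reals s' ''d'' (int x) = ?d x) \<and> (\<forall>v<k. ?cand v \<longrightarrow> best s' \<le> ?d v) \<and>
      (best s' = W \<or> (\<exists>v<n. ints s' ''arg'' 0 = int v \<and> ?cand v \<and> best s' = ?d v))"
  let ?I5 = "\<lambda>x k s'. inp s' \<and> ints s' ''l'' 0 = int lg \<and> reals s' ''W'' 0 = W \<and>
      best s' = ?d x \<and> ints s' ''arg'' 0 = int x \<and> ints s' ''A'' = ind (nb_list (take k es) x)"
  have cand_iff: "?d v + w v < W \<longleftrightarrow> ?cand v" if "v < n" for v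
  proof -
    have sub: "insert v (nbs E v) \<subseteq> V" using nbs_subset that by auto
    have eq: "sum w (insert v (nbs E v)) = ?d v + w v"
      using nbs_irrefl[of v] finite_subset[OF nbs_subset[of v]] by simp
    show ?thesis
    proof
      assume "?cand v"
      then obtain y where y: "y \<in> V - insert v (nbs E v)" using sub by blast
      have "0 < sum w (V - insert v (nbs E v))" using y by (intro sum_w_pos) auto
      then show "?d v + w v < W" using eq sum.subset_diff[OF sub, of w] by simp
    next
      assume lt: "?d v + w v < W"
      show "?cand v"
      proof
        assume "insert v (nbs E v) = V"
        then show False using eq lt by simp
      qed
    qed
  qed
  have ex_cand: "\<exists>v<n. ?cand v"
  proof -
    obtain C where "vertex_cut V E C" using has_cut by blast
    then obtain X Y where XY: "separation V E X C Y" "X \<noteq> {}" "Y \<noteq> {}"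
      by (rule vertex_cut_separation[OF graph])
    then obtain x where "x \<in> X" by blast
    then show ?thesis using separation_nbs_subset(2,3)[OF XY(1) _ XY(3)] by blast
  qed
  show ?thesis
    unfolding init_body_def
  proof (rule AS_SeqI, rule AS_for_loop[where I = ?I1 and tb = 1])
    show "?I1 0 (iupd ''v'' 0 0 s)" using s by simp
  next
    fix k s' assume "?I1 k s'"
    then show "ieval (iv ''n'') s' = int n" by (simp add: inp_simps)
  next
    fix k s' assume "k < n" "?I1 k s'" "ints s' ''v'' 0 = int k"
    then show "AS (add_to ''W'' (N 0) (RVal ''w'' (iv ''v''))) s'
       (\<lambda>t s''. t \<le> 1 \<and> ints s'' ''v'' 0 = int k \<and> ?I1 (Suc k) (iupd ''v'' 0 (int (Suc k)) s''))"
      by (simp add: add_to_def inp_simps)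
  next
    fix t1 s1 assume t1: "t1 \<le> 2 + n * (1 + 2)" and I1: "?I1 n s1"
    have s1: "ints s1 ''A'' = (\<lambda>_. 0)" "reals s1 ''d'' = (\<lambda>_. 0)" "ints s1 ''l'' 0 = 0" "inp s1" "reals s1 ''W'' 0 = W"
      using I1 s by (simp_all add: agree_def)
    show "AS (Seq (Seq (ISet ''p'' (N 0) (N 1)) double_up)
    (Seq weigh_nbs (Seq lightest_nbs mark_nbs))) s1
      (\<lambda>t s'. t1 + t \<le> 50 * size_in + 50 \<and> good s' \<and> ints s' ''l'' 0 = int lg \<and> reals s' ''W'' 0 = W)"
    proof (rule AS_SeqI, subst AS_Seq, subst AS_ISet, rule AS_mono[OF AS_compute_lg], goal_cases)
      case (4 t2 s2)
      have s2: "ints s2 ''A'' = (\<lambda>_. 0)" "reals s2 ''d'' = (\<lambda>_. 0)" "ints s2 ''l'' 0 = int lg" "inp s2" "reals s2 ''W'' 0 = W"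
        using 4 s1 by (auto simp: agree_def inp_def)
      show ?case
      proof (rule AS_SeqI, rule AS_for_loop[where I = ?I3 and K = "length es" and tb = 2], goal_cases)
        case 1 show ?case using s2 by simp
      next
        case (2 k s') then show ?case by (simp add: inp_simps)
      next
        case (3 k s')
        obtain a b where ab: "es ! k = (a, b)" by fastforce
        then have "a \<noteq> b" "a < n" "b < n" using es_edgeD[of a b] 3(1) by (metis nth_mem)+
        then show ?case using 3 ab
          by (simp add: add_to_def inp_simps take_Suc_conv_app_nth nb_weight_append)
      next
        case (4 t3 s3)
        show ?case
        proof (rule AS_SeqI, subst AS_Seq, subst AS_RSet, rule AS_for_loop[where I = ?I4 and K = n and tb = 3], goal_cases)
          case 1 show ?case using 4 by (simp add: nb_weight_es)
        next
          case (2 k s') then show ?case by (simp add: inp_simps)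
        next
          case (3 k s')
          have c: "?d k + w k < W \<longleftrightarrow> ?cand k" using cand_iff 3(1) .
          show ?case
          proof (cases "?cand k \<and> ?d k < best s'")
            case True
            have "\<forall>v<Suc k. ?cand v \<longrightarrow> ?d k \<le> ?d v"
              using 3(2) True by (auto simp: less_Suc_eq intro: order_trans[OF less_imp_le])
            then show ?thesis using 3 True c by (auto simp: inp_simps)
          next
            case False
            have "\<forall>v<Suc k. ?cand v \<longrightarrow> best s' \<le> ?d v"
              using 3(2) False by (auto simp: less_Suc_eq not_less)
            then show ?thesis using 3 False c by (auto simp: inp_simps)
          qed
        next
          case I4: (4 t4 s4)
          have "best s4 \<noteq> W"
          proof -
            obtain v where v: "v < n" "?cand v" using ex_cand by blast
            then have "best s4 \<le> ?d v" using I4(2) by blast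
            also have "?d v < W" using cand_iff[OF v(1)] v w_pos[OF v(1)] by simp
            finally show ?thesis by simp
          qed
          then obtain x where x: "x < n" "ints s4 ''arg'' 0 = int x" "?cand x" "best s4 = ?d x"
            using I4(2) by blast
          show ?case
          proof (rule AS_for_loop[where I = "?I5 x" and K = "length es" and tb = 4], goal_cases)
            case 1 show ?case using I4 x by simp
          next
            case (2 k s') then show ?case by (simp add: inp_simps)
          next
            case (3 k s')
            obtain a b where ab: "es ! k = (a, b)" by fastforce
            then have "a \<noteq> b" "a < n" "b < n" using es_edgeD[of a b] 3(1) by (metis nth_mem)+
            then show ?case using 3 ab
              by (simp add: inp_simps take_Suc_conv_app_nth nb_list_append)
          next
            case (4 t5 s5)
            have "aset s5 = nbs E x"
              using 4(2) nbs_subset[of x] by (auto simp: aset_def nb_list_es)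
            moreover have "\<forall>v<n. ?cand v \<longrightarrow> ?d x \<le> ?d v" using I4(2) x by auto
            ultimately have "good s5"
              using 4(2) nbs_vertex_cut[OF x(1,3)] by (simp add: good_def)
            moreover have "t1 + (1 + t2 + (t3 + (1 + t4 + t5))) \<le> 50 * size_in + 50"
              using t1 \<open>t2 \<le> _ \<and> _\<close> \<open>t3 \<le> _\<close> \<open>t4 \<le> _\<close> \<open>t5 \<le> _\<close> lg_le_n by simp
            ultimately show ?case using 4(2) by simp
          qed
        qed
      qed
    qed (use s1 in \<open>simp_all add: inp_simps\<close>)
  qed
qed


definition cands :: "store \<Rightarrow> nat set" where
  "cands s = {v. v < n \<and> reals s ''lo'' 0 < w v \<and> real n * w v < best s}"

lemma finite_cands [simp]: "finite (cands s)"
  unfolding cands_def by (rule finite_subset[of _ V]) auto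

abbreviation pick :: com where
  "pick \<equiv> Call [''n'', ''m'', ''src'', ''dst'', ''w'', ''lo'', ''best''] pick_body [''cnt'', ''thr'']"

lemma AS_pick_loop:
  assumes s: "inp s" "ints s ''cnt'' 0 = 0"
  shows "AS list_candidates s
    (\<lambda>t s'. t \<le> 5 * n + 2 \<and> inp s' \<and> (\<exists>xs. distinct xs \<and> set xs = cands s \<and>
      ints s' ''cnt'' 0 = int (length xs) \<and> (\<forall>j<length xs. ints s' ''lst'' (int j) = int (xs ! j))))"
proof -
  let ?P = "\<lambda>k xs s'. distinct xs \<and> set xs = cands s \<inter> {..<k} \<and>
      ints s' ''cnt'' 0 = int (length xs) \<and> (\<forall>j<length xs. ints s' ''lst'' (int j) = int (xs ! j))"
  let ?I = "\<lambda>k s'. inp s' \<and> reals s' = reals s \<and> (\<exists>xs. ?P k xs s')"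
  show ?thesis
  proof (rule AS_for_loop[where I = ?I and tb = 3 and K = n], goal_cases)
    case 1
    show ?case using s by (auto intro!: exI[of _ "[]"])
  next
    case (2 k s') then show ?case by (simp add: inp_simps)
  next
    case (3 k s')
    then obtain xs where xs: "?P k xs s'" by blast
    have c: "k \<in> cands s \<longleftrightarrow> reals s ''lo'' 0 < w k \<and> real n * w k < best s"
      using 3(1) by (simp add: cands_def)
    have set: "cands s \<inter> {..<Suc k} = (if k \<in> cands s then insert k (cands s \<inter> {..<k}) else cands s \<inter> {..<k})"
      by (auto simp: less_Suc_eq)
    have wk: "reals s ''w'' (int k) = w k" using s 3(1) by (simp add: inp_simps)
    have n: "ints s' ''n'' 0 = int n" using 3(2) by (simp add: inp_simps)
    show ?case
    proof (cases "k \<in> cands s")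
      case True
      have "?P (Suc k) (xs @ [k]) (iupd ''v'' 0 (int (Suc k)) (iupd ''cnt'' 0 (int (length xs) + 1)
          (iupd ''lst'' (int (length xs)) (int k) s')))"
        using xs True set by (auto simp: nth_append less_Suc_eq)
      then have "\<exists>ys. ?P (Suc k) ys (iupd ''v'' 0 (int (Suc k)) (iupd ''cnt'' 0 (int (length xs) + 1)
          (iupd ''lst'' (int (length xs)) (int k) s')))"
        by (rule exI[where P = "\<lambda>xs'. ?P (Suc k) xs' (iupd ''v'' 0 (int (Suc k)) (iupd ''cnt'' 0 (int (length xs) + 1)
          (iupd ''lst'' (int (length xs)) (int k) s')))"])
      then show ?thesis using 3 xs True c wk n by simp
    next
      case False
      then have "?P (Suc k) xs (iupd ''v'' 0 (int (Suc k)) s')" using xs set by simp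
      then have "\<exists>xs. ?P (Suc k) xs (iupd ''v'' 0 (int (Suc k)) s')"
        by (rule exI[where P = "\<lambda>xs. ?P (Suc k) xs (iupd ''v'' 0 (int (Suc k)) s')"])
      moreover have "\<not> (reals s ''lo'' 0 < w k \<and> real n * w k < best s)"
        using False c by simp
      moreover have "reals s' = reals s" "inp s'" using 3(2) by simp_all
      ultimately show ?thesis using 3(3) wk n by (simp del: de_Morgan_conj)
    qed
  next
    case (4 t s')
    moreover have "cands s \<inter> {..<n} = cands s" by (auto simp: cands_def)
    ultimately show ?case by auto
  qed
qed

lemma AS_pick_empty:
  assumes s: "inp s" "cands s = {}"
  shows "AS pick s (\<lambda>t s'. t \<le> 5 * n + 10 \<and> agree (-{''cnt'', ''thr''}) s' s \<and> ints s' ''cnt'' 0 = 0)"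
proof -
  define s0 where "s0 = transfer_arrays [''n'', ''m'', ''src'', ''dst'', ''w'', ''lo'', ''best''] s zero_store"
  have s0: "inp s0" "ints s0 ''cnt'' 0 = 0" "cands s0 = {}"
    using s by (simp_all add: s0_def cands_def)
  show ?thesis
    unfolding AS_Call s0_def[symmetric] pick_body_def AS_Seq[of "for_loop _ _ _"]
    by (rule AS_mono[OF AS_pick_loop[OF s0(1,2)]]) (auto simp: s0 agree_def)
qed

lemma expf_pick:
  assumes s: "inp s" "cands s \<noteq> {}"
    and h: "\<And>v t s'. v \<in> cands s \<Longrightarrow> t \<le> 5 * n + 10 \<Longrightarrow> agree (-{''cnt'', ''thr''}) s' s \<Longrightarrow>
      0 < ints s' ''cnt'' 0 \<Longrightarrow> reals s' ''thr'' 0 = w v \<Longrightarrow> h t s' \<le> B v"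
  shows "expf pick s h \<le> (\<Sum>v\<in>cands s. B v) / of_nat (card (cands s))"
proof -
  define s0 where "s0 = transfer_arrays [''n'', ''m'', ''src'', ''dst'', ''w'', ''lo'', ''best''] s zero_store"
  have s0: "inp s0" "ints s0 ''cnt'' 0 = 0" "cands s0 = cands s"
    using s by (simp_all add: s0_def cands_def)
  show ?thesis
    unfolding expf_Call s0_def[symmetric] pick_body_def expf_Seq[of "for_loop _ _ _"]
  proof (rule expf_AS_le[OF AS_pick_loop[OF s0(1,2)]], elim conjE exE)
    fix t s1 xs
    assume t: "t \<le> 5 * n + 2" and s1: "inp s1" and xs: "distinct xs" "set xs = cands s0"
      "ints s1 ''cnt'' 0 = int (length xs)" "\<forall>j<length xs. ints s1 ''lst'' (int j) = int (xs ! j)"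
    have len: "length xs = card (cands s)" using xs s0 by (metis distinct_card)
    have pos: "0 < length xs" using s(2) len by (simp add: card_gt_0_iff)
    let ?s = "\<lambda>j. rupd ''thr'' 0 (w (xs ! j)) (iupd ''r'' 0 (int j) s1)"
    have wj: "reals s1 ''w'' (int (xs ! j)) = w (xs ! j)" if "j < length xs" for j
    proof -
      have "xs ! j \<in> cands s" using that xs s0 by auto
      then show ?thesis using s1 by (simp add: inp_simps cands_def)
    qed
    have "expf draw_candidate s1
        (\<lambda>t' s'. h (1 + (t + t')) (transfer_arrays [''cnt'', ''thr''] s' s))
      = (\<Sum>j<length xs. h (1 + (t + (1 + 1))) (transfer_arrays [''cnt'', ''thr''] (?s j) s)) / of_nat (length xs)"
      unfolding expf_Seq
      by (subst expf_Rand[OF pos]) (use xs wj in \<open>auto intro!: arg_cong2[of _ _ _ _ "(/)"] sum.cong\<close>)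
    also have "\<dots> \<le> (\<Sum>j<length xs. B (xs ! j)) / of_nat (length xs)"
    proof (intro divide_right_mono_ennreal sum_mono h)
      fix j assume "j \<in> {..<length xs}"
      then show "xs ! j \<in> cands s" using xs s0 by auto
    qed (use t xs pos in \<open>auto simp: agree_def\<close>)
    also have "(\<Sum>j<length xs. B (xs ! j)) = (\<Sum>v\<in>cands s. B v)"
      using xs s0 by (intro sum.reindex_bij_betw bij_betw_nth) auto
    finally show "expf draw_candidate s1
        (\<lambda>t' s'. h (1 + (t + t')) (transfer_arrays [''cnt'', ''thr''] s' s))
      \<le> (\<Sum>v\<in>cands s. B v) / of_nat (card (cands s))"
      unfolding len .
  qed
qed

definition search_inv :: "store \<Rightarrow> real \<Rightarrow> store \<Rightarrow> bool" where
  "search_inv s0 b s \<longleftrightarrow> agree (-{''best'', ''A'', ''i'', ''thr'', ''cnt'', ''lo'', ''g''}) s s0 \<and> good s \<and>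
    0 \<le> reals s ''lo'' 0 \<and> (best s \<le> real n * kappa \<or> reals s ''lo'' 0 < b)"

definition level_time :: "nat \<Rightarrow> real" where
  "level_time a = 2 + real (a * lg * (2 * lg + 1)) * (round_time lg + 2)"

lemma level_time_nonneg: "0 \<le> level_time a"
  unfolding level_time_def using round_time_nonneg[of lg] by simp

lemma expf_search:
  assumes s: "search_inv s0 b s" and s0: "inp s0" "ints s0 ''l'' 0 = int lg" "reals s0 ''cap'' 0 = 1"
      "reals s0 ''base'' 0 = 0"
    and b: "\<exists>C. vertex_cut V E C \<and> (\<forall>v\<in>C. w v \<le> b)" "b \<le> kappa" "b = 0 \<or> (\<exists>v<n. w v = b)"
    and a: "0 < a"
  shows "expf (search a k Q) s (fails (\<lambda>t s'.
      real t \<le> 2 + real (k * lg) * (level_time a + 5 * real n + 22) \<and>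
      search_inv s0 b s' \<and> best s' \<le> real n * kappa))
    \<le> ennreal ((3 / 4) ^ (k * lg) * real n + real (k * lg) * exp (- (real (a * lg) / 1024)))"
proof -
  define K where "K = k * lg"
  define f where "f = exp (- (real (a * lg) / 1024))"
  have f: "0 \<le> f" by (simp add: f_def)
  define tb where "tb = level_time a + 5 * real n + 20"
  define pot where "pot = (\<lambda>i c. (3 / 4) ^ (K - i) * real c + real (K - i) * f)"
  have pot_nonneg: "0 \<le> pot i c" for i c using f by (simp add: pot_def)
  define G where "G = (\<lambda>i s. min 1 (ennreal (pot i (card (cands s)))))"
  let ?I = "\<lambda>(k::nat) s. search_inv s0 b s"
  have inv: "inp s'" "ints s' ''l'' 0 = int lg" "reals s' ''cap'' 0 = 1" "reals s' ''base'' 0 = 0"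
    if "search_inv s0 b s'" for s'
    using that s0 inp_agree[of _ s' s0] by (auto simp: search_inv_def agree_def inp_def)
  have inv_g: "search_inv s0 b (iupd ''g'' 0 j s') \<longleftrightarrow> search_inv s0 b s'" for j s'
    by (simp add: search_inv_def good_upd)
  have cands_g: "cands (iupd x j i s') = cands s'" for x j i s'
    by (simp add: cands_def)
  have "expf (search a k Q) s (fails (\<lambda>t s'. real t \<le> 2 + real K * (tb + 2) \<and>
      search_inv s0 b s' \<and> best s' \<le> real n * kappa)) \<le> G 0 (iupd ''g'' 0 0 s)"
    unfolding search_def
  proof (rule expf_for_loop[where I = ?I and timed = True and tb = tb and K = K and G = G])
    show "search_inv s0 b (iupd ''g'' 0 0 s)" using s by (simp add: inv_g)
  next
    fix s' assume "search_inv s0 b s'"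
    then show "ieval (itimes k (iv ''l'')) s' = int K" using inv by (simp add: K_def)
  next
    fix t s' assume t: "True \<Longrightarrow> real t \<le> 2 + real K * (tb + 2)" and I: "search_inv s0 b s'"
    show "(if real t \<le> 2 + real K * (tb + 2) \<and> search_inv s0 b s' \<and> best s' \<le> real n * kappa
        then 0 else 1) \<le> G K s'"
    proof (cases "cands s' = {}")
      case True
      have "best s' \<le> real n * kappa"
      proof (rule ccontr)
        assume not: "\<not> ?thesis"
        then have lo: "reals s' ''lo'' 0 < b" "0 \<le> reals s' ''lo'' 0" using I by (auto simp: search_inv_def)
        then obtain v where v: "v < n" "w v = b" using b(3) by auto
        then have "\<not> real n * b < best s'" using True lo by (auto simp: cands_def)
        moreover have "real n * b \<le> real n * kappa" using b(2) by (intro mult_left_mono) auto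
        ultimately show False using not by simp
      qed
      then show ?thesis using t I by simp
    next
      case False
      then have "1 \<le> real (card (cands s'))" by (simp add: Suc_le_eq card_gt_0_iff)
      then have "1 \<le> ennreal (pot K (card (cands s')))" unfolding pot_def by simp
      then show ?thesis unfolding G_def by (auto simp: min_def)
    qed
  next
    fix i s' assume i: "i < K" and I: "search_inv s0 b s'" and g: "ints s' ''g'' 0 = int i"
    define H where "H = (\<lambda>t s''. if (True \<longrightarrow> real t \<le> tb) \<and> ints s'' ''g'' 0 = int i \<and>
        search_inv s0 b (iupd ''g'' 0 (int (Suc i)) s'')
        then G (Suc i) (iupd ''g'' 0 (int (Suc i)) s'') else 1)"
    have h1: "H t s'' \<le> 1" for t s'' by (simp add: H_def G_def)
    have h: "H t s'' \<le> ennreal (pot (Suc i) c)"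
      if "real t \<le> tb" "agree (-{''best'', ''A'', ''i'', ''thr'', ''cnt'', ''lo''}) s'' s'" "search_inv s0 b s''"
        "card (cands s'') \<le> c" for t s'' c
    proof -
      have "ints s'' ''g'' 0 = int i" using that(2) g by (simp add: agree_def)
      then have "H t s'' = G (Suc i) s''" using that by (simp add: H_def inv_g G_def cands_g)
      also have "\<dots> \<le> ennreal (pot (Suc i) (card (cands s'')))" by (simp add: G_def)
      also have "\<dots> \<le> ennreal (pot (Suc i) c)"
        using that(4) unfolding pot_def by (intro ennreal_leI add_right_mono mult_left_mono) auto
      finally show ?thesis .
    qed
    have Ki: "K - i = Suc (K - Suc i)" using i by simp
    have "expf (search_step a Q) s' H \<le> ennreal (pot i (card (cands s')))"
    proof (cases "cands s' = {}")
      case True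
      have "expf (search_step a Q) s' H \<le> ennreal (pot (Suc i) 0)"
        unfolding search_step_def expf_Seq[of pick]
      proof (rule expf_AS_le[OF AS_pick_empty[OF inv(1)[OF I] True]], elim conjE)
        fix t s1
        assume t: "t \<le> 5 * n + 10" and ag: "agree (-{''cnt'', ''thr''}) s1 s'" and c: "ints s1 ''cnt'' 0 = 0"
        have eq: "reals s1 ''lo'' = reals s' ''lo''" "reals s1 ''best'' = reals s' ''best''"
          "ints s1 ''A'' = ints s' ''A''" using ag by (simp_all add: agree_def)
        have tt: "real (t + (1 + 1)) \<le> tb" using t level_time_nonneg[of a] by (simp add: tb_def)
        have ag': "agree (-{''best'', ''A'', ''i'', ''thr'', ''cnt'', ''lo''}) s1 s'"
          using ag by (auto simp: agree_def)
        have "agree (-{''best'', ''A'', ''i'', ''thr'', ''cnt'', ''lo'', ''g''}) s1 s'"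
          using ag by (auto simp: agree_def)
        then have I1: "search_inv s0 b s1"
          using I eq by (auto simp: search_inv_def good_def aset_def intro: agree_trans)
        have "card (cands s1) \<le> 0" using True eq by (simp add: cands_def)
        from h[OF tt ag' I1 this] show "expf (If (ILess (N 0) (iv ''cnt''))
            (Seq (find_level a Q) raise_lo) Skip) s1 (\<lambda>t'. H (t + t')) \<le> ennreal (pot (Suc i) 0)"
          using c by simp
      qed
      also have "\<dots> \<le> ennreal (pot i (card (cands s')))"
      proof (rule ennreal_leI)
        have "real (K - Suc i) * f \<le> real (K - i) * f" using f by (intro mult_right_mono) auto
        then show "pot (Suc i) 0 \<le> pot i (card (cands s'))" unfolding True pot_def by simp
      qed
      finally show ?thesis .
    next
      case False
      define c where "c = card (cands s')"
      have c: "0 < c" using False by (simp add: c_def card_gt_0_iff)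
      let ?m = "\<lambda>v. max (card {u\<in>cands s'. w u < w v}) (card {u\<in>cands s'. w v < w u})"
      define B where "B = (\<lambda>v. ennreal (f + pot (Suc i) (?m v)))"
      have "expf (search_step a Q) s' H \<le> (\<Sum>v\<in>cands s'. B v) / of_nat (card (cands s'))"
        unfolding search_step_def expf_Seq[of pick]
      proof (rule expf_pick[OF inv(1)[OF I] False])
        fix v t s1
        assume v: "v \<in> cands s'" and t: "t \<le> 5 * n + 10" and ag: "agree (-{''cnt'', ''thr''}) s1 s'"
          and cnt: "0 < ints s1 ''cnt'' 0" and thr: "reals s1 ''thr'' 0 = w v"
        have vn: "v < n" "0 \<le> w v" "0 \<le> reals s' ''lo'' 0" using v w_pos[of v] I
          by (auto simp: cands_def search_inv_def intro: less_imp_le)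
        have eq: "reals s1 ''lo'' = reals s' ''lo''" "reals s1 ''best'' = reals s' ''best''"
          "ints s1 ''A'' = ints s' ''A''" using ag by (simp_all add: agree_def)
        have "good s' = good s1" using eq by (simp add: good_def aset_def)
        then have good1: "good s1" using I by (simp add: search_inv_def)
        have in1: "inp s1" "ints s1 ''l'' 0 = int lg" "reals s1 ''cap'' 0 = 1" "reals s1 ''base'' 0 = 0"
          using inv[OF I] ag by (auto simp: inp_def agree_def)
        let ?P = "\<lambda>t s2. real t \<le> level_time a \<and> agree (-{''best'', ''A'', ''i''}) s2 s1 \<and> good s2 \<and>
          best s2 \<le> best s1 \<and>
          ((\<exists>C. vertex_cut V E C \<and> (\<forall>u\<in>C. w u \<le> w v)) \<longrightarrow> best s2 \<le> real n * w v)"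
        
        have "expf (find_level a Q) s1 (\<lambda>t' s2. expf raise_lo s2 (\<lambda>t''. H (t + (1 + (t' + t'')))))
          \<le> expf (find_level a Q) s1 (fails ?P) + ennreal (pot (Suc i) (?m v))"
        proof (rule expf_le_add)
          fix t' s2 show "expf raise_lo s2 (\<lambda>t''. H (t + (1 + (t' + t'')))) \<le> 1"
            by (rule expf_le_1) (rule h1)
        next
          fix t' s2 assume P: "?P t' s2"
          have ag2: "agree (-{''best'', ''A'', ''i'', ''thr'', ''cnt'', ''lo''}) s2 s'"
            using P ag by (auto simp: agree_def)
          have ag3: "agree (-{''best'', ''A'', ''i'', ''thr'', ''cnt'', ''lo'', ''g''}) s2 s0"
            using ag2 I by (auto simp: agree_def search_inv_def)
          have s2: "inp s2" "reals s2 ''thr'' 0 = w v" "reals s2 ''lo'' 0 = reals s' ''lo'' 0"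
            "best s2 \<le> best s'"
            using P in1 thr eq by (auto simp: agree_def inp_def)
          have tt: "real (t + (1 + (t' + (1 + 1)))) \<le> tb" using t P by (simp add: tb_def)
          show "expf raise_lo s2 (\<lambda>t''. H (t + (1 + (t' + t'')))) \<le> ennreal (pot (Suc i) (?m v))"
          proof (cases "real n * w v < best s2")
            case True
            let ?s3 = "rupd ''lo'' 0 (w v) s2"
            have "w v < b \<or> best s2 \<le> real n * kappa"
              using P True b(1) by (meson not_le order_trans)
            then have "search_inv s0 b ?s3"
              using ag3 P vn by (auto simp: search_inv_def good_upd)
            moreover have "card (cands ?s3) \<le> ?m v"
            proof -
              have "cands ?s3 \<subseteq> {u\<in>cands s'. w v < w u}"
                using s2 v by (auto simp: cands_def)
              then have "card (cands ?s3) \<le> card {u\<in>cands s'. w v < w u}" by (intro card_mono) auto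
              then show ?thesis by simp
            qed
            moreover have "agree (-{''best'', ''A'', ''i'', ''thr'', ''cnt'', ''lo''}) ?s3 s'" using ag2 by simp
            ultimately have "H (t + (1 + (t' + (1 + 1)))) ?s3 \<le> ennreal (pot (Suc i) (?m v))"
              using tt by (intro h)
            then show ?thesis using True s2 by (simp add: inp_simps)
          next
            case False
            have "search_inv s0 b s2"
              using ag3 P I s2 by (auto simp: search_inv_def intro: order_trans)
            moreover have "card (cands s2) \<le> ?m v"
            proof -
              have "cands s2 \<subseteq> {u\<in>cands s'. w u < w v}"
              proof
                fix u assume u: "u \<in> cands s2"
                then have "real n * w u < best s2" by (simp add: cands_def)
                also have "\<dots> \<le> real n * w v" using False by (simp only: not_less)
                finally have "w u < w v" by (rule mult_left_less_imp_less) simp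
                then show "u \<in> {u\<in>cands s'. w u < w v}" using u s2 by (auto simp: cands_def)
              qed
              then have "card (cands s2) \<le> card {u\<in>cands s'. w u < w v}" by (intro card_mono) auto
              then show ?thesis by simp
            qed
            ultimately have "H (t + (1 + (t' + (1 + 1)))) s2 \<le> ennreal (pot (Suc i) (?m v))"
              using tt ag2 by (intro h)
            then show ?thesis using False s2 by (simp add: inp_simps)
          qed
        qed
        also have "\<dots> \<le> ennreal f + ennreal (pot (Suc i) (?m v))"
          using find_level_fails[OF in1(1,2) n_le_lg good1 thr vn(2) in1(3,4) a lg_pos]
          unfolding f_def level_time_def by (intro add_right_mono)
        also have "\<dots> = B v" unfolding B_def using f pot_nonneg by simp
        finally show "expf (If (ILess (N 0) (iv ''cnt'')) (Seq (find_level a Q) raise_lo) Skip) s1 (\<lambda>t'. H (t + t')) \<le> B v"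
          using cnt by simp
      qed
      also have "\<dots> \<le> ennreal (pot i (card (cands s')))"
      proof -
        have "(\<Sum>v\<in>cands s'. B v) / of_nat c = ennreal ((\<Sum>v\<in>cands s'. f + pot (Suc i) (?m v)) / real c)"
          unfolding B_def using f pot_nonneg c
          by (subst sum_ennreal) (auto simp: ennreal_of_nat_eq_real_of_nat divide_ennreal sum_nonneg)
        also have "\<dots> \<le> ennreal (pot i c)"
        proof (rule ennreal_leI)
          let ?q = "(3 / 4 :: real) ^ (K - Suc i)"
          have "(\<Sum>v\<in>cands s'. f + pot (Suc i) (?m v))
              = real c * f + ?q * (\<Sum>v\<in>cands s'. real (?m v)) + real c * (real (K - Suc i) * f)"
            by (simp add: pot_def sum.distrib sum_distrib_left c_def del: of_nat_max)
          also have "\<dots> \<le> real c * f + ?q * (3 / 4 * (real c)\<^sup>2) + real c * (real (K - Suc i) * f)"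
            using sum_max_rank[of "cands s'" w] by (intro add_mono mult_left_mono) (auto simp: c_def)
          also have "\<dots> = real c * pot i c"
            unfolding pot_def Ki by (simp add: power2_eq_square algebra_simps)
          finally show "(\<Sum>v\<in>cands s'. f + pot (Suc i) (?m v)) / real c \<le> pot i c"
            using c by (simp add: divide_le_eq mult.commute)
        qed
        finally show ?thesis unfolding c_def .
      qed
      finally show ?thesis .
    qed
    moreover have "expf (search_step a Q) s' H \<le> 1" by (rule expf_le_1) (rule h1)
    ultimately have "expf (search_step a Q) s' H \<le> G i s'" unfolding G_def by simp
    then show "expf (search_step a Q) s' (\<lambda>t s''. if (True \<longrightarrow> real t \<le> tb) \<and> ints s'' ''g'' 0 = int i \<and>
        search_inv s0 b (iupd ''g'' 0 (int (Suc i)) s'')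
        then G (Suc i) (iupd ''g'' 0 (int (Suc i)) s'') else 1) \<le> G i s'"
      unfolding H_def .
  qed simp
  also have "\<dots> \<le> ennreal (pot 0 n)"
  proof -
    have "card (cands s) \<le> card V" by (rule card_mono) (auto simp: cands_def)
    then have "pot 0 (card (cands s)) \<le> pot 0 n"
      unfolding pot_def by (intro add_right_mono mult_left_mono) auto
    then show ?thesis unfolding G_def cands_g by (intro min.coboundedI2 ennreal_leI)
  qed
  finally show ?thesis unfolding pot_def K_def f_def tb_def by (simp add: add.assoc)
qed

end

section \<open>The algorithm\<close>

definition vertex_cut_prog :: "nat \<Rightarrow> nat \<Rightarrow> com \<Rightarrow> com" where
  "vertex_cut_prog a k Q =
    Seq (Seq (Call [''n'', ''m'', ''src'', ''dst'', ''w''] init_body [''W'', ''l'', ''best'', ''A''])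
      (RSet ''cap'' (N 0) (OfInt (N 1))))
    (Seq (find_level a Q)
    (Seq (search a k Q)
    (Seq (Seq (RSet ''base'' (N 0) (OfInt (N 1)))
      (If (RLess (rv ''eps'') (OfInt (N 1)))
        (RSet ''ie'' (N 0) (RDiv (OfInt (N 1)) (rv ''eps''))) (RSet ''ie'' (N 0) (OfInt (N 1)))))
    (Seq (refine a Q)
      (for_loop ''v'' (iv ''n'') (ISet ''C'' (iv ''v'') (IVal ''A'' (iv ''v''))))))))"

lemma expf_Seq_fails:
  assumes "expf c s (fails P) \<le> ennreal a" "0 \<le> a" "0 \<le> b"
    and "\<And>t s'. P t s' \<Longrightarrow> expf d s' (\<lambda>t' s''. fails R (t + t') s'') \<le> ennreal b"
  shows "expf (Seq c d) s (fails R) \<le> ennreal (a + b)"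
proof -
  have "expf (Seq c d) s (fails R) = expf c s (\<lambda>t s'. expf d s' (\<lambda>t' s''. fails R (t + t') s''))"
    by simp
  also have "\<dots> \<le> expf c s (fails P) + ennreal b"
    using assms(4) by (intro expf_le_add expf_le_1) auto
  also have "\<dots> \<le> ennreal a + ennreal b" using assms(1) by (rule add_right_mono)
  also have "\<dots> = ennreal (a + b)" using assms by simp
  finally show ?thesis .
qed

lemma expf_fails_shift:
  assumes "expf c s (fails P) \<le> e" "\<And>t s'. P t s' \<Longrightarrow> R t s'"
  shows "expf c s (fails R) \<le> e"
  using assms(1) by (rule order_trans[rotated], intro expf_mono fails_mono assms(2))

lemma AS_fails: "AS c s P \<Longrightarrow> expf c s (fails P) \<le> ennreal 0"
  by (simp add: AS_iff_expf)

context oracle_graph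
begin

definition total_time :: "nat \<Rightarrow> nat \<Rightarrow> real \<Rightarrow> real" where
  "total_time a k e = (50 * real size_in + 60) + level_time a +
     (2 + real (k * lg) * (level_time a + 5 * real n + 22)) + 10 +
     (2 + (2 * refine_bound a lg e kappa + 1) * (round_time lg + 5)) + (2 + 3 * real n)"

lemma vertex_cut_prog_fails:
  assumes eps: "0 < \<epsilon>" and e: "e = max 1 (1 / \<epsilon>)" and a: "0 < a"
  shows "expf (vertex_cut_prog a k Q) (cut_store n es w \<epsilon>)
    (fails (\<lambda>t s'. real t \<le> total_time a k e \<and> approx_min_vertex_cut V E w \<epsilon> (output_set n s')))
    \<le> ennreal (exp (- (real (a * lg) / 1024)) + ((3 / 4) ^ (k * lg) * real n +
        real (k * lg) * exp (- (real (a * lg) / 1024)) + exp (- (real (a * lg) / 1024))))"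
proof -
  define f where "f = exp (- (real (a * lg) / 1024))"
  define f2 where "f2 = (3 / 4) ^ (k * lg) * real n + real (k * lg) * f"
  have f: "0 \<le> f" "0 \<le> f2" by (simp_all add: f_def f2_def)
  define s where "s = cut_store n es w \<epsilon>"
  have s: "inp s" "reals s ''eps'' 0 = \<epsilon>" "reals s ''thr'' 0 = 0" "reals s ''base'' 0 = 0" "reals s ''lo'' 0 = 0"
    by (simp_all add: s_def inp_def agree_def cut_store_def graph_store_def arr_def)
  let ?init = "Seq (Call [''n'', ''m'', ''src'', ''dst'', ''w''] init_body [''W'', ''l'', ''best'', ''A''])
      (RSet ''cap'' (N 0) (OfInt (N 1)))"
  let ?scale = "Seq (RSet ''base'' (N 0) (OfInt (N 1)))
      (If (RLess (rv ''eps'') (OfInt (N 1)))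
        (RSet ''ie'' (N 0) (RDiv (OfInt (N 1)) (rv ''eps''))) (RSet ''ie'' (N 0) (OfInt (N 1))))"
  let ?copy = "for_loop ''v'' (iv ''n'') (ISet ''C'' (iv ''v'') (IVal ''A'' (iv ''v'')))"

  obtain C where C: "vertex_cut V E C" "sum w C = kappa" by (rule kappa_attained)
  have CV: "C \<subseteq> V" "finite C" using C by (auto simp: vertex_cut_def intro: finite_subset[of _ V])
  define b where "b = Max (insert 0 (w ` C))"
  have b1: "\<exists>C. vertex_cut V E C \<and> (\<forall>v\<in>C. w v \<le> b)"
    using C(1) CV by (intro exI[of _ C]) (simp add: b_def)
  have b3: "b = 0 \<or> (\<exists>v<n. w v = b)"
  proof -
    have "b \<in> insert 0 (w ` C)" unfolding b_def using CV by (intro Max_in) auto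
    then show ?thesis using CV by auto
  qed
  have b2: "b \<le> kappa"
  proof -
    have "w v \<le> sum w C" if "v \<in> C" for v
    proof (rule member_le_sum[OF that _ CV(2)])
      fix x assume "x \<in> C - {v}"
      then show "0 \<le> w x" using CV by (intro less_imp_le w_pos) auto
    qed
    then show ?thesis unfolding b_def using CV kappa_nonneg C by auto
  qed

  let ?P1 = "\<lambda>t s'. real t \<le> 50 * real size_in + 60 \<and> agree (-{''W'', ''l'', ''best'', ''A'', ''cap''}) s' s \<and> inp s' \<and>
    good s' \<and> ints s' ''l'' 0 = int lg \<and> reals s' ''W'' 0 = W \<and> reals s' ''cap'' 0 = 1"
  have init: "expf ?init s (fails ?P1) \<le> ennreal 0"
  proof (rule AS_fails)
    define s0 where "s0 = transfer_arrays [''n'', ''m'', ''src'', ''dst'', ''w''] s zero_store"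
    have s0: "inp s0" "ints s0 ''l'' 0 = 0" "ints s0 ''A'' = (\<lambda>_. 0)" "reals s0 ''d'' = (\<lambda>_. 0)"
      "reals s0 ''W'' 0 = 0" using s by (simp_all add: s0_def fun_eq_iff)
    show "AS ?init s ?P1"
      unfolding AS_Seq AS_Call s0_def[symmetric]
    proof (rule AS_mono[OF AS_init_body[OF s0]], elim conjE)
      fix t s1
      assume "t \<le> 50 * size_in + 50" "good s1" "ints s1 ''l'' 0 = int lg" "reals s1 ''W'' 0 = W"
      then show "AS (RSet ''cap'' (N 0) (OfInt (N 1))) (transfer_arrays [''W'', ''l'', ''best'', ''A''] s1 s) (\<lambda>t'. ?P1 (1 + t + t'))"
        using s by (simp add: good_upd) (auto simp: agree_def good_def aset_def)
    qed
  qed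
  let ?P2 = "\<lambda>t s'. real t \<le> level_time a \<and> agree (-{''W'', ''l'', ''best'', ''A'', ''cap'', ''i''}) s' s \<and> inp s' \<and>
    search_inv s' b s' \<and> ints s' ''l'' 0 = int lg \<and> reals s' ''W'' 0 = W \<and> reals s' ''cap'' 0 = 1"
  have level: "expf (find_level a Q) s1 (fails ?P2) \<le> ennreal f" if "?P1 t s1" for t s1
  proof -
    have s1: "inp s1" "good s1" "ints s1 ''l'' 0 = int lg" "reals s1 ''thr'' 0 = 0" "reals s1 ''cap'' 0 = 1"
      "reals s1 ''base'' 0 = 0" "reals s1 ''lo'' 0 = 0" "agree (-{''W'', ''l'', ''best'', ''A'', ''cap''}) s1 s"
      using that s by (auto simp: agree_def)
    have "expf (find_level a Q) s1 (fails (\<lambda>t s'. real t \<le> 2 + real (a * lg * (2 * lg + 1)) * (round_time lg + 2) \<and>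
      agree (-{''best'', ''A'', ''i''}) s' s1 \<and> good s' \<and> best s' \<le> best s1 \<and>
      ((\<exists>C. vertex_cut V E C \<and> (\<forall>v\<in>C. w v \<le> 0)) \<longrightarrow> best s' \<le> real n * 0))) \<le> ennreal f"
      unfolding f_def by (rule find_level_fails[OF s1(1,3) n_le_lg s1(2,4) order_refl s1(5,6) a lg_pos])
    then show ?thesis
    proof (rule expf_fails_shift, elim conjE)
      fix t s'
      assume t: "real t \<le> 2 + real (a * lg * (2 * lg + 1)) * (round_time lg + 2)"
        and ag: "agree (-{''best'', ''A'', ''i''}) s' s1" and g: "good s'"
        and z: "(\<exists>C. vertex_cut V E C \<and> (\<forall>v\<in>C. w v \<le> 0)) \<longrightarrow> best s' \<le> real n * 0"
      have "best s' \<le> real n * kappa \<or> 0 < b"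
      proof (cases "b \<le> 0")
        case True
        then have "\<exists>C. vertex_cut V E C \<and> (\<forall>v\<in>C. w v \<le> 0)" using b1 by (meson order_trans)
        then have "best s' \<le> 0" using z by simp
        also have "0 \<le> real n * kappa" using kappa_nonneg by simp
        finally show ?thesis ..
      qed simp
      moreover have "reals s' ''lo'' 0 = 0" using ag s1 by (simp add: agree_def)
      ultimately have "search_inv s' b s'" using g by (simp add: search_inv_def)
      moreover have "agree (-{''W'', ''l'', ''best'', ''A'', ''cap'', ''i''}) s' s" "inp s'"
        using ag s1 by (auto simp: agree_def inp_def)
      ultimately show "?P2 t s'"
        using t ag that by (auto simp: level_time_def agree_def)
    qed
  qed
  let ?P3 = "\<lambda>t s'. real t \<le> 2 + real (k * lg) * (level_time a + 5 * real n + 22) \<and> inp s' \<and> good s' \<and>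
    best s' \<le> real n * kappa \<and> ints s' ''l'' 0 = int lg \<and> reals s' ''W'' 0 = W \<and> reals s' ''eps'' 0 = \<epsilon>"
  have search: "expf (search a k Q) s2 (fails ?P3) \<le> ennreal f2" if "?P2 t s2" for t s2
  proof -
    have s2: "inp s2" "ints s2 ''l'' 0 = int lg" "reals s2 ''cap'' 0 = 1" "reals s2 ''base'' 0 = 0"
      "reals s2 ''eps'' 0 = \<epsilon>" "search_inv s2 b s2"
      using that s by (auto simp: agree_def)
    show ?thesis
      using expf_search[OF s2(6) s2(1-4) b1 b2 b3 a, of k] unfolding f2_def f_def
    proof (rule expf_fails_shift, elim conjE)
      fix t s'
      assume t: "real t \<le> 2 + real (k * lg) * (level_time a + 5 * real n + 22)"
        and i: "search_inv s2 b s'" "best s' \<le> real n * kappa"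
      have "inp s'" using i(1) s2(1) by (auto simp: search_inv_def agree_def inp_def)
      then show "?P3 t s'" using t i s2 that by (auto simp: search_inv_def agree_def)
    qed
  qed
  let ?P4 = "\<lambda>t s'. real t \<le> 10 \<and> refine_inv lg e s'"
  have scale: "expf ?scale s3 (fails ?P4) \<le> ennreal 0" if "?P3 t s3" for t s3
    by (rule AS_fails) (use that eps e in \<open>auto simp: refine_inv_def good_upd max_def\<close>)
  let ?P5 = "\<lambda>t s'. real t \<le> 2 + (2 * refine_bound a lg e kappa + 1) * (round_time lg + 5) \<and>
      refine_inv lg e s' \<and> best s' \<le> (1 + 1 / e) * kappa"
  have refine: "expf (refine a Q) s4 (fails ?P5) \<le> ennreal f" if "?P4 t s4" for t s4
    unfolding f_def using that e by (intro refine_fails n_le_lg lg_pos a) auto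
  let ?P6 = "\<lambda>t s'. real t \<le> 2 + 3 * real n \<and> approx_min_vertex_cut V E w \<epsilon> (output_set n s')"
  have copy: "expf ?copy s5 (fails ?P6) \<le> ennreal 0" if "?P5 t s5" for t s5
  proof (rule AS_fails)
    have s5: "inp s5" "good s5" using that by (auto simp: refine_inv_def)
    have "sum w (aset s5) \<le> (1 + 1 / e) * kappa" using that s5 by (simp add: good_def)
    also have "\<dots> \<le> (1 + \<epsilon>) * kappa"
      using eps kappa_nonneg by (intro mult_right_mono) (auto simp: e max_def divide_le_eq)
    finally have apx: "approx_min_vertex_cut V E w \<epsilon> (aset s5)"
      using s5 by (simp add: approx_min_vertex_cut_def good_def)
    show "AS ?copy s5 ?P6"
    proof (rule AS_for_loop[where tb = 1 and K = n and I = "\<lambda>k s'. inp s' \<and> aset s' = aset s5 \<and>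
        (\<forall>v<k. ints s' ''C'' (int v) = ints s' ''A'' (int v))"], goal_cases)
      case 1 show ?case using s5 by (simp add: aset_def)
    next
      case (2 k s') then show ?case by (simp add: inp_simps)
    next
      case (3 k s') then show ?case by (simp add: aset_def less_Suc_eq)
    next
      case (4 t s')
      then have "output_set n s' = aset s5" by (auto simp: output_set_def aset_def)
      then show ?case using 4 apx by simp
    qed
  qed
  let ?ok = "\<lambda>\<tau> t s'. real t \<le> \<tau> \<and> approx_min_vertex_cut V E w \<epsilon> (output_set n s')"
  let ?\<tau>5 = "2 + (2 * refine_bound a lg e kappa + 1) * (round_time lg + 5) + (2 + 3 * real n)"
  let ?\<tau>3 = "2 + real (k * lg) * (level_time a + 5 * real n + 22) + (10 + ?\<tau>5)"
  have 5: "expf (Seq (refine a Q) ?copy) s4 (fails (?ok ?\<tau>5)) \<le> ennreal (f + 0)" if "?P4 t s4" for t s4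
  proof (rule expf_Seq_fails[OF refine[OF that] f(1) order_refl])
    fix t s' assume P: "?P5 t s'"
    show "expf ?copy s' (\<lambda>t' s''. fails (?ok ?\<tau>5) (t + t') s'') \<le> ennreal 0"
      using copy[OF P] by (rule expf_fails_shift) (use P in auto)
  qed
  have 4: "expf (Seq ?scale (Seq (refine a Q) ?copy)) s3 (fails (?ok (10 + ?\<tau>5))) \<le> ennreal (0 + (f + 0))"
    if "?P3 t s3" for t s3
  proof (rule expf_Seq_fails[OF scale[OF that] order_refl])
    fix t s' assume P: "?P4 t s'"
    show "expf (Seq (refine a Q) ?copy) s' (\<lambda>t' s''. fails (?ok (10 + ?\<tau>5)) (t + t') s'') \<le> ennreal (f + 0)"
      using 5[OF P] by (rule expf_fails_shift) (use P in auto)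
  qed (use f in simp)
  have 3: "expf (Seq (search a k Q) (Seq ?scale (Seq (refine a Q) ?copy))) s2 (fails (?ok ?\<tau>3))
      \<le> ennreal (f2 + (0 + (f + 0)))" if "?P2 t s2" for t s2
  proof (rule expf_Seq_fails[OF search[OF that] f(2)])
    fix t s' assume P: "?P3 t s'"
    show "expf (Seq ?scale (Seq (refine a Q) ?copy)) s' (\<lambda>t' s''. fails (?ok ?\<tau>3) (t + t') s'')
        \<le> ennreal (0 + (f + 0))"
      using 4[OF P] by (rule expf_fails_shift) (use P in auto)
  qed (use f in simp)
  have 2: "expf (Seq (find_level a Q) (Seq (search a k Q) (Seq ?scale (Seq (refine a Q) ?copy)))) s1
      (fails (?ok (level_time a + ?\<tau>3))) \<le> ennreal (f + (f2 + (0 + (f + 0))))" if "?P1 t s1" for t s1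
  proof (rule expf_Seq_fails[OF level[OF that] f(1)])
    fix t s' assume P: "?P2 t s'"
    show "expf (Seq (search a k Q) (Seq ?scale (Seq (refine a Q) ?copy))) s'
        (\<lambda>t' s''. fails (?ok (level_time a + ?\<tau>3)) (t + t') s'') \<le> ennreal (f2 + (0 + (f + 0)))"
      using 3[OF P] by (rule expf_fails_shift) (use P in auto)
  qed (use f in simp)
  have 1: "expf (vertex_cut_prog a k Q) s (fails (?ok (total_time a k e))) \<le> ennreal (0 + (f + (f2 + (0 + (f + 0)))))"
    unfolding vertex_cut_prog_def
  proof (rule expf_Seq_fails[OF init order_refl])
    fix t s' assume P: "?P1 t s'"
    show "expf (Seq (find_level a Q) (Seq (search a k Q) (Seq ?scale (Seq (refine a Q) ?copy)))) s'
        (\<lambda>t' s''. fails (?ok (total_time a k e)) (t + t') s'') \<le> ennreal (f + (f2 + (0 + (f + 0))))"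
      using 2[OF P] by (rule expf_fails_shift) (use P in \<open>auto simp: total_time_def\<close>)
  qed (use f in simp)
  then show ?thesis by (simp add: s_def f_def f2_def add_ac)
qed

end

lemma le_mult_factor: "0 \<le> z \<Longrightarrow> 1 \<le> m \<Longrightarrow> z \<le> z * (m::real)"
  using mult_left_mono[of 1 m z] by simp

context oracle_graph
begin

lemma exp_lg_le: "exp (- (real (A * lg))) \<le> (1 / real n) ^ A"
proof -
  have "exp (- 1 :: real) \<le> 1 / 2" using exp_ge_add_one_self[of 1] by (simp add: exp_minus field_simps)
  then have "exp (- 1 :: real) ^ (lg * A) \<le> (1 / 2) ^ (lg * A)" by (rule power_mono) simp
  also have "\<dots> = (1 / 2 ^ lg) ^ A" by (simp add: power_mult power_one_over)
  also have "\<dots> \<le> (1 / real n) ^ A"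
  proof (intro power_mono divide_left_mono)
    show "real n \<le> 2 ^ lg" using n_le_lg by (metis of_nat_le_iff of_nat_numeral of_nat_power)
  qed (use n_ge_2 in auto)
  finally show ?thesis by (simp add: exp_of_nat_mult[symmetric] mult.commute)
qed

lemma failure_le:
  assumes k: "k = 3 * (c + 3)" and A: "A = c + k + 4"
  shows "exp (- (real (1024 * A * lg) / 1024)) + ((3 / 4) ^ (k * lg) * real n +
      real (k * lg) * exp (- (real (1024 * A * lg) / 1024)) + exp (- (real (1024 * A * lg) / 1024)))
    \<le> 1 / real n ^ c"
proof -
  define y where "y = 1 / real n"
  have n: "2 \<le> real n" using n_ge_2 by simp
  have y: "0 < y" "y \<le> 1 / 2" "real n * y = 1" using n by (simp_all add: y_def field_simps)
  define f where "f = exp (- (real (1024 * A * lg) / 1024))"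
  have "f = exp (- (real (A * lg)))" by (simp add: f_def)
  then have f: "f \<le> y ^ A" using exp_lg_le unfolding y_def by simp
  have q: "(3 / 4 :: real) ^ (k * lg) \<le> y ^ (c + 3)"
  proof -
    have "(3 / 4 :: real) ^ (k * lg) = ((3 / 4) ^ 3) ^ (lg * (c + 3))"
      unfolding k power_mult[symmetric] by (simp add: mult_ac)
    also have "\<dots> \<le> (1 / 2) ^ (lg * (c + 3))" by (intro power_mono) (auto simp: power3_eq_cube)
    also have "\<dots> = (1 / 2 ^ lg) ^ (c + 3)" by (simp only: power_mult power_one_over)
    also have "\<dots> \<le> y ^ (c + 3)"
      unfolding y_def
    proof (intro power_mono divide_left_mono)
      show "real n \<le> 2 ^ lg" using n_le_lg by (metis of_nat_le_iff of_nat_numeral of_nat_power)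
    qed (use n in auto)
    finally show ?thesis .
  qed
  have "f + ((3 / 4) ^ (k * lg) * real n + real (k * lg) * f + f) = (3 / 4) ^ (k * lg) * real n + (real (k * lg) + 2) * f"
    by (simp add: algebra_simps)
  also have "\<dots> \<le> y ^ (c + 3) * real n + ((real k + 2) * real n) * y ^ A"
  proof (intro add_mono mult_right_mono mult_mono q f)
    have "real k * real lg \<le> real k * real n" using lg_le_n by (intro mult_left_mono) auto
    then show "real (k * lg) + 2 \<le> (real k + 2) * real n" using n by (simp add: algebra_simps)
  qed (use n y in \<open>auto simp: f_def\<close>)
  also have "\<dots> = (real n * y) * y ^ c * y ^ 2 + (real k + 2) * (real n * y) * y ^ c * y ^ (k + 3)"
    by (simp add: A power_add power2_eq_square numeral_eq_Suc mult_ac)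
  also have "\<dots> = y ^ c * (y ^ 2 + (real k + 2) * y ^ (k + 3))"
    unfolding y(3) by (simp add: algebra_simps)
  also have "\<dots> \<le> y ^ c * 1"
  proof (rule mult_left_mono)
    have "y ^ 2 \<le> (1 / 2) ^ 2" "y ^ (k + 3) \<le> (1 / 2) ^ (k + 3)" using y by (auto intro!: power_mono)
    moreover have "(real k + 2) * (1 / 2) ^ (k + 3) \<le> 1 / 2"
    proof -
      have "real (k + 2) \<le> 2 ^ (k + 2)"
        using less_exp[of "k + 2"] by (metis less_imp_le of_nat_le_iff of_nat_numeral of_nat_power)
      then show ?thesis by (simp add: power_one_over power_add field_simps)
    qed
    moreover have "(real k + 2) * y ^ (k + 3) \<le> (real k + 2) * (1 / 2) ^ (k + 3)"
      using \<open>y ^ (k + 3) \<le> _\<close> by (intro mult_left_mono) auto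
    moreover have "(1 / 2 :: real) ^ 2 = 1 / 4" by (simp add: power2_eq_square)
    ultimately show "y ^ 2 + (real k + 2) * y ^ (k + 3) \<le> 1" by linarith
  qed (use y in simp)
  also have "\<dots> = 1 / real n ^ c" by (simp add: y_def power_one_over)
  finally show ?thesis unfolding f_def .
qed

lemma total_time_le:
  assumes e: "1 \<le> e" and a: "0 < a" and k: "0 < k"
  shows "total_time a k e \<le>
    20 * (real a * real k * real lg ^ 3 * (e * min e (W / (W - kappa))) * ((1 + 100 / \<delta>) * T (card E) n))"
proof -
  define S where "S = real size_in"
  define L where "L = real lg"
  define x where "x = e * min e (W / (W - kappa))"
  define \<tau> where "\<tau> = (1 + 100 / \<delta>) * T (card E) n"
  define al where "al = real a"
  define kl where "kl = real k"
  have L: "1 \<le> L" "L \<le> S" "real n \<le> S" "2 \<le> S"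
    using lg_pos lg_le_n n_ge_2 by (simp_all add: L_def S_def)
  have ak: "1 \<le> al" "1 \<le> kl" using a k by (simp_all add: al_def kl_def)
  have x: "1 \<le> x"
  proof -
    have "1 * 1 \<le> e * min e (W / (W - kappa))"
      using e W_ratio(1)[OF order_refl kappa_less_W] by (intro mult_mono) auto
    then show ?thesis by (simp add: x_def)
  qed
  have "\<delta> * S \<le> T (card E) n"
    using reads_input(2)[of "card E" n] by (simp add: S_def length_es add.commute)
  then have "100 * S \<le> 100 / \<delta> * T (card E) n" using reads_input(1) by (simp add: field_simps)
  then have T: "T (card E) n + 100 * S \<le> \<tau>" by (simp add: \<tau>_def distrib_right)
  then have \<tau>S: "100 * S \<le> \<tau>" using T_nonneg[of "card E" n] by simp
  have tr: "round_time lg + 5 \<le> \<tau>"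
    using T L unfolding round_time_def S_def[symmetric] L_def[symmetric] by simp
  have \<tau>0: "0 \<le> \<tau>" "200 \<le> \<tau>" using \<tau>S L by simp_all
  define Y where "Y = al * kl * L ^ 3 * x * \<tau>"
  define NB where "NB = real (a * lg * (2 * lg + 1))"
  have LL: "1 \<le> L * L" "1 \<le> L * L * L" using L mult_mono[of 1 L 1 L] mult_mono[of 1 "L * L" 1 L] by auto
  have NB: "0 \<le> NB" "NB \<le> 3 * (al * (L * L))"
  proof -
    have "NB = al * (L * (2 * L + 1))" by (simp add: NB_def al_def L_def algebra_simps)
    also have "\<dots> \<le> al * (L * (3 * L))" using L ak by (intro mult_left_mono) auto
    finally show "NB \<le> 3 * (al * (L * L))" by simp
  qed (simp add: NB_def)
  define D where "D = al * (L * L)"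
  have D: "1 \<le> D" using ak LL mult_mono[of 1 al 1 "L * L"] by (simp add: D_def)
  have "\<tau> \<le> \<tau> * D" using \<tau>0 D by (intro le_mult_factor)
  then have \<tau>D: "\<tau> \<le> D * \<tau>" by (simp add: mult.commute)
  have Dk: "D * \<tau> \<le> Y" "D * \<tau> * (kl * L) \<le> Y" "D * \<tau> * x \<le> Y"
  proof -
    have Y: "Y = D * \<tau> * (kl * L * x)" by (simp add: Y_def D_def power3_eq_cube mult_ac)
    have 1: "1 \<le> kl * L" using ak L mult_mono[of 1 kl 1 L] by simp
    have 2: "1 \<le> kl * L * x" using 1 x mult_mono[of 1 "kl * L" 1 x] by simp
    have 0: "0 \<le> D * \<tau>" using D \<tau>0 by simp
    show "D * \<tau> \<le> Y" unfolding Y by (rule le_mult_factor[OF 0 2])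
    show "D * \<tau> * (kl * L) \<le> Y"
    proof -
      have "0 \<le> kl * L" using 1 by linarith
      with 0 have "0 \<le> D * \<tau> * (kl * L)" by (rule mult_nonneg_nonneg)
      from le_mult_factor[OF this x] show ?thesis by (simp add: Y mult_ac)
    qed
    show "D * \<tau> * x \<le> Y"
    proof -
      have "0 \<le> x" using x by linarith
      with 0 have "0 \<le> D * \<tau> * x" by (rule mult_nonneg_nonneg)
      from le_mult_factor[OF this 1] show ?thesis by (simp add: Y mult_ac)
    qed
  qed
  have rt: "0 \<le> round_time lg" by (rule round_time_nonneg)
  have lt: "level_time a \<le> 4 * (D * \<tau>)"
  proof -
    have "NB * (round_time lg + 2) \<le> (3 * D) * \<tau>"
      using NB tr rt \<tau>0 D unfolding D_def by (intro mult_mono) auto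
    then show ?thesis using \<tau>D \<tau>0 unfolding level_time_def NB_def[symmetric] by linarith
  qed
  have t2: "real (k * lg) * (level_time a + 5 * real n + 22) \<le> 5 * Y"
  proof -
    have "level_time a + 5 * real n + 22 \<le> 5 * (D * \<tau>)" using lt \<tau>D \<tau>S L by linarith
    then have "(kl * L) * (level_time a + 5 * real n + 22) \<le> (kl * L) * (5 * (D * \<tau>))"
      using ak L by (intro mult_left_mono) auto
    also have "\<dots> \<le> 5 * Y" using Dk(2) by (simp add: mult_ac)
    finally show ?thesis by (simp add: kl_def L_def)
  qed
  have t3: "(2 * refine_bound a lg e kappa + 1) * (round_time lg + 5) \<le> 7 * Y"
  proof -
    have "refine_bound a lg e kappa = NB * x" by (simp add: refine_bound_def NB_def x_def)
    also have "\<dots> \<le> 3 * D * x" using NB x unfolding D_def by (intro mult_right_mono) auto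
    finally have rb: "refine_bound a lg e kappa \<le> 3 * D * x" .
    have "0 \<le> 2 * (3 * D * x) + 1" using D x by simp
    then have "(2 * refine_bound a lg e kappa + 1) * (round_time lg + 5) \<le> (2 * (3 * D * x) + 1) * \<tau>"
      using rb tr rt by (intro mult_mono) auto
    also have "\<dots> = 6 * (D * \<tau> * x) + \<tau>" by (simp add: algebra_simps)
    finally show ?thesis using Dk \<tau>D by linarith
  qed
  have "total_time a k e \<le> 20 * Y"
    unfolding total_time_def S_def[symmetric] using t2 t3 lt Dk(1) \<tau>D \<tau>S \<tau>0 L by linarith
  then show ?thesis by (simp add: Y_def al_def kl_def L_def x_def \<tau>_def)
qed

lemma run_prob_vertex_cut_prog:
  assumes \<epsilon>: "0 < \<epsilon>" "\<epsilon> \<le> \<epsilon>\<^sub>0" and k: "k = 3 * (c + 3)" and A: "A = c + k + 4"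
  shows "1 - 1 / real n ^ c \<le> run_prob (vertex_cut_prog (1024 * A) k Q) (cut_store n es w \<epsilon>)
    (\<lambda>t s. real t \<le> 160 * (real (1024 * A) * real k * (max 1 \<epsilon>\<^sub>0)\<^sup>2 * (1 + 100 / \<delta>)) *
        (1 / \<epsilon> * T (card E) n * min (1 / \<epsilon>) (W / (W - kappa))) * log 2 (real n) ^ 3
      \<and> approx_min_vertex_cut V E w \<epsilon> (output_set n s))"
proof -
  define k0 where "k0 = max 1 \<epsilon>\<^sub>0"
  have k0: "1 \<le> k0" "\<epsilon>\<^sub>0 \<le> k0" by (simp_all add: k0_def)
  define a where "a = 1024 * A"
  have ak: "0 < a" "0 < k" by (simp_all add: a_def A k)
  define e where "e = max 1 (1 / \<epsilon>)"
  define R where "R = W / (W - kappa)"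
  have R: "1 \<le> R" unfolding R_def by (rule W_ratio[OF order_refl kappa_less_W])
  have "1 \<le> k0 / \<epsilon>" "1 / \<epsilon> \<le> k0 / \<epsilon>"
    using \<epsilon> k0 by (simp_all add: le_divide_eq divide_right_mono)
  then have e: "1 \<le> e" "e \<le> k0 * (1 / \<epsilon>)" by (simp_all add: e_def)
  have "R \<le> k0 * R" using k0 R by simp
  then have "min e R \<le> k0 * min (1 / \<epsilon>) R" using e k0 by (auto simp: min_def)
  then have x: "e * min e R \<le> k0 * (1 / \<epsilon>) * (k0 * min (1 / \<epsilon>) R)"
    using e R k0 \<epsilon> by (intro mult_mono) auto
  have L: "real lg ^ 3 \<le> 8 * log 2 (real n) ^ 3"
    using power_mono[OF lg_le_log, of 3] by (simp add: power_mult_distrib)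
  define \<tau> where "\<tau> = (1 + 100 / \<delta>) * T (card E) n"
  have \<tau>: "0 \<le> \<tau>" using T_nonneg reads_input(1) by (simp add: \<tau>_def)
  have "total_time a k e \<le> 20 * (real a * real k * real lg ^ 3 * (e * min e R) * \<tau>)"
    unfolding R_def \<tau>_def by (rule total_time_le[OF e(1) ak])
  also have "\<dots> = (20 * (real a * real k)) * (real lg ^ 3 * (e * min e R)) * \<tau>"
    by (simp only: mult_ac)
  also have "\<dots> \<le> (20 * (real a * real k)) * ((8 * log 2 (real n) ^ 3) * (k0 * (1 / \<epsilon>) * (k0 * min (1 / \<epsilon>) R))) * \<tau>"
  proof (intro mult_right_mono mult_left_mono \<tau>)
    show "real lg ^ 3 * (e * min e R) \<le> (8 * log 2 (real n) ^ 3) * (k0 * (1 / \<epsilon>) * (k0 * min (1 / \<epsilon>) R))"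
      using e R n_ge_2 by (intro mult_mono[OF L x]) auto
  qed simp
  also have "\<dots> = 160 * (real a * real k * k0\<^sup>2 * (1 + 100 / \<delta>)) *
      (1 / \<epsilon> * T (card E) n * min (1 / \<epsilon>) R) * log 2 (real n) ^ 3"
    by (simp add: \<tau>_def power2_eq_square mult_ac)
  finally have time: "total_time a k e \<le> \<dots>" .
  show ?thesis
    unfolding a_def[symmetric] k0_def[symmetric] R_def[symmetric]
  proof (rule run_prob_ge, rule expf_fails_shift)
    have "expf (vertex_cut_prog a k Q) (cut_store n es w \<epsilon>)
      (fails (\<lambda>t s'. real t \<le> total_time a k e \<and> approx_min_vertex_cut V E w \<epsilon> (output_set n s')))
      \<le> ennreal (exp (- (real (a * lg) / 1024)) + ((3 / 4) ^ (k * lg) * real n +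
          real (k * lg) * exp (- (real (a * lg) / 1024)) + exp (- (real (a * lg) / 1024))))"
      by (rule vertex_cut_prog_fails[OF \<epsilon>(1) e_def ak(1)])
    also have "\<dots> \<le> ennreal (1 / real n ^ c)"
      unfolding a_def by (intro ennreal_leI failure_le[OF k A])
    finally show "expf (vertex_cut_prog a k Q) (cut_store n es w \<epsilon>)
      (fails (\<lambda>t s'. real t \<le> total_time a k e \<and> approx_min_vertex_cut V E w \<epsilon> (output_set n s')))
      \<le> ennreal (1 / real n ^ c)" .
  qed (use time in auto)
qed

end

theorem theorem4p2:
  fixes Q :: com and T\<^sub>i\<^sub>v\<^sub>c :: "nat \<Rightarrow> nat \<Rightarrow> real" and \<delta> :: real
  assumes ivc: "computes_min_isolating_cut Q T\<^sub>i\<^sub>v\<^sub>c"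
    and reads_input: "\<delta> > 0" "\<And>m n. \<delta> * real (m + n) \<le> T\<^sub>i\<^sub>v\<^sub>c m n"
  shows "\<forall>a::nat. \<exists>(P::com) (d::nat). \<forall>\<epsilon>\<^sub>0>0. \<exists>c>0.
    \<forall>(\<epsilon>::real) (n::nat) (E::nat set set) (es::(nat \<times> nat) list) (w::nat \<Rightarrow> real).
      0 < \<epsilon> \<longrightarrow> \<epsilon> \<le> \<epsilon>\<^sub>0 \<longrightarrow>
      simple_graph {..<n} E \<longrightarrow> lists_edges es E \<longrightarrow> (\<forall>v<n. 0 < w v) \<longrightarrow>
      (\<exists>C. vertex_cut {..<n} E C) \<longrightarrow>
      (let W = sum w {..<n}; \<kappa> = min_cut_weight {..<n} E w in
        run_prob P (cut_store n es w \<epsilon>)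
          (\<lambda>t s. real t \<le> c * (1 / \<epsilon> * T\<^sub>i\<^sub>v\<^sub>c (card E) n * min (1 / \<epsilon>) (W / (W - \<kappa>))) * log 2 (real n) ^ d
               \<and> approx_min_vertex_cut {..<n} E w \<epsilon> (output_set n s))
        \<ge> 1 - 1 / real n ^ a)"
proof (intro allI, goal_cases)
  case (1 a)
  define k where "k = 3 * (a + 3)"
  define A where "A = a + k + 4"
  show ?case
  proof (rule exI[of _ "vertex_cut_prog (1024 * A) k Q"], rule exI[of _ 3], intro allI impI, goal_cases)
    case (1 \<epsilon>\<^sub>0)
    show ?case
    proof (rule exI[of _ "160 * (real (1024 * A) * real k * (max 1 \<epsilon>\<^sub>0)\<^sup>2 * (1 + 100 / \<delta>))"],
        intro conjI allI impI, goal_cases)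
      case 1
      show ?case using reads_input(1) by (simp add: A_def k_def add_pos_pos)
    next
      case (2 \<epsilon> n E es w)
      interpret oracle_graph n E es w Q "T\<^sub>i\<^sub>v\<^sub>c" \<delta>
        by unfold_locales (use ivc reads_input 2 in auto)
      show ?case
        unfolding Let_def by (rule run_prob_vertex_cut_prog[OF 2(1,2) k_def A_def])
    qed
  qed
qed

end
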